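(* Let $u$ be a dissipative weak solution of the Camassa–Holm system and let $(S_T)_{T>0}$ be a family of sets as described in the context, of the form $S_T=L_T^{unique}\setminus Z_T$ with $Z_T$ of Lebesgue measure $0$. Then for every $T>0$ small enough, the set $$S_T(T)=\{\zeta(T):\ \zeta\in S_T,\ \zeta(\cdot)\text{ the unique characteristic of }u\text{ with }\zeta(0)=\zeta\}$$ has full Lebesgue measure in $\mathbb{R}$.
   Context: Camassa–Holm system: $\partial_t u + \partial_x(u^2/2)+P_x=0$, $P(t,x)=\frac12\int_{\mathbb{R}} e^{-|x-y|}\big(u^2(t,y)+\frac12u_x^2(t,y)\big)dy$, $P_x(t,x)=\frac12\int_{\mathbb{R}}\mathrm{sgn}(y-x)e^{-|x-y|}\big(u^2+\frac12u_x^2\big)(t,y)\,dy$, $u(0,\cdot)=u_0\in H^1(\mathbb{R})$. A weak solution is $u\in C([0,\infty)\times\mathbb{R})\cap L^\infty([0,\infty),H^1(\mathbb{R}))$ with $u(0,\cdot)=u_0$ solving the equation in the sense of distributions; it is dissipative if $u_x(t,x)\le c(1+1/t)$ for some constant $c$ and $\|u(t,\cdot)\|_{H^1}\le\|u(0,\cdot)\|_{H^1}$ for all $t>0$. Characteristics: a characteristic of $u$ emanating from $\zeta$ (at time $0$) is $\zeta(\cdot):[0,\infty)\to\mathbb{R}$ with $\zeta(0)=\zeta$, $\frac{d}{dt}\zeta(t)=u(t,\zeta(t))$, $\frac{d}{dt}u(t,\zeta(t))=-P_x(t,\zeta(t))$ (always exists, possibly non-unique). Unique forwards on $[0,T]$: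 all characteristics from $\zeta$ coincide on $[0,T]$. Unique backwards on $[0,T]$: any characteristic $\eta(\cdot)$ (from any $\eta$) with $\eta(T)=\zeta(T)$ satisfies $\eta=\zeta$ on $[0,T]$. $\omega(s)=\frac{u(s,\eta(s))-u(s,\zeta(s))}{\eta(s)-\zeta(s)}$. $L_T^{unique,N}$: the set of $\zeta$ whose characteristic is unique forwards on $[0,T]$, with $\zeta(s)$ a Lebesgue point of $u_x(s,\cdot)$ for a.e. $s\in[0,T]$, and $-N\le\omega(s)\le N$ for all $\eta\in(\zeta-\frac1N,\zeta)\cup(\zeta,\zeta+\frac1N)$, all characteristics $\eta(\cdot)$ from $\eta$ and all $s\in[0,T]$; $L_T^{unique}=\bigcup_N L_T^{unique,N}$. The family $(S_T)_{T>0}$: $S_T\subset\mathbb{R}$ such that for every $\zeta\in S_T$ the characteristic is unique forwards and backwards on $[0,T]$ and $v(t)=u_x(t,\zeta(t))$ satisfies $v(t)-v(0)=\int_0^t(u^2-\frac12v^2-P)(s,\zeta(s))ds$ on $[0,T]$ (with $u_x$ modified on null sets), $S_{T_1}\subset S_{T_2}$ for $T_1>T_2$, and $\mathbb{R}\setminus\bigcup_{T>0}S_T$ is null; such a family of the form $L_T^{unique}\setminus Z_T$ with $Z_T$ null exists by prior work. *)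

theory Defs
  imports "HOL-Analysis.Analysis"
begin

text \<open>Functions of (t,x) are curried: u t x.  ux is a (jointly measurable)
representative of the spatial weak derivative u_x.\<close>

definition test1 :: "(real \<Rightarrow> real) \<Rightarrow> (real \<Rightarrow> real) \<Rightarrow> bool" where
  "test1 \<phi> \<phi>' \<longleftrightarrow> (\<forall>x. (\<phi> has_real_derivative \<phi>' x) (at x)) \<and> continuous_on UNIV \<phi>'
      \<and> bounded {x. \<phi> x \<noteq> 0}"

definition weak_deriv :: "(real \<Rightarrow> real) \<Rightarrow> (real \<Rightarrow> real) \<Rightarrow> bool" where
  "weak_deriv f g \<longleftrightarrow>
     (\<forall>a b. set_integrable lborel {a..b} f \<and> set_integrable lborel {a..b} g) \<and>
     (\<forall>\<phi> \<phi>'. test1 \<phi> \<phi>' \<longrightarrow>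
        (LINT x|lborel. f x * \<phi>' x) = - (LINT x|lborel. g x * \<phi> x))"

definition in_H1 :: "(real \<Rightarrow> real) \<Rightarrow> (real \<Rightarrow> real) \<Rightarrow> bool" where
  "in_H1 f g \<longleftrightarrow> f \<in> borel_measurable borel \<and> g \<in> borel_measurable borel \<and>
     integrable lborel (\<lambda>x. (f x)^2) \<and> integrable lborel (\<lambda>x. (g x)^2) \<and> weak_deriv f g"

definition H1norm :: "(real \<Rightarrow> real) \<Rightarrow> (real \<Rightarrow> real) \<Rightarrow> real" where
  "H1norm f g = sqrt (LINT x|lborel. (f x)^2 + (g x)^2)"

definition CH_P :: "(real \<Rightarrow> real \<Rightarrow> real) \<Rightarrow> (real \<Rightarrow> real \<Rightarrow> real) \<Rightarrow> real \<Rightarrow> real \<Rightarrow> real" where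
  "CH_P u ux t x = 1/2 * (LINT y|lborel. exp (- \<bar>x - y\<bar>) * ((u t y)^2 + 1/2 * (ux t y)^2))"

definition CH_Px :: "(real \<Rightarrow> real \<Rightarrow> real) \<Rightarrow> (real \<Rightarrow> real \<Rightarrow> real) \<Rightarrow> real \<Rightarrow> real \<Rightarrow> real" where
  "CH_Px u ux t x = 1/2 * (LINT y|lborel. sgn (y - x) * exp (- \<bar>x - y\<bar>) * ((u t y)^2 + 1/2 * (ux t y)^2))"

definition test2 :: "(real \<Rightarrow> real \<Rightarrow> real) \<Rightarrow> (real \<Rightarrow> real \<Rightarrow> real) \<Rightarrow> (real \<Rightarrow> real \<Rightarrow> real) \<Rightarrow> bool" where
  "test2 \<phi> \<phi>t \<phi>x \<longleftrightarrow>
     (\<forall>t x. ((\<lambda>p. \<phi> (fst p) (snd p)) has_derivative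
              (\<lambda>h. fst h * \<phi>t t x + snd h * \<phi>x t x)) (at (t, x))) \<and>
     continuous_on UNIV (\<lambda>p. \<phi>t (fst p) (snd p)) \<and>
     continuous_on UNIV (\<lambda>p. \<phi>x (fst p) (snd p)) \<and>
     (\<exists>a b R. 0 < a \<and> a < b \<and> (\<forall>t x. \<phi> t x \<noteq> 0 \<longrightarrow> a \<le> t \<and> t \<le> b \<and> \<bar>x\<bar> \<le> R))"

definition weak_solution ::
  "(real \<Rightarrow> real \<Rightarrow> real) \<Rightarrow> (real \<Rightarrow> real \<Rightarrow> real) \<Rightarrow> (real \<Rightarrow> real) \<Rightarrow> bool" where
  "weak_solution u ux u0 \<longleftrightarrow>
     continuous_on ({0..} \<times> UNIV) (\<lambda>p. u (fst p) (snd p)) \<and>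
     (\<lambda>p. ux (fst p) (snd p)) \<in> borel_measurable borel \<and>
     (\<forall>t\<ge>0. in_H1 (u t) (ux t)) \<and>
     (\<exists>M. \<forall>t\<ge>0. H1norm (u t) (ux t) \<le> M) \<and>
     u 0 = u0 \<and>
     (\<forall>\<phi> \<phi>t \<phi>x. test2 \<phi> \<phi>t \<phi>x \<longrightarrow>
        (let F = (\<lambda>p. u (fst p) (snd p) * \<phi>t (fst p) (snd p)
                    + (u (fst p) (snd p))^2 / 2 * \<phi>x (fst p) (snd p)
                    - CH_Px u ux (fst p) (snd p) * \<phi> (fst p) (snd p))
         in integrable lborel F \<and> (LINT p|lborel. F p) = 0))"

definition dissipative ::
  "(real \<Rightarrow> real \<Rightarrow> real) \<Rightarrow> (real \<Rightarrow> real \<Rightarrow> real) \<Rightarrow> (real \<Rightarrow> real) \<Rightarrow> bool" where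
  "dissipative u ux u0 \<longleftrightarrow> weak_solution u ux u0 \<and>
     (\<exists>c. \<forall>t>0. AE x in lborel. ux t x \<le> c * (1 + 1 / t)) \<and>
     (\<forall>t>0. H1norm (u t) (ux t) \<le> H1norm (u 0) (ux 0))"

definition characteristic ::
  "(real \<Rightarrow> real \<Rightarrow> real) \<Rightarrow> (real \<Rightarrow> real \<Rightarrow> real) \<Rightarrow> real \<Rightarrow> (real \<Rightarrow> real) \<Rightarrow> bool" where
  "characteristic u ux \<zeta> \<zeta>c \<longleftrightarrow> \<zeta>c 0 = \<zeta> \<and>
     (\<forall>t\<ge>0. (\<zeta>c has_real_derivative u t (\<zeta>c t)) (at t within {0..})) \<and>
     (\<forall>t\<ge>0. ((\<lambda>s. CH_Px u ux s (\<zeta>c s)) has_integral (u 0 \<zeta> - u t (\<zeta>c t))) {0..t})"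

definition unique_fwd ::
  "(real \<Rightarrow> real \<Rightarrow> real) \<Rightarrow> (real \<Rightarrow> real \<Rightarrow> real) \<Rightarrow> real \<Rightarrow> real \<Rightarrow> bool" where
  "unique_fwd u ux \<zeta> T \<longleftrightarrow> (\<forall>\<zeta>1 \<zeta>2. characteristic u ux \<zeta> \<zeta>1 \<longrightarrow> characteristic u ux \<zeta> \<zeta>2 \<longrightarrow>
      (\<forall>s\<in>{0..T}. \<zeta>1 s = \<zeta>2 s))"

definition unique_bwd ::
  "(real \<Rightarrow> real \<Rightarrow> real) \<Rightarrow> (real \<Rightarrow> real \<Rightarrow> real) \<Rightarrow> real \<Rightarrow> real \<Rightarrow> bool" where
  "unique_bwd u ux \<zeta> T \<longleftrightarrow> (\<forall>\<zeta>c. characteristic u ux \<zeta> \<zeta>c \<longrightarrow>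
      (\<forall>\<eta> \<eta>c. characteristic u ux \<eta> \<eta>c \<longrightarrow> \<eta>c T = \<zeta>c T \<longrightarrow> (\<forall>s\<in>{0..T}. \<eta>c s = \<zeta>c s)))"

definition lebesgue_point :: "(real \<Rightarrow> real) \<Rightarrow> real \<Rightarrow> bool" where
  "lebesgue_point f x \<longleftrightarrow> (\<forall>a b. set_integrable lborel {a..b} f) \<and>
     ((\<lambda>r. 1 / (2 * r) * (LINT y:{x - r..x + r}|lborel. \<bar>f y - f x\<bar>)) \<longlongrightarrow> 0) (at_right 0)"

definition L_unique_N ::
  "(real \<Rightarrow> real \<Rightarrow> real) \<Rightarrow> (real \<Rightarrow> real \<Rightarrow> real) \<Rightarrow> real \<Rightarrow> nat \<Rightarrow> real set" where
  "L_unique_N u ux T N = {\<zeta>. unique_fwd u ux \<zeta> T \<and>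
     (\<forall>\<zeta>c. characteristic u ux \<zeta> \<zeta>c \<longrightarrow>
        (AE s in lborel. s \<in> {0..T} \<longrightarrow> lebesgue_point (ux s) (\<zeta>c s)) \<and>
        (\<forall>\<eta> \<in> {\<zeta> - 1 / real N<..<\<zeta>} \<union> {\<zeta><..<\<zeta> + 1 / real N}. \<forall>\<eta>c. characteristic u ux \<eta> \<eta>c \<longrightarrow>
           (\<forall>s\<in>{0..T}.
              - real N \<le> (u s (\<eta>c s) - u s (\<zeta>c s)) / (\<eta>c s - \<zeta>c s) \<and>
              (u s (\<eta>c s) - u s (\<zeta>c s)) / (\<eta>c s - \<zeta>c s) \<le> real N)))}"

definition L_unique ::
  "(real \<Rightarrow> real \<Rightarrow> real) \<Rightarrow> (real \<Rightarrow> real \<Rightarrow> real) \<Rightarrow> real \<Rightarrow> real set" where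
  "L_unique u ux T = (\<Union>N\<in>{1..}. L_unique_N u ux T N)"

definition admissible_family ::
  "(real \<Rightarrow> real \<Rightarrow> real) \<Rightarrow> (real \<Rightarrow> real \<Rightarrow> real) \<Rightarrow> (real \<Rightarrow> real set) \<Rightarrow> bool" where
  "admissible_family u ux S \<longleftrightarrow>
     (\<forall>T>0. \<forall>\<zeta>\<in>S T. unique_fwd u ux \<zeta> T \<and> unique_bwd u ux \<zeta> T \<and>
        (\<forall>\<zeta>c. characteristic u ux \<zeta> \<zeta>c \<longrightarrow> (\<forall>t\<in>{0..T}.
          ((\<lambda>s. (u s (\<zeta>c s))^2 - 1/2 * (ux s (\<zeta>c s))^2 - CH_P u ux s (\<zeta>c s))
             has_integral (ux t (\<zeta>c t) - ux 0 \<zeta>)) {0..t}))) \<and>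
     (\<forall>T1 T2. 0 < T2 \<longrightarrow> T2 < T1 \<longrightarrow> S T1 \<subseteq> S T2) \<and>
     UNIV - (\<Union>T\<in>{0<..}. S T) \<in> null_sets lebesgue"

definition image_at ::
  "(real \<Rightarrow> real \<Rightarrow> real) \<Rightarrow> (real \<Rightarrow> real \<Rightarrow> real) \<Rightarrow> real set \<Rightarrow> real \<Rightarrow> real set" where
  "image_at u ux A T = {\<zeta>c T | \<zeta> \<zeta>c. \<zeta> \<in> A \<and> characteristic u ux \<zeta> \<zeta>c}"

end

theory Submission
  imports Defs "HOL-Complex_Analysis.Great_Picard"
begin

text \<open>Let \<open>\<zeta> \<in> S \<tau>\<close> for some small \<open>\<tau> > 0\<close>. By the Oleinik bound the flow from time \<open>\<tau>\<close> to \<open>T\<close> is a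
  monotone Lipschitz map, and its values at the points where it is not expanding form a null set
  (Vitali). Where it is expanding, difference quotients of \<open>u\<close> along characteristics stay bounded,
  because \<open>\<Delta>u\<close> decreases in time at most at the rate \<open>C \<Delta>x\<close>, so that a very negative quotient
  can only occur on an interval that is collapsing; by Fubini almost every such point moves through Lebesgue points
  of \<open>ux\<close>. Hence \<open>\<zeta>\<close> lies in \<open>L_unique T\<close> except on a set with null image.

  What remains is that a null set of initial points has a null image at time \<open>T\<close>. Let \<open>L(s)\<close> be the total
  length at time \<open>s\<close> of a family of intervals covering the null set. The energy inequality upgrades
  the weak convergence \<open>ux s \<rightarrow> ux 0\<close> to strong convergence, so that \<open>L' \<le> sqrt (L * o(1))\<close> and \<open>L(s) = o(s\<^sup>2)\<close>.
  On the other hand \<open>ux\<close> satisfies a Riccati equation up to the variance of \<open>ux\<close> on small cells transported by the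
  flow, which yields the sharp Oleinik bound \<open>ux \<le> 2 / t + C\<close>, and by it lengths grow between \<open>s\<close> and \<open>T\<close> at most by
  the factor \<open>(T / s)\<^sup>2 * exp (C * T)\<close>.\<close>

section \<open>Gronwall estimates\<close>

text \<open>The obstacle is the initial time. The bound on \<open>ux\<close> in
  \<open>dissipative\<close> is of order c / t with an unspecified c. It is not integrable at 0, and
  Gronwall turns it into an expansion factor (T / s)^c between s and T, which lengths of order
  o(s^2) cannot compensate when c > 2. Hence the improvement of c to 2, the constant of the Riccati
  equation v' = - v^2 / 2, whose solution 2 / t comes down from infinity. The matching power s^2 of
  the lengths arises because L' \<le> sqrt (L * e) lets sqrt L grow only at the rate sqrt e / 2.
  From a fixed time \<tau> > 0 on, the flow is Lipschitz and covering arguments suffice. Neither the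
  existence of characteristics nor the equation for u along them is taken for granted: Peano's
  theorem gives a curve through every point at every time, and the weak equation tested along this
  curve gives the equation for u. Tracing such curves back from time T shows that every point at
  time T comes from some initial point, so that only the images of exceptional sets have to be
  controlled.\<close>

lemma DERIV_nonpos_imp_nonincreasing_open:
  fixes f :: "real \<Rightarrow> real"
  assumes "a \<le> b" and cont: "continuous_on {a..b} f"
    and der: "\<And>x. a < x \<Longrightarrow> x < b \<Longrightarrow> \<exists>y. (f has_real_derivative y) (at x) \<and> y \<le> 0"
  shows "f b \<le> f a"
proof (cases "a = b")
  case False
  then have "a < b" using assms(1) by simp
  then obtain l z where z: "a < z" "z < b" "(f has_real_derivative l) (at z)" "f b - f a = (b - a) * l"
    using MVT[OF _ cont] der real_differentiable_def by metis
  then have "l \<le> 0" using der[of z] DERIV_unique by blast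
  then have "f b - f a \<le> 0" using z(4) \<open>a < b\<close> by (simp add: mult_nonneg_nonpos)
  then show ?thesis by simp
qed simp

lemma gronwall_integral:
  fixes f :: "real \<Rightarrow> real"
  assumes ab: "a \<le> b" and k: "0 \<le> k" and cont: "continuous_on {a..b} f"
    and le: "\<And>s. a \<le> s \<Longrightarrow> s \<le> b \<Longrightarrow> f s \<le> c + k * integral {a..s} f"
  shows "f b \<le> c * exp (k * (b - a))"
proof (cases "a = b")
  case True
  then show ?thesis using le[of b] by simp
next
  case False
  define W where "W s = integral {a..s} f" for s
  define \<phi> where "\<phi> s = exp (- k * (s - a)) * (c + k * W s)" for s
  have W: "(W has_real_derivative f s) (at s within {a..b})" if "s \<in> {a..b}" for s
    unfolding W_def using integral_has_real_derivative[OF cont that] .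
  have contW: "continuous_on {a..b} W"
    using W by (meson DERIV_continuous_on)
  have "\<phi> b \<le> \<phi> a"
  proof (rule DERIV_nonpos_imp_nonincreasing_open[where f=\<phi> and a=a and b=b])
    show "a \<le> b" using ab False by simp
    show "continuous_on {a..b} \<phi>" unfolding \<phi>_def by (intro continuous_intros contW)
    fix s assume s: "a < s" "s < b"
    then have "(W has_real_derivative f s) (at s)"
      using W[of s] at_within_Icc_at[of a s b] by auto
    from DERIV_add[OF DERIV_const DERIV_cmult[OF this]]
    have L: "((\<lambda>s. c + k * W s) has_real_derivative k * f s) (at s)" by simp
    have E: "((\<lambda>s. exp (- k * (s - a))) has_real_derivative exp (- k * (s - a)) * (- k)) (at s)"
      by (auto intro!: derivative_eq_intros)
    have "(\<phi> has_real_derivative exp (- k * (s - a)) * k * (f s - (c + k * W s))) (at s)"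
      unfolding \<phi>_def by (rule DERIV_cong[OF DERIV_mult[OF E L]]) (simp add: algebra_simps)
    moreover have "exp (- k * (s - a)) * k * (f s - (c + k * W s)) \<le> 0"
      using le[of s] s k by (intro mult_nonneg_nonpos) (auto simp: W_def)
    ultimately show "\<exists>y. (\<phi> has_real_derivative y) (at s) \<and> y \<le> 0" by blast
  qed
  then have "exp (- k * (b - a)) * (c + k * W b) \<le> c" by (simp add: \<phi>_def W_def)
  then have "c + k * W b \<le> c * exp (k * (b - a))"
    by (simp add: exp_minus divide_simps mult.commute)
  then show ?thesis using le[of b] ab by (simp add: W_def)
qed

text \<open>The integral inequality is available only while \<open>z\<close> is positive. Starting
  at the last time \<open>q\<close> with \<open>z q \<le> 0\<close> brings all of {q..t} into its
  range, and the plain Gronwall inequality applies from there.\<close>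

lemma gronwall_positive_part:
  fixes z p :: "real \<Rightarrow> real"
  assumes rt: "r \<le> t" and k: "0 \<le> k" and cont: "continuous_on {r..t} z" and zr: "z r \<le> 0"
    and p0: "\<And>s. s \<in> {r..t} \<Longrightarrow> 0 \<le> p s" and pint: "p integrable_on {r..t}"
    and le: "\<And>s1 s2. r \<le> s1 \<Longrightarrow> s1 \<le> s2 \<Longrightarrow> s2 \<le> t \<Longrightarrow> (\<And>s. s1 < s \<Longrightarrow> s \<le> s2 \<Longrightarrow> 0 < z s) \<Longrightarrow>
       z s2 - z s1 \<le> integral {s1..s2} p + k * integral {s1..s2} z"
  shows "z t \<le> integral {r..t} p * exp (k * (t - r))"
proof -
  have P0: "0 \<le> integral {r..t} p" using p0 pint by (intro integral_nonneg) auto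
  show ?thesis
  proof (cases "z t \<le> 0")
    case True
    then show ?thesis using P0 by (meson exp_ge_zero order_trans mult_nonneg_nonneg)
  next
    case False
    define A where "A = {r..t} \<inter> z -` {..0}"
    have "closed A" unfolding A_def
      using continuous_closed_preimage[OF cont, of "{..0}"] by simp
    moreover have "bounded A" unfolding A_def by (meson bounded_Int bounded_closed_interval)
    moreover have "A \<noteq> {}" using zr rt by (auto simp: A_def)
    ultimately obtain q where q: "q \<in> A" "\<And>s. s \<in> A \<Longrightarrow> s \<le> q"
      by (metis compact_attains_sup compact_eq_bounded_closed)
    have qr: "r \<le> q" "q \<le> t" "z q \<le> 0" using q(1) by (auto simp: A_def)
    have pos: "0 < z s" if "q < s" "s \<le> t" for s
      using q(2)[of s] that qr by (force simp: A_def)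
    have c': "continuous_on {q..t} z" using cont qr by (meson atLeastatMost_subset_iff continuous_on_subset order_refl)
    have "z t \<le> integral {r..t} p * exp (k * (t - q))"
    proof (rule gronwall_integral[OF qr(2) k c'])
      fix s assume s: "q \<le> s" "s \<le> t"
      have "z s - z q \<le> integral {q..s} p + k * integral {q..s} z"
        using le[of q s] qr s pos by auto
      moreover have "integral {q..s} p \<le> integral {r..t} p"
        using qr s pint p0 by (intro integral_subset_le) (auto intro: integrable_on_subinterval)
      ultimately show "z s \<le> integral {r..t} p + k * integral {q..s} z" using qr by linarith
    qed
    also have "\<dots> \<le> integral {r..t} p * exp (k * (t - r))"
      using P0 qr k by (intro mult_left_mono) (auto intro: mult_left_mono)
    finally show ?thesis .
  qed
qed

section \<open>Weak derivatives\<close>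

text \<open>The tent function on [0, 2] with peak 1 at 1; its integral is 1.\<close>

definition hat :: "real \<Rightarrow> real" where
  "hat x = max 0 x - 2 * max 0 (x - 1) + max 0 (x - 2)"

text \<open>The primitive of \<open>hat\<close>: a step of class C^1 that rises from 0 to 1 on
  [0, 2]. \<open>test1\<close> and \<open>test2\<close> ask for continuous first derivatives only,
  so piecewise quadratics can serve as test functions.\<close>

definition smooth_step :: "real \<Rightarrow> real" where
  "smooth_step x = ((max 0 x)\<^sup>2 - 2 * (max 0 (x - 1))\<^sup>2 + (max 0 (x - 2))\<^sup>2) / 2"

lemma has_real_derivative_max0_square:
  "((\<lambda>x. (max 0 x)\<^sup>2) has_real_derivative 2 * max 0 x) (at (x::real))"
proof -
  consider "x < 0" | "x = 0" | "x > 0" by linarith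
  then show ?thesis
  proof cases
    case 1
    have "((\<lambda>x. 0) has_real_derivative 0) (at x)" by simp
    then have "((\<lambda>x. (max 0 x)\<^sup>2) has_real_derivative 0) (at x)"
      by (rule has_field_derivative_transform_within_open[where S="{..<0}"]) (use 1 in auto)
    then show ?thesis using 1 by simp
  next
    case 3
    have "((\<lambda>x. x\<^sup>2) has_real_derivative 2 * x) (at x)" by (auto intro!: derivative_eq_intros)
    then have "((\<lambda>x. (max 0 x)\<^sup>2) has_real_derivative 2 * x) (at x)"
      by (rule has_field_derivative_transform_within_open[where S="{0<..}"]) (use 3 in auto)
    then show ?thesis using 3 by simp
  next
    case 2
    have "((\<lambda>h. ((max 0 h)\<^sup>2) / h) \<longlongrightarrow> 0) (at (0::real))"
    proof (rule tendsto_rabs_zero_cancel, rule tendsto_sandwich[of "\<lambda>_. 0" _ _ "\<lambda>h. \<bar>h\<bar>"])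
      show "\<forall>\<^sub>F x in at (0::real). \<bar>(max 0 x)\<^sup>2 / x\<bar> \<le> \<bar>x\<bar>"
        by (rule always_eventually) (auto simp: max_def power2_eq_square)
      show "((\<lambda>h. \<bar>h\<bar>) \<longlongrightarrow> 0) (at (0::real))" by (auto intro!: tendsto_eq_intros)
    qed auto
    then show ?thesis using 2 by (simp add: DERIV_def)
  qed
qed

lemma smooth_step_has_derivative: "(smooth_step has_real_derivative hat x) (at x)"
proof -
  have *: "((\<lambda>x. (max 0 (x - c))\<^sup>2) has_real_derivative 2 * max 0 (x - c)) (at x)" for c
  proof -
    have "((\<lambda>x. x - c) has_real_derivative 1) (at x)" by (auto intro!: derivative_eq_intros)
    from DERIV_chain2[OF has_real_derivative_max0_square this] show ?thesis by simp
  qed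
  show ?thesis unfolding smooth_step_def[abs_def] hat_def
    by (rule DERIV_cong[OF DERIV_cdivide[OF DERIV_add[OF DERIV_diff[OF
            has_real_derivative_max0_square DERIV_cmult[OF *]] *]]]) (simp add: field_simps)
qed

lemma hat_bounds: "0 \<le> hat x" "hat x \<le> 1" and hat_eq_0: "x \<le> 0 \<or> 2 \<le> x \<Longrightarrow> hat x = 0"
  by (auto simp: hat_def max_def)

lemma smooth_step_eq: "x \<le> 0 \<Longrightarrow> smooth_step x = 0" "2 \<le> x \<Longrightarrow> smooth_step x = 1"
  by (auto simp: smooth_step_def max_def power2_eq_square algebra_simps)

lemma smooth_step_mono: "x \<le> y \<Longrightarrow> smooth_step x \<le> smooth_step y"
  by (rule DERIV_nonneg_imp_nondecreasing[of x y smooth_step])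
    (use smooth_step_has_derivative hat_bounds in blast)+

lemma smooth_step_bounds: "0 \<le> smooth_step x" "smooth_step x \<le> 1"
  using smooth_step_mono[of "min x 0" x] smooth_step_mono[of x "max x 2"] by (auto simp: smooth_step_eq)

lemma continuous_hat: "continuous_on A hat"
  unfolding hat_def[abs_def] by (intro continuous_intros)

lemma continuous_smooth_step: "continuous_on A smooth_step"
  unfolding smooth_step_def[abs_def] by (intro continuous_intros) auto

lemma hat_measurable [measurable]: "hat \<in> borel_measurable borel"
  by (intro borel_measurable_continuous_onI continuous_hat)

lemma smooth_step_measurable [measurable]: "smooth_step \<in> borel_measurable borel"
  by (intro borel_measurable_continuous_onI continuous_smooth_step)

lemma has_bochner_integral_hat: "has_bochner_integral lborel hat 1"
proof -
  have "has_bochner_integral lborel (\<lambda>x. hat x * indicator {0..2} x) (smooth_step 2 - smooth_step 0)"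
    by (rule has_bochner_integral_FTC_Icc_real)
      (use smooth_step_has_derivative continuous_hat[of UNIV] in \<open>auto simp: continuous_on_eq_continuous_at\<close>)
  moreover have "(\<lambda>x. hat x * indicator {0..2} x) = hat"
  proof
    show "hat x * indicator {0..2} x = hat x" for x
      using hat_eq_0[of x] by (cases "x \<in> {0..2}") auto
  qed
  ultimately show ?thesis by (simp add: smooth_step_eq)
qed

text \<open>Mollification written after the substitution x = a + y / m n: the kernel
  \<open>k\<close> stays fixed, and dominated convergence applies with the majorant B * |k|.\<close>

lemma approximate_identity:
  fixes h k :: "real \<Rightarrow> real"
  assumes h[measurable]: "h \<in> borel_measurable borel" and B: "\<And>x. \<bar>h x\<bar> \<le> B" and cont: "isCont h a"
    and k: "integrable lborel k" and m: "filterlim m at_top sequentially"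
  shows "(\<lambda>n. LINT y|lborel. h (a + y / m n) * k y) \<longlonglongrightarrow> h a * (LINT y|lborel. k y)"
proof -
  have [measurable]: "k \<in> borel_measurable borel" using k by auto
  have "(\<lambda>n. LINT y|lborel. h (a + y / m n) * k y) \<longlonglongrightarrow> (LINT y|lborel. h a * k y)"
  proof (rule integral_dominated_convergence[where w="\<lambda>y. B * \<bar>k y\<bar>"])
    show "integrable lborel (\<lambda>y. B * \<bar>k y\<bar>)" using k by auto
    show "AE y in lborel. (\<lambda>n. h (a + y / m n) * k y) \<longlonglongrightarrow> h a * k y"
    proof (rule AE_I2)
      fix y
      have "(\<lambda>n. a + y / m n) \<longlonglongrightarrow> a + 0"
        by (intro tendsto_intros tendsto_divide_0[OF tendsto_const] filterlim_at_top_imp_at_infinity m)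
      then have "(\<lambda>n. h (a + y / m n)) \<longlonglongrightarrow> h a"
        using isCont_tendsto_compose[OF cont] by simp
      then show "(\<lambda>n. h (a + y / m n) * k y) \<longlonglongrightarrow> h a * k y" by (intro tendsto_intros)
    qed
    show "AE y in lborel. norm (h (a + y / m n) * k y) \<le> B * \<bar>k y\<bar>" for n
      using B by (auto simp: abs_mult intro!: mult_right_mono)
  qed auto
  then show ?thesis by simp
qed

text \<open>The test functions are smoothed indicators of \<open>{a<..b}\<close>.\<close>

lemma weak_derivative_imp_FTC:
  fixes f g :: "real \<Rightarrow> real"
  assumes ab: "a \<le> b" and b': "b < b'" and cont: "continuous_on {a..b'} f"
    and g: "set_integrable lborel {a..b'} g"
    and weak: "\<And>\<phi> \<phi>'. test1 \<phi> \<phi>' \<Longrightarrow> (\<And>x. x \<notin> {a..b'} \<Longrightarrow> \<phi> x = 0 \<and> \<phi>' x = 0) \<Longrightarrow>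
        (LINT x|lborel. f x * \<phi>' x) = - (LINT x|lborel. g x * \<phi> x)"
  shows "f b - f a = (LINT x:{a..b}|lborel. g x)"
proof -
  \<comment> \<open>The summand 2 / (b' - b) keeps the ramp to the right of \<open>b\<close>, of
    width 2 / m n, inside {a..b'} for every \<open>n\<close>.\<close>
  define m where "m n = real n + 2 / (b' - b)" for n
  \<comment> \<open>\<open>f\<close> is controlled on {a..b'} only. Freezing it at the end points
    gives a bounded continuous function on the line, to which \<open>approximate_identity\<close>
    applies.\<close>
  define F where "F x = f (min b' (max a x))" for x
  have mpos: "m n > 0" for n using b' by (auto simp: m_def add_nonneg_pos)
  have mb: "2 / m n \<le> b' - b" for n
  proof -
    have "2 = 2 / (b' - b) * (b' - b)" using b' by (auto simp: field_simps)
    also have "\<dots> \<le> m n * (b' - b)" using b' by (intro mult_right_mono) (auto simp: m_def)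
    finally show ?thesis using mpos[of n] by (simp add: divide_le_eq mult.commute)
  qed
  have mtop: "filterlim m at_top sequentially"
    unfolding m_def
    by (rule filterlim_tendsto_add_at_top[OF tendsto_const filterlim_real_sequentially, THEN filterlim_cong[THEN iffD1, rotated -1]]) auto
  have contF: "continuous_on UNIV F" unfolding F_def
    by (rule continuous_on_compose2[OF cont]) (use ab b' in \<open>auto intro!: continuous_intros\<close>)
  then have [measurable]: "F \<in> borel_measurable borel" by (rule borel_measurable_continuous_onI)
  have "compact (f ` {a..b'})" using cont by (intro compact_continuous_image) auto
  then have "\<exists>B. \<forall>x\<in>{a..b'}. \<bar>f x\<bar> \<le> B"
    using compact_imp_bounded[of "f ` {a..b'}"] by (auto simp: bounded_iff)
  then obtain B where "\<forall>x\<in>{a..b'}. \<bar>f x\<bar> \<le> B" ..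
  then have B: "\<And>x. x \<in> {a..b'} \<Longrightarrow> \<bar>f x\<bar> \<le> B" by blast
  have FB: "\<bar>F x\<bar> \<le> B" for x unfolding F_def using ab b' by (intro B) auto
  have isF: "isCont F x" for x using contF by (simp add: continuous_on_eq_continuous_at)
  \<comment> \<open>Both ramps lie to the right of their base points, so the support stays in
    {a..b'}. When the variable is time and a > 0, the test functions therefore keep away from t
    \<le> 0.\<close>
  define \<phi> where "\<phi> n x = smooth_step (m n * (x - a)) - smooth_step (m n * (x - b))" for n x
  define \<phi>' where "\<phi>' n x = m n * hat (m n * (x - a)) - m n * hat (m n * (x - b))" for n x
  have out: "\<phi> n x = 0 \<and> \<phi>' n x = 0" if "x \<notin> {a..b'}" for n x
  proof (cases "x < a")
    case True
    then have "m n * (x - a) \<le> 0" "m n * (x - b) \<le> 0" using mpos[of n] ab by (auto simp: mult_le_0_iff)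
    then show ?thesis by (simp add: \<phi>_def \<phi>'_def smooth_step_eq hat_eq_0)
  next
    case False
    then have "x > b'" using that by auto
    then have "2 / m n \<le> x - b" "2 / m n \<le> x - a" using mb[of n] ab by linarith+
    then have "2 \<le> m n * (x - a)" "2 \<le> m n * (x - b)" using mpos[of n] by (auto simp: field_simps)
    then show ?thesis by (simp add: \<phi>_def \<phi>'_def smooth_step_eq hat_eq_0)
  qed
  have test: "test1 (\<phi> n) (\<phi>' n)" for n
  proof -
    have "(\<phi> n has_real_derivative \<phi>' n x) (at x)" for x
    proof -
      have *: "((\<lambda>x. smooth_step (m n * (x - c))) has_real_derivative hat (m n * (x - c)) * m n) (at x)" for c
        by (rule DERIV_chain2[OF smooth_step_has_derivative]) (auto intro!: derivative_eq_intros)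
      show ?thesis unfolding \<phi>_def[abs_def] \<phi>'_def
        by (auto intro!: derivative_eq_intros *)
    qed
    moreover have "continuous_on UNIV (\<phi>' n)" unfolding \<phi>'_def[abs_def]
      by (intro continuous_intros continuous_on_compose2[OF continuous_hat[of UNIV]]) auto
    moreover have "bounded {x. \<phi> n x \<noteq> 0}"
      by (rule bounded_subset[OF bounded_closed_interval[of a b']]) (use out in blast)
    ultimately show ?thesis by (simp add: test1_def)
  qed
  have eq: "(LINT x|lborel. f x * \<phi>' n x) = - (LINT x|lborel. g x * \<phi> n x)" for n
    by (rule weak[OF test out]) 
  have kint: "integrable lborel hat" and kval: "(LINT y|lborel. hat y) = 1"
    using has_bochner_integral_hat by (auto simp: has_bochner_integral_iff)
  have sub: "integrable lborel (\<lambda>x. F x * (m n * hat (m n * (x - c))))"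
    "(LINT x|lborel. F x * (m n * hat (m n * (x - c)))) = (LINT y|lborel. F (c + y / m n) * hat y)" for n c
  proof -
    have i: "integrable lborel (\<lambda>y. F (c + y / m n) * hat y)"
    proof (rule Bochner_Integration.integrable_bound[where f="\<lambda>y. B * hat y"])
      have "\<bar>F y\<bar> \<le> \<bar>B\<bar>" for y using FB[of y] by linarith
      then show "AE y in lborel. norm (F (c + y / m n) * hat y) \<le> norm (B * hat y)"
        using hat_bounds by (auto simp: abs_mult intro!: mult_right_mono)
    qed (use kint in auto)
    have *: "(\<lambda>x. F x * hat (m n * (x - c))) (c + 1 / m n * y) = F (c + y / m n) * hat y" for y
      using mpos[of n] by simp
    have "integrable lborel (\<lambda>x. F x * hat (m n * (x - c)))"
      using lborel_integrable_real_affine_iff[of "1 / m n" "\<lambda>x. F x * hat (m n * (x - c))" c] i mpos[of n] *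
      by simp
    then have "integrable lborel (\<lambda>x. m n * (F x * hat (m n * (x - c))))" by simp
    then show "integrable lborel (\<lambda>x. F x * (m n * hat (m n * (x - c))))" by (simp add: mult.left_commute)
    have "(LINT x|lborel. F x * hat (m n * (x - c))) = 1 / m n * (LINT y|lborel. F (c + y / m n) * hat y)"
      using lborel_integral_real_affine[of "1 / m n" "\<lambda>x. F x * hat (m n * (x - c))" c] mpos[of n] *
      by simp
    then show "(LINT x|lborel. F x * (m n * hat (m n * (x - c)))) = (LINT y|lborel. F (c + y / m n) * hat y)"
      using mpos[of n] by (simp add: mult.left_commute[of _ "m n"])
  qed
  have "(LINT x|lborel. f x * \<phi>' n x) = (LINT y|lborel. F (a + y / m n) * hat y) - (LINT y|lborel. F (b + y / m n) * hat y)" for n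
  proof -
    have "f x * \<phi>' n x = F x * (m n * hat (m n * (x - a))) - F x * (m n * hat (m n * (x - b)))" for x
    proof (cases "x \<in> {a..b'}")
      case True
      then have "F x = f x" by (simp add: F_def)
      then show ?thesis by (simp add: \<phi>'_def algebra_simps)
    next
      case False
      then have "\<phi>' n x = 0" using out by auto
      then have *: "m n * hat (m n * (x - a)) = m n * hat (m n * (x - b))" by (simp add: \<phi>'_def)
      show ?thesis using \<open>\<phi>' n x = 0\<close> unfolding * by simp
    qed
    then show ?thesis using sub by simp
  qed
  moreover have "(\<lambda>n. (LINT y|lborel. F (a + y / m n) * hat y) - (LINT y|lborel. F (b + y / m n) * hat y)) \<longlonglongrightarrow> F a * 1 - F b * 1"
    unfolding kval[symmetric]
    by (intro tendsto_diff approximate_identity[OF _ FB isF kint mtop]) auto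
  ultimately have lim1: "(\<lambda>n. LINT x|lborel. f x * \<phi>' n x) \<longlonglongrightarrow> f a - f b"
    using ab b' by (simp add: F_def)
  define G where "G x = indicator {a..b'} x * g x" for x
  have Gint: "integrable lborel G" using g by (simp add: set_integrable_def G_def[abs_def])
  have [measurable]: "\<phi> n \<in> borel_measurable borel" for n unfolding \<phi>_def[abs_def] by measurable
  have [measurable]: "G \<in> borel_measurable borel" using Gint by auto
  have "(LINT x|lborel. g x * \<phi> n x) = (LINT x|lborel. G x * \<phi> n x)" for n
    by (rule Bochner_Integration.integral_cong) (use out in \<open>auto simp: G_def indicator_def\<close>)
  moreover have "(\<lambda>n. LINT x|lborel. G x * \<phi> n x) \<longlonglongrightarrow> (LINT x|lborel. G x * indicator {a<..b} x)"
  proof (rule integral_dominated_convergence[where w="\<lambda>x. \<bar>G x\<bar>"])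
    show "AE x in lborel. norm (G x * \<phi> n x) \<le> \<bar>G x\<bar>" for n
    proof (rule AE_I2)
      fix x
      have "\<bar>\<phi> n x\<bar> \<le> 1"
        using smooth_step_bounds[of "m n * (x - a)"] smooth_step_bounds[of "m n * (x - b)"] by (auto simp: \<phi>_def)
      then show "norm (G x * \<phi> n x) \<le> \<bar>G x\<bar>" by (simp add: abs_mult mult_left_le)
    qed
    show "AE x in lborel. (\<lambda>n. G x * \<phi> n x) \<longlonglongrightarrow> G x * indicator {a<..b} x"
    proof (rule AE_I2)
      fix x
      have lim: "(\<lambda>n. smooth_step (m n * (x - c))) \<longlonglongrightarrow> (if x \<le> c then 0 else 1)" for c
      proof (cases "x \<le> c")
        case True
        then have "smooth_step (m n * (x - c)) = 0" for n
          using mpos[of n] by (intro smooth_step_eq) (auto simp: mult_le_0_iff)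
        then show ?thesis using True by simp
      next
        case False
        have "filterlim (\<lambda>n. (x - c) * m n) at_top sequentially"
          by (rule filterlim_tendsto_pos_mult_at_top[OF tendsto_const _ mtop]) (use False in auto)
        then have "eventually (\<lambda>n. 2 \<le> (x - c) * m n) sequentially" by (simp add: filterlim_at_top)
        then have "eventually (\<lambda>n. smooth_step (m n * (x - c)) = 1) sequentially"
          by eventually_elim (auto intro: smooth_step_eq simp: mult.commute)
        then show ?thesis using False by (auto intro: tendsto_eventually)
      qed
      have "(\<lambda>n. \<phi> n x) \<longlonglongrightarrow> (if x \<le> a then 0 else 1) - (if x \<le> b then 0 else 1)"
        unfolding \<phi>_def by (intro tendsto_diff lim)
      also have "(if x \<le> a then 0 else 1) - (if x \<le> b then 0 else 1) = (indicator {a<..b} x :: real)"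
        using ab by auto
      finally show "(\<lambda>n. G x * \<phi> n x) \<longlonglongrightarrow> G x * indicator {a<..b} x" by (intro tendsto_intros)
    qed
  qed (use Gint in auto)
  moreover have "(LINT x|lborel. G x * indicator {a<..b} x) = (LINT x:{a..b}|lborel. g x)"
    unfolding set_lebesgue_integral_def
  proof (rule integral_cong_AE)
    show "AE x in lborel. G x * indicator {a<..b} x = indicat_real {a..b} x *\<^sub>R g x"
      using AE_lborel_singleton[of a] by eventually_elim (use b' in \<open>auto simp: G_def indicator_def\<close>)
    have "(\<lambda>x. indicat_real {a..b} x *\<^sub>R g x) = (\<lambda>x. indicat_real {a..b} x * G x)"
      using b' by (auto simp: G_def indicator_def)
    then show "(\<lambda>x. indicat_real {a..b} x *\<^sub>R g x) \<in> borel_measurable lborel" by simp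
  qed simp
  ultimately have "(\<lambda>n. LINT x|lborel. f x * \<phi>' n x) \<longlonglongrightarrow> - (LINT x:{a..b}|lborel. g x)"
    unfolding eq by (auto intro!: tendsto_intros)
  from LIMSEQ_unique[OF lim1 this] show ?thesis by simp
qed

section \<open>Continuous and step functions in the space of square-integrable functions\<close>

lemma power2_add_le: "(a + b)\<^sup>2 \<le> 2 * a\<^sup>2 + 2 * (b::real)\<^sup>2"
  using sum_squares_bound[of a b] by (simp add: power2_sum)

lemma dominated_convergence_0:
  fixes s :: "nat \<Rightarrow> 'a \<Rightarrow> real"
  assumes "\<And>i. s i \<in> borel_measurable M" "integrable M w"
    "AE x in M. (\<lambda>i. s i x) \<longlonglongrightarrow> 0" "\<And>i. AE x in M. norm (s i x) \<le> w x"
  shows "(\<lambda>i. LINT x|M. s i x) \<longlonglongrightarrow> 0"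
  using integral_dominated_convergence[of "\<lambda>_. 0" M s w] assms by simp

text \<open>Measurability yields continuous functions that converge to \<open>F\<close> merely
  almost everywhere. Cutting off in height (\<open>clamp\<close>) and in space (\<open>cut\<close>)
  makes this convergence dominated, and the cut-off error of \<open>F\<close> itself tends to 0 as
  well.\<close>

lemma L2_dense_continuous:
  fixes F :: "real \<Rightarrow> real"
  assumes F[measurable]: "F \<in> borel_measurable borel" and int: "integrable lborel (\<lambda>x. (F x)\<^sup>2)" and e: "0 < e"
  obtains G R where "continuous_on UNIV G" "0 < R" "\<And>x. R \<le> \<bar>x\<bar> \<Longrightarrow> G x = 0"
    "integrable lborel (\<lambda>x. (F x - G x)\<^sup>2)" "(LINT x|lborel. (F x - G x)\<^sup>2) \<le> e"
proof -
  have "F \<in> borel_measurable lebesgue" by (rule measurable_completion) simp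
  then have "F measurable_on UNIV" by (rule lebesgue_measurable_imp_measurable_on_real) simp
  then obtain N g where N: "negligible N" and g: "\<And>n. continuous_on UNIV (g n)"
    and lim: "\<And>x. x \<notin> N \<Longrightarrow> (\<lambda>n. g n x) \<longlonglongrightarrow> F x"
    unfolding measurable_on_def by auto
  have AEN: "AE x in lborel. x \<notin> N"
    using N unfolding negligible_iff_null_sets by (metis AE_completion_iff AE_not_in)
  define clamp where "clamp (k::real) x = max (- k) (min k x)" for k x :: real
  define cut where "cut (k::real) x = max 0 (min 1 (k + 1 - \<bar>x\<bar>))" for k x :: real
  have cl: "\<bar>clamp k x\<bar> \<le> \<bar>x\<bar>" "\<bar>clamp k x\<bar> \<le> k" if "0 \<le> k" for k x
    using that by (auto simp: clamp_def)
  have cu: "0 \<le> cut k x" "cut k x \<le> 1" for k x by (auto simp: cut_def)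
  have cu0: "cut k x = 0" if "k + 1 \<le> \<bar>x\<bar>" for k x using that by (auto simp: cut_def)
  have [continuous_intros]: "continuous_on UNIV (cut k)" for k unfolding cut_def by (intro continuous_intros)
  have [measurable]: "cut k \<in> borel_measurable borel" for k by (intro borel_measurable_continuous_onI continuous_intros)
  have [measurable]: "clamp k \<in> borel_measurable borel" for k
    unfolding clamp_def by (intro borel_measurable_continuous_onI continuous_intros)
  have [measurable]: "g n \<in> borel_measurable borel" for n using g by (rule borel_measurable_continuous_onI)
  define H where "H k x = cut (real k) x * clamp (real k) (F x)" for k x
  define G where "G k n x = cut (real k) x * clamp (real k) (g n x)" for k n x
  have [measurable]: "H k \<in> borel_measurable borel" "G k n \<in> borel_measurable borel" for k n
    unfolding H_def G_def by measurable
  have HF: "\<bar>F x - H k x\<bar> \<le> \<bar>F x\<bar>" for k x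
  proof -
    \<comment> \<open>Cutting off multiplies \<open>F x\<close> by a number in [0, 1], so |F x|
      dominates the error.\<close>
    have "\<exists>\<theta>. 0 \<le> \<theta> \<and> \<theta> \<le> 1 \<and> clamp (real k) (F x) = \<theta> * F x"
    proof (cases "F x = 0")
      case False
      have "0 \<le> clamp (real k) (F x) / F x \<and> clamp (real k) (F x) / F x \<le> 1"
        using False by (auto simp: clamp_def divide_simps)
      then show ?thesis using False by (intro exI[of _ "clamp (real k) (F x) / F x"]) auto
    qed (auto simp: clamp_def intro!: exI[of _ 0])
    then obtain \<theta> where \<theta>: "0 \<le> \<theta>" "\<theta> \<le> 1" "clamp (real k) (F x) = \<theta> * F x" by blast
    have "F x - H k x = (1 - cut (real k) x * \<theta>) * F x" by (simp add: H_def \<theta> algebra_simps)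
    moreover have "0 \<le> cut (real k) x * \<theta>" "cut (real k) x * \<theta> \<le> 1"
      using cu \<theta> by (auto simp: mult_le_one)
    ultimately show ?thesis by (simp add: abs_mult mult_left_le_one_le)
  qed
  have limH: "(\<lambda>k. LINT x|lborel. (F x - H k x)\<^sup>2) \<longlonglongrightarrow> 0"
  proof (rule dominated_convergence_0[where w="\<lambda>x. (F x)\<^sup>2"])
    show "AE x in lborel. (\<lambda>k. (F x - H k x)\<^sup>2) \<longlonglongrightarrow> 0"
    proof (rule AE_I2)
      fix x
      have "eventually (\<lambda>k. real k \<ge> \<bar>F x\<bar> + \<bar>x\<bar>) sequentially"
        using filterlim_real_sequentially by (simp add: filterlim_at_top)
      then have "eventually (\<lambda>k. (F x - H k x)\<^sup>2 = 0) sequentially"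
        by eventually_elim (auto simp: H_def cut_def clamp_def)
      then show "(\<lambda>k. (F x - H k x)\<^sup>2) \<longlonglongrightarrow> 0" by (rule tendsto_eventually)
    qed
    show "AE x in lborel. norm ((F x - H k x)\<^sup>2) \<le> (F x)\<^sup>2" for k
      using HF by (auto simp: abs_le_square_iff)
  qed (use int in auto)
  then have "eventually (\<lambda>k. (LINT x|lborel. (F x - H k x)\<^sup>2) < e / 4) sequentially"
    using e by (intro order_tendstoD(2)[OF limH]) auto
  then obtain k where k: "(LINT x|lborel. (F x - H k x)\<^sup>2) < e / 4"
    by (auto simp: eventually_sequentially)
  have bnd: "norm ((H k x - G k n x)\<^sup>2) \<le> indicator {- (real k + 1)..real k + 1} x * (2 * real k)\<^sup>2" for n x
  proof (cases "x \<in> {- (real k + 1)..real k + 1}")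
    case True
    have "\<bar>H k x\<bar> \<le> 1 * real k" "\<bar>G k n x\<bar> \<le> 1 * real k"
      unfolding H_def G_def abs_mult using cu cl by (intro mult_mono; force)+
    then have "\<bar>H k x - G k n x\<bar> \<le> 2 * real k" by linarith
    then have "(H k x - G k n x)\<^sup>2 \<le> (2 * real k)\<^sup>2" by (subst power2_le_iff_abs_le) auto
    then show ?thesis using True by simp
  next
    case False
    then have "H k x = 0" "G k n x = 0" unfolding H_def G_def using cu0[of "real k" x] by auto
    then show ?thesis by simp
  qed
  have ind: "integrable lborel (\<lambda>x. indicator {- (real k + 1)..real k + 1} x * (2 * real k)\<^sup>2)"
    by (intro integrable_mult_left integrable_real_indicator) auto
  have limG: "(\<lambda>n. LINT x|lborel. (H k x - G k n x)\<^sup>2) \<longlonglongrightarrow> 0"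
  proof (rule dominated_convergence_0[where w="\<lambda>x. indicator {- (real k + 1)..real k + 1} x * (2 * real k)\<^sup>2"])
    show "AE x in lborel. (\<lambda>n. (H k x - G k n x)\<^sup>2) \<longlonglongrightarrow> 0"
      using AEN
    proof eventually_elim
      case (elim x)
      have "(\<lambda>n. (H k x - G k n x)\<^sup>2) \<longlonglongrightarrow> (H k x - cut (real k) x * clamp (real k) (F x))\<^sup>2"
        unfolding G_def clamp_def by (intro tendsto_intros lim elim)
      then show ?case by (simp add: H_def)
    qed
  qed (use bnd ind in auto)
  have "eventually (\<lambda>n. (LINT x|lborel. (H k x - G k n x)\<^sup>2) < e / 4) sequentially"
    using e by (intro order_tendstoD(2)[OF limG]) auto
  then obtain n where n: "(LINT x|lborel. (H k x - G k n x)\<^sup>2) < e / 4"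
    by (auto simp: eventually_sequentially)
  have i1: "integrable lborel (\<lambda>x. (F x - H k x)\<^sup>2)"
    by (rule Bochner_Integration.integrable_bound[OF int]) (use HF in \<open>auto simp: abs_le_square_iff\<close>)
  have i2: "integrable lborel (\<lambda>x. (H k x - G k n x)\<^sup>2)"
    by (rule Bochner_Integration.integrable_bound[OF ind]) (use bnd in \<open>auto\<close>)
  have le: "(F x - G k n x)\<^sup>2 \<le> 2 * (F x - H k x)\<^sup>2 + 2 * (H k x - G k n x)\<^sup>2" for x
    using power2_add_le[of "F x - H k x" "H k x - G k n x"] by simp
  have i3: "integrable lborel (\<lambda>x. (F x - G k n x)\<^sup>2)"
    by (rule Bochner_Integration.integrable_bound[where f="\<lambda>x. 2 * (F x - H k x)\<^sup>2 + 2 * (H k x - G k n x)\<^sup>2"])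
      (use i1 i2 le in auto)
  show ?thesis
  proof
    show "continuous_on UNIV (G k n)" unfolding G_def clamp_def
      by (intro continuous_intros g)
    show "0 < real k + 1" by simp
    show "G k n x = 0" if "real k + 1 \<le> \<bar>x\<bar>" for x using cu0[OF that] by (simp add: G_def)
    show "integrable lborel (\<lambda>x. (F x - G k n x)\<^sup>2)" by fact
    have "(LINT x|lborel. (F x - G k n x)\<^sup>2) \<le> (LINT x|lborel. 2 * (F x - H k x)\<^sup>2 + 2 * (H k x - G k n x)\<^sup>2)"
      by (intro integral_mono) (use i1 i2 i3 le in auto)
    also have "\<dots> \<le> e" using k n i1 i2 by simp
    finally show "(LINT x|lborel. (F x - G k n x)\<^sup>2) \<le> e" .
  qed
qed

text \<open>Step functions suit \<open>ux\<close>: its integral over an interval is a difference of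
  values of \<open>u\<close>, which is continuous in time. This turns continuity of \<open>u\<close>
  into weak convergence of \<open>ux\<close>.\<close>

lemma L2_dense_step:
  fixes F :: "real \<Rightarrow> real"
  assumes F[measurable]: "F \<in> borel_measurable borel" and int: "integrable lborel (\<lambda>x. (F x)\<^sup>2)" and e: "0 < e"
  obtains n :: nat and a h :: real and c :: "nat \<Rightarrow> real"
  where "0 < h" "(LINT x|lborel. (F x - (\<Sum>i<n. c i * indicator {a + i * h..<a + Suc i * h} x))\<^sup>2) \<le> e"
proof -
  have "0 < e / 4" using e by simp
  then obtain G R where G: "continuous_on UNIV G" "0 < R" "\<And>x. R \<le> \<bar>x\<bar> \<Longrightarrow> G x = 0"
    "integrable lborel (\<lambda>x. (F x - G x)\<^sup>2)" "(LINT x|lborel. (F x - G x)\<^sup>2) \<le> e / 4"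
    by (rule L2_dense_continuous[OF F int]) (rule that)
  have [measurable]: "G \<in> borel_measurable borel" using G(1) by (rule borel_measurable_continuous_onI)
  \<comment> \<open>Chosen so that 2 * R * \<open>\<eta>\<^sup>2\<close> = e / 4. With the error e /
    4 of \<open>G\<close> and the factor 2 of \<open>power2_add_le\<close> the total is e.\<close>
  define \<eta> where "\<eta> = sqrt (e / (8 * R))"
  have \<eta>: "0 < \<eta>" "\<eta>\<^sup>2 = e / (8 * R)" using e G(2) by (auto simp: \<eta>_def)
  have "uniformly_continuous_on {-R..R} G"
    by (rule compact_uniformly_continuous) (use G(1) continuous_on_subset in auto)
  then obtain \<delta> where \<delta>: "0 < \<delta>" "\<And>x y. x \<in> {-R..R} \<Longrightarrow> y \<in> {-R..R} \<Longrightarrow> dist y x < \<delta> \<Longrightarrow> dist (G y) (G x) < \<eta>"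
    unfolding uniformly_continuous_on_def using \<eta>(1) by metis
  obtain n :: nat where n: "2 * R / \<delta> < real n" using reals_Archimedean2 by blast
  have n0: "0 < n" using n G(2) \<delta>(1) by (metis gr0I of_nat_0 less_asym divide_pos_pos mult_pos_pos zero_less_numeral)
  define h where "h = 2 * R / n"
  have h: "0 < h" "h < \<delta>" using n n0 G(2) \<delta>(1) by (auto simp: h_def field_simps)
  define S where "S x = (\<Sum>i<n. G (- R + i * h) * indicator {- R + i * h..<- R + Suc i * h} x)" for x
  have Snz: "S x = G (- R + i * h)" if "i < n" "x \<in> {- R + i * h..<- R + Suc i * h}" for i x
  proof -
    have "x \<notin> {- R + j * h..<- R + Suc j * h}" if "j \<noteq> i" for j :: nat
    proof
      assume A: "x \<in> {- R + j * h..<- R + Suc j * h}"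
      then have "real j * h < real (Suc i) * h" "real i * h < real (Suc j) * h"
        using \<open>x \<in> {- R + i * h..<- R + Suc i * h}\<close> by auto
      then have "real j < real (Suc i)" "real i < real (Suc j)" using h(1) by (simp_all only: mult_less_cancel_right_pos)
      then show False using that by auto
    qed
    then have "S x = (\<Sum>k<n. if k = i then G (- R + i * h) else 0)"
      unfolding S_def by (intro sum.cong refl) (use that in \<open>auto simp: indicator_def\<close>)
    then show ?thesis using that(1) by simp
  qed
  have S0: "S x = 0" if "x < - R \<or> R \<le> x" for x
    unfolding S_def
  proof (rule sum.neutral, rule ballI)
    fix i assume "i \<in> {..<n}"
    then have "real (Suc i) * h \<le> real n * h" "0 \<le> real i * h" using h(1) by (auto intro!: mult_right_mono)
    moreover have "real n * h = 2 * R" using n0 by (simp add: h_def)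
    ultimately have "x \<notin> {- R + i * h..<- R + Suc i * h}" using that by auto
    then show "G (- R + i * h) * indicator {- R + i * h..<- R + Suc i * h} x = 0" by simp
  qed
  have le1: "(G x - S x)\<^sup>2 \<le> indicator {-R..R} x * \<eta>\<^sup>2" for x
  proof (cases "- R \<le> x \<and> x < R")
    case False
    then have "S x = 0" "G x = 0" using S0[of x] G(3)[of x] by auto
    then show ?thesis by simp
  next
    case True
    define i where "i = nat \<lfloor>(x + R) / h\<rfloor>"
    have p: "0 \<le> (x + R) / h" using True h by simp
    then have i1: "real i \<le> (x + R) / h" "(x + R) / h < real i + 1" unfolding i_def by linarith+
    then have i2: "real i * h \<le> x + R" "x + R < real (Suc i) * h" using h by (auto simp: field_simps)
    have "x + R < 2 * R" using True by simp
    also have "2 * R = real n * h" using n0 by (simp add: h_def)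
    finally have "real i * h < real n * h" using i2 by linarith
    then have "i < n" using h(1) by simp
    moreover have xi: "x \<in> {- R + i * h..<- R + Suc i * h}" using i2 by auto
    ultimately have S: "S x = G (- R + i * h)" by (rule Snz)
    have "dist x (- R + i * h) < \<delta>" using i2 h(2) by (auto simp: dist_real_def algebra_simps)
    then have "dist (G x) (G (- R + i * h)) < \<eta>"
      using i2(1) True h(1) by (intro \<delta>(2)) auto
    then have "\<bar>G x - S x\<bar> \<le> \<bar>\<eta>\<bar>" using S by (simp add: dist_real_def)
    then show ?thesis using True by (simp add: abs_le_square_iff)
  qed
  have [measurable]: "S \<in> borel_measurable borel" unfolding S_def[abs_def] by measurable
  have iind: "integrable lborel (\<lambda>x. indicator {-R..R} x * \<eta>\<^sup>2)"
    by (intro integrable_mult_left integrable_real_indicator) (auto simp: emeasure_lborel_Icc_eq)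
  have i2: "integrable lborel (\<lambda>x. (G x - S x)\<^sup>2)"
    by (rule Bochner_Integration.integrable_bound[OF iind]) (use le1 in auto)
  have "(LINT x|lborel. (G x - S x)\<^sup>2) \<le> (LINT x|lborel. indicator {-R..R} x * \<eta>\<^sup>2)"
    by (rule integral_mono[OF i2 iind le1])
  also have "\<dots> = 2 * R * \<eta>\<^sup>2" using G(2) by simp
  also have "\<dots> = e / 4" using G(2) by (simp add: \<eta>(2))
  finally have e2: "(LINT x|lborel. (G x - S x)\<^sup>2) \<le> e / 4" .
  have le: "(F x - S x)\<^sup>2 \<le> 2 * (F x - G x)\<^sup>2 + 2 * (G x - S x)\<^sup>2" for x
    using power2_add_le[of "F x - G x" "G x - S x"] by simp
  have "(LINT x|lborel. (F x - S x)\<^sup>2) \<le> (LINT x|lborel. 2 * (F x - G x)\<^sup>2 + 2 * (G x - S x)\<^sup>2)"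
  proof (rule integral_mono)
    show "integrable lborel (\<lambda>x. (F x - S x)\<^sup>2)"
      by (rule Bochner_Integration.integrable_bound[where f="\<lambda>x. 2 * (F x - G x)\<^sup>2 + 2 * (G x - S x)\<^sup>2"])
        (use G(4) i2 le in auto)
  qed (use G(4) i2 le in auto)
  also have "\<dots> \<le> e" using e2 G(4,5) i2 by simp
  finally have "(LINT x|lborel. (F x - S x)\<^sup>2) \<le> e" .
  then show thesis unfolding S_def by (rule that[OF h(1)])
qed

section \<open>Null sets under Lipschitz and expanding maps\<close>

text \<open>\<open>E\<close> is split into countably many pieces on which scale and constant are
  uniform. On a piece \<open>f\<close> is injective with a Lipschitz inverse, and Lipschitz maps
  preserve null sets.\<close>

lemma negligible_if_locally_expanding_image:
  fixes f :: "real \<Rightarrow> real"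
  assumes exp: "\<And>x. x \<in> E \<Longrightarrow> \<exists>d>0. \<exists>c>0. \<forall>y\<in>E. \<bar>y - x\<bar> < d \<longrightarrow> c * \<bar>y - x\<bar> \<le> \<bar>f y - f x\<bar>"
    and neg: "negligible (f ` E)"
  shows "negligible E"
proof -
  \<comment> \<open>Fixing the integer part of x * (n + 1) confines a piece to a half-open interval
    of length 1 / (n + 1), so the local estimate holds for all its pairs of points.\<close>
  define P where "P n j = {x \<in> E. (\<forall>y\<in>E. \<bar>y - x\<bar> < 1 / real (Suc n) \<longrightarrow> \<bar>y - x\<bar> \<le> real (Suc n) * \<bar>f y - f x\<bar>)
      \<and> \<lfloor>x * real (Suc n)\<rfloor> = j}" for n :: nat and j :: int
  have cover: "E \<subseteq> (\<Union>(n, j). P n j)"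
  proof
    fix x assume x: "x \<in> E"
    then obtain d c where dc: "0 < d" "0 < c" "\<And>y. y \<in> E \<Longrightarrow> \<bar>y - x\<bar> < d \<Longrightarrow> c * \<bar>y - x\<bar> \<le> \<bar>f y - f x\<bar>"
      using exp by meson
    obtain n where n: "1 / real (Suc n) < min d c" using dc(1,2) nat_approx_posE[of "min d c"] by auto
    have "\<bar>y - x\<bar> \<le> real (Suc n) * \<bar>f y - f x\<bar>" if "y \<in> E" "\<bar>y - x\<bar> < 1 / real (Suc n)" for y
    proof -
      have "c * \<bar>y - x\<bar> \<le> \<bar>f y - f x\<bar>" using dc(3) that n by auto
      moreover have "1 / real (Suc n) * \<bar>y - x\<bar> \<le> c * \<bar>y - x\<bar>" using n by (intro mult_right_mono) auto
      ultimately have "1 / real (Suc n) * \<bar>y - x\<bar> \<le> \<bar>f y - f x\<bar>" by linarith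
      then show ?thesis by (simp add: field_simps)
    qed
    then have "x \<in> P n \<lfloor>x * real (Suc n)\<rfloor>" using x by (simp add: P_def)
    then show "x \<in> (\<Union>(n, j). P n j)" by auto
  qed
  have Pneg: "negligible (P n j)" for n j
  proof -
    have close: "\<bar>y - x\<bar> < 1 / real (Suc n)" if "x \<in> P n j" "y \<in> P n j" for x y
    proof -
      have "\<lfloor>x * real (Suc n)\<rfloor> = j" "\<lfloor>y * real (Suc n)\<rfloor> = j" using that by (auto simp: P_def)
      then have "\<bar>y * real (Suc n) - x * real (Suc n)\<bar> < 1" by linarith
      then have "\<bar>y - x\<bar> * real (Suc n) < 1" by (simp add: left_diff_distrib[symmetric] abs_mult)
      then show ?thesis by (simp add: field_simps)
    qed
    have lip: "\<bar>y - x\<bar> \<le> real (Suc n) * \<bar>f y - f x\<bar>" if "x \<in> P n j" "y \<in> P n j" for x y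
      using close[OF that] that by (auto simp: P_def)
    have inj: "inj_on f (P n j)" using lip by (fastforce intro: inj_onI)
    have "negligible (inv_into (P n j) f ` (f ` P n j))"
    proof (rule negligible_locally_Lipschitz_image[OF order_refl])
      show "negligible (f ` P n j)" by (rule negligible_subset[OF neg]) (auto simp: P_def)
      fix q assume "q \<in> f ` P n j"
      then show "\<exists>T B. open T \<and> q \<in> T \<and> (\<forall>y\<in>f ` P n j \<inter> T.
          norm (inv_into (P n j) f y - inv_into (P n j) f q) \<le> B * norm (y - q))"
        by (intro exI[of _ UNIV] exI[of _ "real (Suc n)"]) (use lip inj in auto)
    qed
    moreover have "inv_into (P n j) f ` (f ` P n j) = P n j" using inj by (simp add: image_inv_into_cancel)
    ultimately show ?thesis by simp
  qed
  have "negligible (\<Union>(range (\<lambda>(n, j). P n j)))"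
    by (rule negligible_countable_Union) (use Pneg in auto)
  then show ?thesis using cover negligible_subset by blast
qed

text \<open>Vitali covering: every point of \<open>E\<close> lies in arbitrarily small balls whose
  images fit into intervals at most 4 * c times as long. A disjoint selection covers
  \<open>E\<close> up to a null set, and this remainder has a null image because \<open>f\<close> is
  Lipschitz.\<close>

lemma negligible_image_nonexpanding_points:
  fixes f :: "real \<Rightarrow> real"
  assumes mono: "mono f" and lip: "\<And>x y. \<bar>f y - f x\<bar> \<le> L * \<bar>y - x\<bar>"
    and E: "\<And>x c d. x \<in> E \<Longrightarrow> 0 < c \<Longrightarrow> 0 < d \<Longrightarrow> \<exists>y. 0 < \<bar>y - x\<bar> \<and> \<bar>y - x\<bar> < d \<and> \<bar>f y - f x\<bar> < c * \<bar>y - x\<bar>"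
  shows "negligible (f ` E)"
proof -
  have L0: "0 \<le> L" using lip[of 1 0] by (metis abs_ge_zero abs_one diff_zero mult.right_neutral order_trans abs_minus_commute diff_0_right)
  have bdd: "negligible (f ` (E \<inter> ball 0 R))" if R: "0 < R" for R
    unfolding negligible_outer_le
  proof (intro allI impI)
    fix e :: real assume e: "0 < e"
    \<comment> \<open>The selected balls are disjoint with total length at most 2 * (R + 1), and 4 *
      c times this is e.\<close>
    define c where "c = e / (8 * (R + 1))"
    have c: "0 < c" using e R by (simp add: c_def)
    define K where "K = {(a, r). 0 < r \<and> ball a r \<subseteq> ball 0 (R + 1) \<and> f ` ball a r \<subseteq> cball (f a) (4 * c * r)}"
    have vit: "\<exists>i. i \<in> K \<and> x \<in> ball (fst i) (snd i) \<and> snd i < d" if x: "x \<in> E \<inter> ball 0 R" and d: "0 < d" for x d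
    proof -
      obtain y where y: "0 < \<bar>y - x\<bar>" "\<bar>y - x\<bar> < min d (1/2)" "\<bar>f y - f x\<bar> < c * \<bar>y - x\<bar>"
        using E[of x c "min d (1/2)"] x c d by auto
      define l where "l = \<bar>y - x\<bar>"
      \<comment> \<open>\<open>x\<close> is an end point of the interval between \<open>x\<close>
        and \<open>y\<close>, so the ball about the midpoint must be slightly enlarged to contain
        it. The bound L * \<kappa> \<le> c keeps the image of the added part below c * l.\<close>
      define \<kappa> where "\<kappa> = min (1/2) (c / (L + 1))"
      have \<kappa>: "0 < \<kappa>" "\<kappa> \<le> 1/2" "L * \<kappa> \<le> c"
      proof -
        show "0 < \<kappa>" using c L0 by (auto simp: \<kappa>_def)
        show "\<kappa> \<le> 1/2" unfolding \<kappa>_def by (rule min.cobounded1)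
        have "L * \<kappa> \<le> L * (c / (L + 1))" using L0 by (intro mult_left_mono) (auto simp: \<kappa>_def)
        also have "\<dots> \<le> c" using L0 c by (simp add: field_simps)
        finally show "L * \<kappa> \<le> c" .
      qed
      define a where "a = (x + y) / 2"
      define \<rho> where "\<rho> = l * (1/2 + \<kappa> / 2)"
      have l: "0 < l" "l < d" "l < 1/2" using y by (auto simp: l_def)
      have kl: "\<kappa> * l \<le> 1/2 * l" using \<kappa> l by (intro mult_right_mono) auto
      have kpos: "0 < \<kappa> * l" using \<kappa> l by simp
      have \<rho>_eq: "\<rho> = l / 2 + \<kappa> * l / 2" by (simp add: \<rho>_def algebra_simps)
      have \<rho>: "0 < \<rho>" "\<rho> < d" "\<rho> < 1/2"
        unfolding \<rho>_eq using l kl kpos by linarith+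
      have \<rho>l: "l \<le> 2 * \<rho>" using kpos by (simp add: \<rho>_eq)
      have xin: "x \<in> ball a \<rho>"
      proof -
        have "\<bar>a - x\<bar> = l / 2" by (simp add: a_def l_def abs_if field_simps)
        then show ?thesis using kpos by (simp add: dist_real_def \<rho>_def algebra_simps)
      qed
      moreover have "ball a \<rho> \<subseteq> ball 0 (R + 1)"
      proof
        fix p assume "p \<in> ball a \<rho>"
        then have "\<bar>a - p\<bar> < 1/2" using \<rho> by (simp add: dist_real_def)
        moreover have "\<bar>a - x\<bar> < 1/2" using xin \<rho> by (simp add: dist_real_def)
        moreover have "\<bar>x\<bar> < R" using x by (simp add: dist_real_def)
        ultimately have "\<bar>p\<bar> < R + 1" by linarith
        then show "p \<in> ball 0 (R + 1)" by (simp add: dist_real_def)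
      qed
      moreover have "f ` ball a \<rho> \<subseteq> cball (f a) (4 * c * \<rho>)"
      proof clarify
        fix p assume p: "p \<in> ball a \<rho>"
        define x1 where "x1 = min x y" define y1 where "y1 = max x y"
        have xy: "a - x1 = l / 2" "y1 - a = l / 2" "\<bar>f y1 - f x1\<bar> < c * l" "x1 \<le> a" "a \<le> y1"
          using y by (auto simp: x1_def y1_def l_def a_def min_def max_def field_simps abs_minus_commute)
        have pb: "x1 - \<kappa> * l / 2 \<le> p" "p \<le> y1 + \<kappa> * l / 2"
          using p xy(1,2) by (auto simp: dist_real_def \<rho>_def algebra_simps abs_if split: if_splits)
        have 1: "f p \<le> f y1 + L * (\<kappa> * l / 2)"
        proof -
          have "f p \<le> f (y1 + \<kappa> * l / 2)" using monoD[OF mono] pb by blast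
          also have "\<dots> \<le> f y1 + L * \<bar>\<kappa> * l / 2\<bar>"
            using order_trans[OF abs_ge_self lip[where x=y1 and y="y1 + \<kappa> * l / 2"]] by simp
          finally show ?thesis using kpos by simp
        qed
        have 2: "f x1 - L * (\<kappa> * l / 2) \<le> f p"
        proof -
          have "f (x1 - \<kappa> * l / 2) \<le> f p" using monoD[OF mono] pb by blast
          moreover have "f x1 - L * \<bar>\<kappa> * l / 2\<bar> \<le> f (x1 - \<kappa> * l / 2)" 
            using order_trans[OF abs_ge_self lip[where y=x1 and x="x1 - \<kappa> * l / 2"]] by simp
          ultimately show ?thesis using kpos by simp
        qed
        have "L * \<kappa> * l \<le> c * l" using \<kappa> l by (intro mult_right_mono) auto
        then have 3: "L * (\<kappa> * l / 2) \<le> c * l / 2" by simp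
        have 4: "f x1 \<le> f a" "f a \<le> f y1" using monoD[OF mono] xy(4,5) by blast+
        have "0 < c * l" using c l by simp
        then have "\<bar>f a - f p\<bar> \<le> 2 * (c * l)" using 1 2 3 4 xy(3) by linarith
        also have "\<dots> \<le> 4 * c * \<rho>" using \<rho>l c by simp
        finally show "f p \<in> cball (f a) (4 * c * \<rho>)" by (simp add: dist_real_def)
      qed
      ultimately show ?thesis using \<rho> by (intro exI[of _ "(a, \<rho>)"]) (auto simp: K_def)
    qed
    obtain C where C: "countable C" "C \<subseteq> K"
      "pairwise (\<lambda>i j. disjnt (ball (fst i) (snd i)) (ball (fst j) (snd j))) C"
      "negligible (E \<inter> ball 0 R - (\<Union>i\<in>C. ball (fst i) (snd i)))"
      using Vitali_covering_theorem_balls[of "E \<inter> ball 0 R" K fst snd, OF vit] by blast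
    define D where "D i = cball (f (fst i)) (4 * c * snd i)" for i :: "real \<times> real"
    have fin: "measure lebesgue (\<Union> (D ` I)) \<le> e" if I: "I \<subseteq> C" "finite I" for I
    proof -
      have "measure lebesgue (\<Union> (D ` I)) \<le> (\<Sum>i\<in>I. measure lebesgue (D i))"
        by (rule measure_UNION_le) (use I in \<open>auto simp: D_def\<close>)
      also have "\<dots> = (\<Sum>i\<in>I. 4 * c * measure lebesgue (ball (fst i) (snd i)))"
      proof (rule sum.cong[OF refl])
        fix i assume "i \<in> I"
        then have "0 < snd i" using I C(2) by (auto simp: K_def)
        then have "0 \<le> 4 * c * snd i" "0 \<le> snd i" using c by auto
        then show "measure lebesgue (D i) = 4 * c * measure lebesgue (ball (fst i) (snd i))"
          unfolding D_def cball_eq_atLeastAtMost ball_eq_greaterThanLessThan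
          by simp
      qed
      also have "\<dots> = 4 * c * (\<Sum>i\<in>I. measure lebesgue (ball (fst i) (snd i)))" by (simp add: sum_distrib_left)
      also have "(\<Sum>i\<in>I. measure lebesgue (ball (fst i) (snd i))) = measure lebesgue (\<Union>i\<in>I. ball (fst i) (snd i))"
        by (rule measure_UNION'[symmetric]) (use I C(3) in \<open>auto intro: pairwise_subset\<close>)
      also have "\<dots> \<le> measure lebesgue (ball (0::real) (R + 1))"
      proof (rule measure_mono_fmeasurable)
        show "(\<Union>i\<in>I. ball (fst i) (snd i)) \<subseteq> ball 0 (R + 1)" using I C(2) by (force simp: K_def)
        show "(\<Union>i\<in>I. ball (fst i) (snd i)) \<in> sets lebesgue" using I by (intro sets.finite_UN) auto
      qed auto
      also have "\<dots> = 2 * (R + 1)"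
        unfolding ball_eq_greaterThanLessThan using R by simp
      also have "4 * c * (2 * (R + 1)) = e" using R by (simp add: c_def field_simps)
      finally show ?thesis using c by simp
    qed
    define N where "N = f ` (E \<inter> ball 0 R - (\<Union>i\<in>C. ball (fst i) (snd i)))"
    have "negligible N" unfolding N_def
    proof (rule negligible_locally_Lipschitz_image[OF order_refl C(4)])
      fix x
      show "\<exists>T B. open T \<and> x \<in> T \<and> (\<forall>y\<in>(E \<inter> ball 0 R - (\<Union>i\<in>C. ball (fst i) (snd i))) \<inter> T. norm (f y - f x) \<le> B * norm (y - x))"
        by (intro exI[of _ UNIV] exI[of _ L]) (use lip in auto)
    qed
    have Dm: "\<Union> (D ` C) \<in> lmeasurable" and De: "measure lebesgue (\<Union> (D ` C)) \<le> e"
      by (rule fmeasurable_UN_bound[OF C(1) _ fin] measure_UN_bound[OF C(1) _ fin]; auto simp: D_def)+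
    have "f ` (E \<inter> ball 0 R) \<subseteq> \<Union> (D ` C) \<union> N"
      using C(2) by (fastforce simp: N_def D_def K_def)
    moreover have "\<Union> (D ` C) \<union> N \<in> lmeasurable"
      using Dm \<open>negligible N\<close> by (simp add: fmeasurable.Un negligible_imp_measurable)
    moreover have "measure lebesgue (\<Union> (D ` C) \<union> N) \<le> e"
      using De Dm \<open>negligible N\<close> by (simp add: negligible_iff_null_sets measure_Un_null_set fmeasurableD)
    ultimately show "\<exists>T. f ` (E \<inter> ball 0 R) \<subseteq> T \<and> T \<in> lmeasurable \<and> measure lebesgue T \<le> e" by blast
  qed
  have "negligible (\<Union>n::nat. f ` (E \<inter> ball 0 (real (Suc n))))"
    by (rule negligible_Union_nat) (use bdd in auto)
  moreover have "f ` E \<subseteq> (\<Union>n::nat. f ` (E \<inter> ball 0 (real (Suc n))))"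
  proof clarify
    fix x assume "x \<in> E"
    moreover obtain n where "\<bar>x\<bar> < real n" using reals_Archimedean2 by blast
    ultimately have "x \<in> E \<inter> ball 0 (real (Suc n))" by (simp add: dist_real_def)
    then show "f x \<in> (\<Union>n::nat. f ` (E \<inter> ball 0 (real (Suc n))))" by blast
  qed
  ultimately show ?thesis using negligible_subset by blast
qed

section \<open>Lebesgue points\<close>

text \<open>Averages over the dyadic radii \<open>2^-k\<close> suffice, which makes the condition visibly Borel in \<open>(F, x)\<close>.\<close>

definition oscillation :: "(real \<Rightarrow> real) \<Rightarrow> real \<Rightarrow> nat \<Rightarrow> real" where
  "oscillation F x k = 2 ^ k / 2 * (LINT y:{x - 1 / 2 ^ k..x + 1 / 2 ^ k}|lborel. \<bar>F y - F x\<bar>)"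

lemma set_integrable_power2_imp:
  fixes F :: "real \<Rightarrow> real"
  assumes [measurable]: "F \<in> borel_measurable borel" and int: "integrable lborel (\<lambda>x. (F x)\<^sup>2)"
  shows "set_integrable lborel {a..b} F"
  unfolding set_integrable_def
proof (rule Bochner_Integration.integrable_bound[where f="\<lambda>x. indicator {a..b} x + (F x)\<^sup>2"])
  show "integrable lborel (\<lambda>x. indicator {a..b} x + (F x)\<^sup>2)"
    using int by (intro Bochner_Integration.integrable_add integrable_real_indicator) (auto simp: emeasure_lborel_Icc_eq)
  have "\<bar>F x\<bar> \<le> 1 + (F x)\<^sup>2" for x
    using zero_le_power2[of "\<bar>F x\<bar> - 1"] by (simp add: power2_diff)
  then show "AE x in lborel. norm (indicator {a..b} x *\<^sub>R F x) \<le> norm (indicator {a..b} x + (F x)\<^sup>2)"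
    by (auto simp: indicator_def)
qed simp

lemma set_integrable_abs_diff_const:
  fixes F :: "real \<Rightarrow> real"
  assumes [measurable]: "F \<in> borel_measurable borel" and int: "integrable lborel (\<lambda>x. (F x)\<^sup>2)"
  shows "set_integrable lborel {a..b} (\<lambda>y. \<bar>F y - c\<bar>)"
proof -
  have "set_integrable lborel {a..b} (\<lambda>y. c)" by (simp add: set_integrable_def integrable_real_indicator emeasure_lborel_Icc_eq)
  then show ?thesis by (intro set_integrable_abs set_integral_diff(1) set_integrable_power2_imp[OF assms])
qed

text \<open>A radius \<open>r\<close> is compared with the dyadic one just above it, which is less
  than 2 * r. Passing to it at most doubles the average.\<close>

lemma lebesgue_point_if_oscillation_tendsto_0:
  fixes F :: "real \<Rightarrow> real"
  assumes F: "F \<in> borel_measurable borel" and int: "integrable lborel (\<lambda>x. (F x)\<^sup>2)"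
    and lim: "oscillation F x \<longlonglongrightarrow> 0"
  shows "lebesgue_point F x"
  unfolding lebesgue_point_def
proof (intro conjI allI)
  show "set_integrable lborel {a..b} F" for a b by (rule set_integrable_power2_imp[OF F int])
  define I where "I r = (LINT y:{x - r..x + r}|lborel. \<bar>F y - F x\<bar>)" for r
  have I0: "0 \<le> I r" for r unfolding I_def set_lebesgue_integral_def by (intro integral_nonneg_AE) auto
  have Imono: "I r \<le> I s" if "r \<le> s" for r s
    unfolding I_def set_lebesgue_integral_def
    by (rule integral_mono)
      (use that set_integrable_abs_diff_const[OF F int] in \<open>auto simp: set_integrable_def indicator_def\<close>)
  show "((\<lambda>r. 1 / (2 * r) * (LINT y:{x - r..x + r}|lborel. \<bar>F y - F x\<bar>)) \<longlongrightarrow> 0) (at_right 0)"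
  proof (rule tendstoI)
    fix e :: real assume e: "0 < e"
    then have "eventually (\<lambda>k. oscillation F x k < e / 2) sequentially"
      by (intro order_tendstoD(2)[OF lim]) auto
    then obtain K where K: "\<And>k. K \<le> k \<Longrightarrow> oscillation F x k < e / 2" by (auto simp: eventually_sequentially)
    show "\<forall>\<^sub>F r in at_right 0. dist (1 / (2 * r) * (LINT y:{x - r..x + r}|lborel. \<bar>F y - F x\<bar>)) 0 < e"
    proof (rule eventually_at_rightI)
      show "(0::real) < 1 / 2 ^ K" by simp
      fix r :: real assume r: "r \<in> {0<..<1 / 2 ^ K}"
      define P where "P k \<longleftrightarrow> 1 / 2 ^ k < r" for k :: nat
      have "\<exists>k. P k" unfolding P_def
        using r real_arch_pow_inv[of r "1/2"] by (auto simp: power_one_over)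
      \<comment> \<open>\<open>1 / 2 ^ k\<close> is the first dyadic radius below \<open>r\<close>,
        so its predecessor \<open>j\<close> satisfies r \<le> 1 / 2 ^ j < 2 * r.\<close>
      define k where "k = (LEAST k. P k)"
      have Pk: "P k" unfolding k_def using \<open>\<exists>k. P k\<close> by (rule LeastI_ex)
      have nP: "\<not> P j" if "j \<le> K" for j
      proof -
        have "1 / 2 ^ K \<le> (1::real) / 2 ^ j" using that by (simp add: divide_simps)
        then show ?thesis using r by (simp add: P_def)
      qed
      then have kK: "K < k" using Pk by (meson not_le)
      define j where "j = k - 1"
      have j: "k = Suc j" "K \<le> j" using kK by (auto simp: j_def)
      have "\<not> P j" using j(1) not_less_Least[of j P] unfolding k_def by auto
      then have rj: "r \<le> 1 / 2 ^ j" by (simp add: P_def)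
      have rj2: "1 / 2 ^ j < 2 * r" using Pk j(1) by (simp add: P_def)
      have "1 / (2 * r) * I r \<le> 1 / (2 * r) * I (1 / 2 ^ j)" using r Imono[OF rj] by (intro mult_left_mono) auto
      also have "\<dots> \<le> 2 ^ j * I (1 / 2 ^ j)"
        using rj2 r I0 by (intro mult_right_mono) (auto simp: field_simps)
      also have "\<dots> = 2 * oscillation F x j" by (simp add: oscillation_def I_def)
      also have "\<dots> < e" using K[OF j(2)] by simp
      finally have "1 / (2 * r) * I r < e" .
      moreover have "0 \<le> 1 / (2 * r) * I r" using I0 r by auto
      ultimately show "dist (1 / (2 * r) * (LINT y:{x - r..x + r}|lborel. \<bar>F y - F x\<bar>)) 0 < e"
        by (simp add: I_def)
    qed
  qed
qed

text \<open>Lebesgue's differentiation theorem in its strong form. For a continuous \<open>G\<close>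
  close to \<open>F\<close> in mean square, a large oscillation at \<open>x\<close> forces (F - G)^2
  to be large either at \<open>x\<close> itself (\<open>E1\<close>, bounded by Markov's inequality)
  or on average over small intervals about \<open>x\<close> (\<open>E2\<close>, bounded by a Vitali
  covering).\<close>

lemma negligible_oscillation_not_tendsto_0:
  fixes F :: "real \<Rightarrow> real"
  assumes F[measurable]: "F \<in> borel_measurable borel" and int: "integrable lborel (\<lambda>x. (F x)\<^sup>2)"
  shows "negligible {x. \<not> oscillation F x \<longlonglongrightarrow> 0}"
proof -
  define Bad where "Bad \<eta> = {x. \<forall>m. \<exists>k\<ge>m. \<eta> < oscillation F x k}" for \<eta>
  have osc0: "0 \<le> oscillation F x k" for x k
    unfolding oscillation_def set_lebesgue_integral_def by (intro mult_nonneg_nonneg integral_nonneg_AE) auto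
  have neg: "negligible (Bad \<eta>)" if \<eta>: "0 < \<eta>" for \<eta>
    unfolding negligible_outer_le
  proof (intro allI impI)
    fix e :: real assume e: "0 < e"
    \<comment> \<open>\<open>E1\<close> and the covering of \<open>E2\<close> both get measure at
      most \<epsilon> / (\<open>\<eta>\<^sup>2\<close> / 16) = e / 2.\<close>
    define \<epsilon> where "\<epsilon> = e * \<eta>\<^sup>2 / 32"
    have \<epsilon>: "0 < \<epsilon>" using e \<eta> by (simp add: \<epsilon>_def)
    obtain G R where G: "continuous_on UNIV G" "0 < R" "\<And>x. R \<le> \<bar>x\<bar> \<Longrightarrow> G x = 0"
      "integrable lborel (\<lambda>x. (F x - G x)\<^sup>2)" "(LINT x|lborel. (F x - G x)\<^sup>2) \<le> \<epsilon>"
      by (rule L2_dense_continuous[OF F int \<epsilon>]) (rule that)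
    have [measurable]: "G \<in> borel_measurable borel" using G(1) by (rule borel_measurable_continuous_onI)
    define D where "D x = (F x - G x)\<^sup>2" for x
    have Dint: "integrable lborel D" and Dval: "(LINT x|lborel. D x) \<le> \<epsilon>" using G(4,5) by (auto simp: D_def[abs_def])
    have [measurable]: "D \<in> borel_measurable borel" unfolding D_def[abs_def] by measurable
    have D0: "0 \<le> D x" for x by (simp add: D_def)
    define E1 where "E1 = {x. \<eta>\<^sup>2 / 16 \<le> D x}"
    have E1m: "E1 \<in> sets borel" unfolding E1_def by measurable
    have E1: "E1 \<in> lmeasurable \<and> measure lebesgue E1 \<le> e / 2"
    proof -
      have p: "0 < \<eta>\<^sup>2 / 16" using \<eta> by simp
      have "emeasure lborel {x \<in> space lborel. \<eta>\<^sup>2 / 16 \<le> D x} \<le> ennreal ((LINT x|lborel. D x) / (\<eta>\<^sup>2 / 16))"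
        using integral_Markov_inequality_measure[OF Dint, of UNIV "\<eta>\<^sup>2 / 16"]
          integral_Markov_inequality[OF Dint _ p] D0 by (simp add: mult.commute)
      also have "\<dots> \<le> ennreal (e / 2)"
        using Dval p by (intro ennreal_leI) (simp add: \<epsilon>_def divide_simps)
      finally have le: "emeasure lborel E1 \<le> ennreal (e / 2)" by (simp add: E1_def)
      have "emeasure lebesgue E1 \<le> ennreal (e / 2)" using le E1m by simp
      then have "E1 \<in> lmeasurable" using E1m by (intro fmeasurableI) (auto simp: le_less_trans)
      moreover have "measure lebesgue E1 \<le> enn2real (ennreal (e / 2))"
        unfolding measure_def by (rule enn2real_mono) (use \<open>emeasure lebesgue E1 \<le> _\<close> in auto)
      then have "measure lebesgue E1 \<le> e / 2" using e by simp
      ultimately show ?thesis by simp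
    qed
    define K where "K = {(a, r). 0 < r \<and> \<eta>\<^sup>2 / 16 * (2 * r) \<le> (LINT y:{a - r..a + r}|lborel. D y)}"
    define E2 where "E2 = Bad \<eta> - E1"
    have vit: "\<exists>i. i \<in> K \<and> x \<in> cball (fst i) (snd i) \<and> snd i < d" if x: "x \<in> E2" and d: "0 < d" for x d
    proof -
      have "isCont G x" using G(1) by (simp add: continuous_on_eq_continuous_at)
      then obtain \<delta> where \<delta>: "0 < \<delta>" "\<And>y. dist y x < \<delta> \<Longrightarrow> dist (G y) (G x) < \<eta> / 4"
        unfolding continuous_at_eps_delta using \<eta> by (metis divide_pos_pos zero_less_numeral)
      obtain m where m: "(1 / 2) ^ m < min d \<delta>" using real_arch_pow_inv[of "min d \<delta>" "1/2"] d \<delta>(1) by auto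
      obtain k where k: "m \<le> k" "\<eta> < oscillation F x k" using x by (auto simp: E2_def Bad_def)
      define r where "r = (1 / 2 :: real) ^ k"
      have "r \<le> (1 / 2) ^ m" unfolding r_def using k(1) by (intro power_decreasing) auto
      then have "r < d" "r < \<delta>" using m by linarith+
      then have r: "0 < r" "r < d" "r < \<delta>" by (auto simp: r_def)
      have FG: "\<bar>G x - F x\<bar> < \<eta> / 4"
      proof -
        have "D x < (\<eta> / 4)\<^sup>2" using x by (simp add: E2_def E1_def power_divide)
        then have "\<bar>G x - F x\<bar>\<^sup>2 < (\<eta> / 4)\<^sup>2" by (simp add: D_def power2_commute)
        then show ?thesis by (rule power2_less_imp_less) (use \<eta> in simp)
      qed
      have sI: "set_integrable lborel {x - r..x + r} D"
        using Dint unfolding set_integrable_def by (intro integrable_mult_indicator) auto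
      have sc: "set_integrable lborel {x - r..x + r} (\<lambda>y. c)" for c :: real
        by (simp add: set_integrable_def integrable_real_indicator emeasure_lborel_Icc_eq)
      have "\<eta> * (2 * r) < (LINT y:{x - r..x + r}|lborel. \<bar>F y - F x\<bar>)"
        using k(2) r(1) unfolding oscillation_def r_def by (simp add: power_one_over field_simps)
      also have "\<dots> \<le> (LINT y:{x - r..x + r}|lborel. 2 / \<eta> * D y + 5 * \<eta> / 8)"
      proof (rule set_integral_mono)
        show "set_integrable lborel {x - r..x + r} (\<lambda>y. \<bar>F y - F x\<bar>)"
          by (rule set_integrable_abs_diff_const[OF F int])
        show "set_integrable lborel {x - r..x + r} (\<lambda>y. 2 / \<eta> * D y + 5 * \<eta> / 8)"
          by (intro set_integral_add set_integrable_mult_right sI sc)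
        fix y assume "y \<in> {x - r..x + r}"
        then have "dist y x < \<delta>" using r by (auto simp: dist_real_def)
        then have "\<bar>G y - G x\<bar> < \<eta> / 4" using \<delta>(2) by (simp add: dist_real_def)
        moreover have "\<bar>F y - G y\<bar> \<le> 2 / \<eta> * D y + \<eta> / 8"
        proof -
          \<comment> \<open>Completing the square replaces the first power in the oscillation by the
            square in \<open>D\<close>.\<close>
          have "0 \<le> (\<bar>F y - G y\<bar> - \<eta> / 4)\<^sup>2" by simp
          then have "\<eta> / 2 * \<bar>F y - G y\<bar> \<le> D y + \<eta>\<^sup>2 / 16"
            by (simp add: D_def power2_diff power_divide algebra_simps)
          then show ?thesis using \<eta> by (simp add: field_simps power2_eq_square)
        qed
        ultimately show "\<bar>F y - F x\<bar> \<le> 2 / \<eta> * D y + 5 * \<eta> / 8" using FG by linarith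
      qed
      also have "\<dots> = 2 / \<eta> * (LINT y:{x - r..x + r}|lborel. D y) + 5 * \<eta> / 8 * (2 * r)"
      proof -
        have "(LINT y:{x - r..x + r}|lborel. 5 * \<eta> / 8) = 5 * \<eta> / 8 * (2 * r)"
          using r(1) by (simp add: set_lebesgue_integral_def)
        then show ?thesis
          by (subst set_integral_add(2)) (auto intro!: set_integrable_mult_right sI sc)
      qed
      finally have "3 * \<eta> / 8 * (2 * r) < 2 / \<eta> * (LINT y:{x - r..x + r}|lborel. D y)" by (simp add: algebra_simps)
      then have "3 * \<eta>\<^sup>2 / 16 * (2 * r) < (LINT y:{x - r..x + r}|lborel. D y)"
        using \<eta> by (simp add: field_simps power2_eq_square)
      moreover have "\<eta>\<^sup>2 / 16 * (2 * r) \<le> 3 * \<eta>\<^sup>2 / 16 * (2 * r)" using r(1) by simp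
      ultimately have "\<eta>\<^sup>2 / 16 * (2 * r) \<le> (LINT y:{x - r..x + r}|lborel. D y)" by linarith
      then have "(x, r) \<in> K" using r(1) unfolding K_def by blast
      then show ?thesis using r by (intro exI[of _ "(x, r)"]) auto
    qed
    have K0: "\<And>i. i \<in> K \<Longrightarrow> 0 < snd i" by (auto simp: K_def)
    obtain C where C: "countable C" "C \<subseteq> K"
      "pairwise (\<lambda>i j. disjnt (cball (fst i) (snd i)) (cball (fst j) (snd j))) C"
      "negligible (E2 - (\<Union>i\<in>C. cball (fst i) (snd i)))"
      using Vitali_covering_theorem_cballs[of K snd E2 fst, OF K0 vit] by blast
    define B where "B i = cball (fst i) (snd i)" for i :: "real \<times> real"
    have Beq: "B i = {fst i - snd i..fst i + snd i}" for i by (simp add: B_def cball_eq_atLeastAtMost)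
    have fin: "measure lebesgue (\<Union> (B ` I)) \<le> e / 2" if I: "I \<subseteq> C" "finite I" for I
    proof -
      have "measure lebesgue (\<Union> (B ` I)) \<le> (\<Sum>i\<in>I. measure lebesgue (B i))"
        by (rule measure_UNION_le) (use I in \<open>auto simp: B_def\<close>)
      then have "\<eta>\<^sup>2 / 16 * measure lebesgue (\<Union> (B ` I)) \<le> \<eta>\<^sup>2 / 16 * (\<Sum>i\<in>I. measure lebesgue (B i))"
        by (intro mult_left_mono) auto
      also have "\<dots> = (\<Sum>i\<in>I. \<eta>\<^sup>2 / 16 * measure lebesgue (B i))" by (simp add: sum_distrib_left)
      also have "\<dots> \<le> (\<Sum>i\<in>I. LINT y:B i|lborel. D y)"
      proof (rule sum_mono)
        fix i assume "i \<in> I"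
        then have "i \<in> K" using I C(2) by auto
        then show "\<eta>\<^sup>2 / 16 * measure lebesgue (B i) \<le> (LINT y:B i|lborel. D y)"
          by (auto simp: K_def Beq)
      qed
      also have "\<dots> = (LINT y:(\<Union>i\<in>I. B i)|lborel. D y)"
      proof (rule set_integral_finite_Union[symmetric])
        show "disjoint_family_on B I"
          using C(3) I unfolding disjoint_family_on_def pairwise_def disjnt_def B_def by blast
        show "set_integrable lborel (B i) D" if "i \<in> I" for i
          using Dint unfolding set_integrable_def Beq by (intro integrable_mult_indicator) auto
      qed (use I Beq in auto)
      also have "\<dots> \<le> (LINT y|lborel. D y)"
        unfolding set_lebesgue_integral_def
      proof (rule integral_mono)
        show "integrable lborel (\<lambda>x. indicat_real (\<Union> (B ` I)) x *\<^sub>R D x)"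
          using Dint I(2) Beq by (intro integrable_mult_indicator) (auto intro!: sets.finite_UN)
      qed (use Dint D0 in \<open>auto simp: indicator_def\<close>)
      also have "\<dots> \<le> \<epsilon>" by (rule Dval)
      finally show ?thesis using \<eta> by (simp add: \<epsilon>_def divide_simps mult.commute)
    qed
    have Bm: "\<Union> (B ` C) \<in> lmeasurable" and Be: "measure lebesgue (\<Union> (B ` C)) \<le> e / 2"
      by (rule fmeasurable_UN_bound[OF C(1) _ fin] measure_UN_bound[OF C(1) _ fin]; auto simp: B_def)+
    define N where "N = E2 - (\<Union>i\<in>C. cball (fst i) (snd i))"
    have N: "negligible N" using C(4) by (simp add: N_def)
    have sub: "Bad \<eta> \<subseteq> (E1 \<union> \<Union> (B ` C)) \<union> N" by (auto simp: N_def E2_def B_def)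
    have EB: "E1 \<union> \<Union> (B ` C) \<in> lmeasurable" using E1 Bm by (simp add: fmeasurable.Un)
    have "measure lebesgue (E1 \<union> \<Union> (B ` C)) \<le> e"
      using measure_Un_le[of E1 lebesgue "\<Union> (B ` C)"] E1 Be Bm by (simp add: fmeasurableD)
    then have "measure lebesgue ((E1 \<union> \<Union> (B ` C)) \<union> N) \<le> e"
      using EB N by (simp add: measure_Un_null_set negligible_iff_null_sets fmeasurableD)
    moreover have "(E1 \<union> \<Union> (B ` C)) \<union> N \<in> lmeasurable"
      using EB N by (simp add: fmeasurable.Un negligible_imp_measurable)
    ultimately show "\<exists>T. Bad \<eta> \<subseteq> T \<and> T \<in> lmeasurable \<and> measure lebesgue T \<le> e" using sub by blast
  qed
  have "negligible (\<Union>n::nat. Bad (1 / real (Suc n)))" by (rule negligible_Union_nat) (use neg in auto)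
  moreover have "{x. \<not> oscillation F x \<longlonglongrightarrow> 0} \<subseteq> (\<Union>n::nat. Bad (1 / real (Suc n)))"
  proof
    fix x assume "x \<in> {x. \<not> oscillation F x \<longlonglongrightarrow> 0}"
    then obtain e where e: "0 < e" "\<And>m. \<exists>k\<ge>m. e \<le> oscillation F x k"
      using osc0[of x] unfolding LIMSEQ_def by (auto simp: not_less)
    obtain n where "1 / real (Suc n) < e" using e(1) nat_approx_posE by auto
    then have "x \<in> Bad (1 / real (Suc n))" unfolding Bad_def using e(2) less_le_trans[of "1 / real (Suc n)" e] by blast
    then show "x \<in> (\<Union>n::nat. Bad (1 / real (Suc n)))" by blast
  qed
  ultimately show ?thesis using negligible_subset by blast
qed

section \<open>Peano's existence theorem\<close>

lemma continuous_on_if_lipschitz_real: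
  fixes g :: "real \<Rightarrow> real"
  assumes "\<And>s t. \<bar>g t - g s\<bar> \<le> B * \<bar>t - s\<bar>"
  shows "continuous_on S g"
proof (rule lipschitz_on_continuous_on[where L="\<bar>B\<bar>"], rule lipschitz_onI)
  fix x y
  have "B * \<bar>x - y\<bar> \<le> \<bar>B\<bar> * \<bar>x - y\<bar>" by (intro mult_right_mono) auto
  then show "dist (g x) (g y) \<le> \<bar>B\<bar> * dist x y"
    using assms[of x y] by (simp add: dist_real_def)
qed simp

text \<open>Tonelli's scheme: the vector field is evaluated with a time delay \<open>h\<close>, so that a solution
  on \<open>[0, (k + 1) h]\<close> is obtained from one on \<open>[0, k h]\<close> by an integration.\<close>

lemma tonelli_delayed_solution:
  fixes f :: "real \<Rightarrow> real \<Rightarrow> real"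
  assumes cont: "continuous_on UNIV (\<lambda>p. f (fst p) (snd p))" and B: "\<And>t x. \<bar>f t x\<bar> \<le> B" and h: "0 < h"
  obtains \<zeta> where "\<And>s t. \<bar>\<zeta> t - \<zeta> s\<bar> \<le> B * \<bar>t - s\<bar>"
    "\<And>t. 0 \<le> t \<Longrightarrow> \<zeta> t = x0 + integral {0..t} (\<lambda>s. f s (\<zeta> (s - h)))" "\<zeta> 0 = x0"
proof -
  \<comment> \<open>\<open>y k\<close> is final on times up to k * h. For t < 0 the interval {0..t}
    is empty and the integral over it is 0, so every iterate equals \<open>x0\<close> there.\<close>
  define y where "y = rec_nat (\<lambda>t. x0) (\<lambda>k y t. x0 + integral {0..t} (\<lambda>s. f s (y (s - h))))"
  have y0: "y 0 t = x0" and yS: "y (Suc k) t = x0 + integral {0..t} (\<lambda>s. f s (y k (s - h)))" for k t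
    by (simp_all add: y_def)
  have B0: "0 \<le> B" using B[of 0 0] by linarith
  have int_lip: "\<bar>integral {0..t} g - integral {0..s} g\<bar> \<le> B * \<bar>t - s\<bar>"
    if g: "continuous_on UNIV g" "\<And>s. \<bar>g s\<bar> \<le> B" for g :: "real \<Rightarrow> real" and s t
  proof -
    have *: "\<bar>integral {0..t} g - integral {0..s} g\<bar> \<le> B * (t - s)" if st: "s \<le> t" for s t
    proof (cases "0 \<le> s")
      case True
      have gi: "g integrable_on {a..b}" for a b
        using g(1) by (intro integrable_continuous_real) (rule continuous_on_subset, auto)
      have "integral {0..s} g + integral {s..t} g = integral {0..t} g"
        by (rule Henstock_Kurzweil_Integration.integral_combine) (use True st gi in auto)
      moreover have "norm (integral {s..t} g) \<le> B * (t - s)"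
        using integral_bound[OF st, of g B] g(2) continuous_on_subset[OF g(1)] by simp
      ultimately show ?thesis by simp
    next
      case False
      then have s0: "integral {0..s} g = 0" by simp
      show ?thesis
      proof (cases "0 \<le> t")
        case True
        have "norm (integral {0..t} g) \<le> B * (t - 0)"
          using integral_bound[OF True, of g B] g(2) continuous_on_subset[OF g(1)] by simp
        also have "\<dots> \<le> B * (t - s)" using False B0 by (intro mult_left_mono) auto
        finally show ?thesis using s0 by simp
      qed (use s0 st B0 in auto)
    qed
    show ?thesis using *[of s t] *[of t s] by (cases "s \<le> t") (auto simp: abs_minus_commute)
  qed
  have ylip: "\<bar>y k t - y k s\<bar> \<le> B * \<bar>t - s\<bar>" for k s t
  proof (induction k arbitrary: s t)
    case 0
    then show ?case using B0 by (simp add: y0)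
  next
    case (Suc k)
    have "continuous_on UNIV (\<lambda>s. y k (s - h))"
      by (rule continuous_on_compose2[OF continuous_on_if_lipschitz_real[OF Suc.IH, of UNIV]])
        (auto intro!: continuous_intros)
    then have "continuous_on UNIV (\<lambda>s. f s (y k (s - h)))"
      using continuous_on_compose2[OF cont, of UNIV "\<lambda>s. (s, y k (s - h))"]
      by (simp add: continuous_on_Pair)
    from int_lip[OF this B, of t s] show ?case by (simp add: yS)
  qed
  have yeq: "y (Suc k) t = y k t" if "t \<le> real k * h" for k t
    using that
  proof (induction k arbitrary: t)
    case 0
    then show ?case by (cases "t = 0") (auto simp: y0 yS)
  next
    case (Suc k)
    have "integral {0..t} (\<lambda>s. f s (y (Suc k) (s - h))) = integral {0..t} (\<lambda>s. f s (y k (s - h)))"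
    proof (rule integral_cong)
      fix s assume "s \<in> {0..t}"
      then have "s - h \<le> real k * h" using Suc.prems by (auto simp: algebra_simps)
      then show "f s (y (Suc k) (s - h)) = f s (y k (s - h))" using Suc.IH by simp
    qed
    then show ?case by (simp only: yS)
  qed
  have yeq2: "y (k + j) t = y k t" if "t \<le> real k * h" for k j t
  proof (induction j)
    case (Suc j)
    have "real k * h \<le> real (k + j) * h" using h by (intro mult_right_mono) auto
    then have "t \<le> real (k + j) * h" using that by linarith
    then show ?case using yeq Suc by simp
  qed simp
  define \<zeta> where "\<zeta> t = y (nat \<lceil>t / h\<rceil>) t" for t
  have \<zeta>: "\<zeta> t = y k t" if t: "t \<le> real k * h" for t k
  proof -
    define m where "m = nat \<lceil>t / h\<rceil>"
    have "t / h \<le> real m" unfolding m_def by linarith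
    then have tm: "t \<le> real m * h" using h by (simp add: pos_divide_le_eq)
    have "t / h \<le> real k" using h t by (simp add: pos_divide_le_eq)
    then have "m \<le> k" unfolding m_def by (simp add: ceiling_le_iff nat_le_iff)
    then obtain j where "k = m + j" using le_Suc_ex by blast
    then show ?thesis using yeq2[OF tm, of j] by (simp add: \<zeta>_def m_def)
  qed
  have ex: "\<exists>k::nat. t \<le> real k * h" for t
  proof -
    obtain k :: nat where "t / h < real k" using reals_Archimedean2 by blast
    then show ?thesis using h by (intro exI[of _ k]) (simp add: pos_divide_less_eq)
  qed
  show thesis
  proof
    show "\<bar>\<zeta> t - \<zeta> s\<bar> \<le> B * \<bar>t - s\<bar>" for s t
    proof -
      obtain k :: nat where "max s t \<le> real k * h" using ex by blast
      then have "\<zeta> t = y k t" "\<zeta> s = y k s" using \<zeta> by auto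
      then show ?thesis using ylip by simp
    qed
    show "\<zeta> 0 = x0" using \<zeta>[of 0 0] by (simp add: y0)
    show "\<zeta> t = x0 + integral {0..t} (\<lambda>s. f s (\<zeta> (s - h)))" if "0 \<le> t" for t
    proof -
      obtain k :: nat where k: "t \<le> real k * h" using ex by blast
      have "integral {0..t} (\<lambda>s. f s (\<zeta> (s - h))) = integral {0..t} (\<lambda>s. f s (y k (s - h)))"
      proof (rule integral_cong)
        fix s assume "s \<in> {0..t}"
        then have "s - h \<le> real k * h" using k h by auto
        then show "f s (\<zeta> (s - h)) = f s (y k (s - h))" using \<zeta> by simp
      qed
      moreover have "\<zeta> t = y (Suc k) t" using \<zeta>[OF k] yeq[OF k] by simp
      ultimately show ?thesis by (simp add: yS)
    qed
  qed
qed

text \<open>The delayed solutions share the Lipschitz constant \<open>B\<close>, so a subsequence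
  that converges at all rational times converges everywhere. The delay disappears in the limit of
  the integral equation.\<close>

lemma peano_forward:
  fixes f :: "real \<Rightarrow> real \<Rightarrow> real"
  assumes cont: "continuous_on UNIV (\<lambda>p. f (fst p) (snd p))" and B: "\<And>t x. \<bar>f t x\<bar> \<le> B"
  obtains z where "z 0 = x0" "\<And>t. 0 \<le> t \<Longrightarrow> (z has_real_derivative f t (z t)) (at t within {0..})"
proof -
  define h where "h n = 1 / real (Suc n)" for n
  have h: "0 < h n" for n by (simp add: h_def)
  have "\<exists>\<zeta>. (\<forall>s t. \<bar>\<zeta> t - \<zeta> s\<bar> \<le> B * \<bar>t - s\<bar>) \<and>
    (\<forall>t\<ge>0. \<zeta> t = x0 + integral {0..t} (\<lambda>s. f s (\<zeta> (s - h n)))) \<and> \<zeta> 0 = x0" for n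
    by (rule tonelli_delayed_solution[OF cont B h[of n], of x0]) blast
  then obtain \<zeta> where lip: "\<And>n s t. \<bar>\<zeta> n t - \<zeta> n s\<bar> \<le> B * \<bar>t - s\<bar>"
    and eq: "\<And>n t. 0 \<le> t \<Longrightarrow> \<zeta> n t = x0 + integral {0..t} (\<lambda>s. f s (\<zeta> n (s - h n)))"
    and init: "\<And>n. \<zeta> n 0 = x0" by metis
  have B0: "0 \<le> B" using B[of 0 0] by linarith
  \<comment> \<open>\<open>function_convergent_subsequence\<close> asks for a bound that does not
    depend on \<open>t\<close>; hence the weight 1 + |t|.\<close>
  define g where "g n t = (\<zeta> n t - x0) / (1 + \<bar>t\<bar>)" for n t
  have gB: "norm (g n t) \<le> B" for n t
  proof -
    have "\<bar>\<zeta> n t - x0\<bar> \<le> B * \<bar>t\<bar>" using lip[of n t 0] init by simp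
    also have "\<dots> \<le> B * (1 + \<bar>t\<bar>)" using B0 by (intro mult_left_mono) auto
    finally show ?thesis by (simp add: g_def abs_divide divide_le_eq)
  qed
  obtain k where k: "strict_mono (k :: nat \<Rightarrow> nat)" "\<And>t. t \<in> \<rat> \<Longrightarrow> \<exists>l. (\<lambda>n. g (k n) t) \<longlonglongrightarrow> l"
    by (rule function_convergent_subsequence[OF countable_rat, of g B]) (use gB that in blast)+
  have convQ: "convergent (\<lambda>n. \<zeta> (k n) t)" if "t \<in> \<rat>" for t
  proof -
    from k(2)[OF that] obtain l where "(\<lambda>n. g (k n) t) \<longlonglongrightarrow> l" ..
    then have "(\<lambda>n. x0 + (1 + \<bar>t\<bar>) * g (k n) t) \<longlonglongrightarrow> x0 + (1 + \<bar>t\<bar>) * l" by (intro tendsto_intros)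
    moreover have "x0 + (1 + \<bar>t\<bar>) * g (k n) t = \<zeta> (k n) t" for n by (simp add: g_def)
    ultimately show ?thesis by (auto simp: convergent_def)
  qed
  have conv: "convergent (\<lambda>n. \<zeta> (k n) t)" for t
  proof -
    have "Cauchy (\<lambda>n. \<zeta> (k n) t)"
    proof (rule CauchyI)
      fix e :: real assume e: "0 < e"
      obtain q where q: "q \<in> \<rat>" "t < q" "q < t + e / (3 * (B + 1))"
        using Rats_dense_in_real[of t "t + e / (3 * (B + 1))"] e B0 by auto
      have close: "\<bar>\<zeta> n t - \<zeta> n q\<bar> < e / 3" for n
      proof -
        have "\<bar>\<zeta> n t - \<zeta> n q\<bar> \<le> B * (q - t)" using lip[where n=n and t=t and s=q] q by simp
        also have "\<dots> \<le> (B + 1) * (q - t)" using q by simp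
        also have "\<dots> < (B + 1) * (e / (3 * (B + 1)))" using q B0 by (intro mult_strict_left_mono) auto
        also have "\<dots> = e / 3" using B0 by (simp add: divide_simps)
        finally show ?thesis .
      qed
      have "Cauchy (\<lambda>n. \<zeta> (k n) q)" using convQ[OF q(1)] by (simp add: Cauchy_convergent_iff)
      then obtain M where M: "\<And>m n. M \<le> m \<Longrightarrow> M \<le> n \<Longrightarrow> \<bar>\<zeta> (k m) q - \<zeta> (k n) q\<bar> < e / 3"
        using e unfolding Cauchy_iff real_norm_def by (metis divide_pos_pos zero_less_numeral)
      show "\<exists>M. \<forall>m\<ge>M. \<forall>n\<ge>M. norm (\<zeta> (k m) t - \<zeta> (k n) t) < e"
      proof (intro exI[of _ M] allI impI)
        fix m n assume "M \<le> m" "M \<le> n"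
        then show "norm (\<zeta> (k m) t - \<zeta> (k n) t) < e"
          using M[of m n] close[of "k m"] close[of "k n"] unfolding real_norm_def by linarith
      qed
    qed
    then show ?thesis by (simp add: Cauchy_convergent_iff)
  qed
  define z where "z t = lim (\<lambda>n. \<zeta> (k n) t)" for t
  have zlim: "(\<lambda>n. \<zeta> (k n) t) \<longlonglongrightarrow> z t" for t
    using conv by (simp add: z_def convergent_LIMSEQ_iff)
  have zlip: "\<bar>z t - z s\<bar> \<le> B * \<bar>t - s\<bar>" for s t
    by (rule tendsto_upperbound[of "\<lambda>n. \<bar>\<zeta> (k n) t - \<zeta> (k n) s\<bar>" _ sequentially])
      (use lip zlim in \<open>auto intro!: tendsto_intros\<close>)
  have contz: "continuous_on S z" for S
    by (rule continuous_on_if_lipschitz_real[OF zlip])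
  have contfz: "continuous_on S (\<lambda>s. f s (z s))" for S
    using continuous_on_compose2[OF cont, of S "\<lambda>s. (s, z s)"] contz[of S]
    by (simp add: continuous_on_Pair)
  have isf: "((\<lambda>n. f s (a n)) \<longlonglongrightarrow> f s b)" if "a \<longlonglongrightarrow> b" for a s b
  proof -
    have "(\<lambda>n. (s, a n)) \<longlonglongrightarrow> (s, b)" using that by (intro tendsto_intros)
    then show ?thesis using continuous_on_tendsto_compose[OF cont, of "\<lambda>n. (s, a n)" "(s, b)" sequentially] by simp
  qed
  have zeq: "z t = x0 + integral {0..t} (\<lambda>s. f s (z s))" if t: "0 \<le> t" for t
  proof -
    have h0: "(\<lambda>n. h (k n)) \<longlonglongrightarrow> 0"
      using LIMSEQ_subseq_LIMSEQ[OF LIMSEQ_inverse_real_of_nat k(1)] by (simp add: h_def o_def inverse_eq_divide)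
    have delay: "(\<lambda>n. \<zeta> (k n) (s - h (k n))) \<longlonglongrightarrow> z s" for s
    proof -
      have "(\<lambda>n. \<zeta> (k n) (s - h (k n)) - \<zeta> (k n) s) \<longlonglongrightarrow> 0"
      proof (rule tendsto_rabs_zero_cancel, rule tendsto_sandwich[of "\<lambda>_. 0" _ _ "\<lambda>n. B * h (k n)"])
        show "\<forall>\<^sub>F n in sequentially. \<bar>\<zeta> (k n) (s - h (k n)) - \<zeta> (k n) s\<bar> \<le> B * h (k n)"
        proof (rule always_eventually, rule allI)
          fix n
          show "\<bar>\<zeta> (k n) (s - h (k n)) - \<zeta> (k n) s\<bar> \<le> B * h (k n)"
            using lip[where n="k n" and t="s - h (k n)" and s=s] h[of "k n"] by simp
        qed
        show "(\<lambda>n. B * h (k n)) \<longlonglongrightarrow> 0" using tendsto_mult_right_zero[OF h0] by simp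
      qed auto
      from tendsto_add[OF this zlim[of s]] show ?thesis by simp
    qed
    have "(\<lambda>n. integral {0..t} (\<lambda>s. f s (\<zeta> (k n) (s - h (k n))))) \<longlonglongrightarrow> integral {0..t} (\<lambda>s. f s (z s))"
    proof (rule dominated_convergence(2)[where h="\<lambda>_. B"])
      show "(\<lambda>s. f s (\<zeta> (k n) (s - h (k n)))) integrable_on {0..t}" for n
      proof (rule integrable_continuous_real)
        have "continuous_on {0..t} (\<lambda>s. \<zeta> (k n) (s - h (k n)))"
          by (rule continuous_on_compose2[OF continuous_on_if_lipschitz_real[OF lip, of UNIV]])
            (auto intro!: continuous_intros)
        then show "continuous_on {0..t} (\<lambda>s. f s (\<zeta> (k n) (s - h (k n))))"
          using continuous_on_compose2[OF cont, of "{0..t}" "\<lambda>s. (s, \<zeta> (k n) (s - h (k n)))"]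
          by (simp add: continuous_on_Pair)
      qed
    qed (use B isf delay in auto)
    then have "(\<lambda>n. x0 + integral {0..t} (\<lambda>s. f s (\<zeta> (k n) (s - h (k n))))) \<longlonglongrightarrow> x0 + integral {0..t} (\<lambda>s. f s (z s))"
      by (intro tendsto_intros)
    then have "(\<lambda>n. \<zeta> (k n) t) \<longlonglongrightarrow> x0 + integral {0..t} (\<lambda>s. f s (z s))"
      using eq[OF t] by simp
    then show ?thesis using LIMSEQ_unique[OF zlim] by blast
  qed
  show thesis
  proof
    show "z 0 = x0" using zeq[of 0] by simp
    show "(z has_real_derivative f t (z t)) (at t within {0..})" if t: "0 \<le> t" for t
    proof -
      have "((\<lambda>x. integral {0..x} (\<lambda>s. f s (z s))) has_real_derivative f t (z t)) (at t within {0..t+1})"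
        by (rule integral_has_real_derivative[OF contfz]) (use t in auto)
      then have "((\<lambda>x. x0 + integral {0..x} (\<lambda>s. f s (z s))) has_real_derivative f t (z t)) (at t within {0..t+1})"
        using DERIV_add[OF DERIV_const] by fastforce
      moreover have "at t within {0..t+1} = at t within {0..}"
        by (rule at_within_nhd[of _ "{..<t+1}"]) auto
      ultimately have "((\<lambda>x. x0 + integral {0..x} (\<lambda>s. f s (z s))) has_real_derivative f t (z t)) (at t within {0..})" by simp
      then show ?thesis
        by (rule has_field_derivative_transform_within[where d=1]) (use t zeq in auto)
    qed
  qed
qed

text \<open>Both time directions matter: a curve through a given point at a positive time has to be
  followed back to time 0. The left half solves the time-reversed equation.\<close>

theorem peano_existence:
  fixes f :: "real \<Rightarrow> real \<Rightarrow> real"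
  assumes cont: "continuous_on UNIV (\<lambda>p. f (fst p) (snd p))" and B: "\<And>t x. \<bar>f t x\<bar> \<le> B"
  obtains z where "z t0 = x0" "\<And>t. (z has_real_derivative f t (z t)) (at t)"
proof -
  have c1: "continuous_on UNIV (\<lambda>p. f (t0 + fst p) (snd p))"
    using continuous_on_compose2[OF cont, of UNIV "\<lambda>p. (t0 + fst p, snd p)"]
    by (simp add: continuous_on_Pair continuous_on_add continuous_on_fst continuous_on_snd)
  have c2: "continuous_on UNIV (\<lambda>p. - f (t0 - fst p) (snd p))"
    using continuous_on_compose2[OF cont, of UNIV "\<lambda>p. (t0 - fst p, snd p)"]
    by (simp add: continuous_on_Pair continuous_on_diff continuous_on_fst continuous_on_snd continuous_on_minus)
  have "\<exists>z1. z1 0 = x0 \<and> (\<forall>t\<ge>0. (z1 has_real_derivative f (t0 + t) (z1 t)) (at t within {0..}))"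
    by (rule peano_forward[OF c1, of B x0]) (use B in blast)+
  then obtain z1 where z1: "z1 0 = x0" "\<And>t. 0 \<le> t \<Longrightarrow> (z1 has_real_derivative f (t0 + t) (z1 t)) (at t within {0..})"
    by blast
  have "\<exists>z2. z2 0 = x0 \<and> (\<forall>t\<ge>0. (z2 has_real_derivative - f (t0 - t) (z2 t)) (at t within {0..}))"
    by (rule peano_forward[OF c2, of B x0]) (simp add: B, blast)
  then obtain z2 where z2: "z2 0 = x0" "\<And>t. 0 \<le> t \<Longrightarrow> (z2 has_real_derivative - f (t0 - t) (z2 t)) (at t within {0..})"
    by blast
  define z where "z t = (if t0 \<le> t then z1 (t - t0) else z2 (t0 - t))" for t
  have right: "(z has_real_derivative f t (z t)) (at t within {t0..})" if t: "t0 \<le> t" for t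
  proof -
    have "(\<lambda>t. t - t0) ` {t0..} = {0..}" by (auto simp: image_iff intro!: bexI[of _ "_ + t0"])
    then have "(z1 has_real_derivative f t (z1 (t - t0))) (at (t - t0) within (\<lambda>t. t - t0) ` {t0..})"
      using z1(2)[of "t - t0"] t by simp
    moreover have "((\<lambda>t. t - t0) has_real_derivative 1) (at t within {t0..})"
      by (auto intro!: derivative_eq_intros)
    ultimately have "(z1 \<circ> (\<lambda>t. t - t0) has_real_derivative f t (z1 (t - t0)) * 1) (at t within {t0..})"
      by (rule DERIV_image_chain)
    then have "(z1 \<circ> (\<lambda>t. t - t0) has_real_derivative f t (z t)) (at t within {t0..})"
      using t by (simp add: z_def)
    then show ?thesis
      by (rule has_field_derivative_transform_within[where d=1]) (use t in \<open>auto simp: z_def\<close>)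
  qed
  have left: "(z has_real_derivative f t (z t)) (at t within {..t0})" if t: "t \<le> t0" for t
  proof -
    have zt: "z t = z2 (t0 - t)" if "t \<le> t0" for t using that z1(1) z2(1) by (cases "t = t0") (auto simp: z_def)
    have "(\<lambda>t. t0 - t) ` {..t0} = {0..}" by (auto simp: image_iff intro!: bexI[of _ "t0 - _"])
    then have "(z2 has_real_derivative - f t (z2 (t0 - t))) (at (t0 - t) within (\<lambda>t. t0 - t) ` {..t0})"
      using z2(2)[of "t0 - t"] t by simp
    moreover have "((\<lambda>t. t0 - t) has_real_derivative - 1) (at t within {..t0})"
      by (auto intro!: derivative_eq_intros)
    ultimately have "(z2 \<circ> (\<lambda>t. t0 - t) has_real_derivative - f t (z2 (t0 - t)) * - 1) (at t within {..t0})"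
      by (rule DERIV_image_chain)
    then have "(z2 \<circ> (\<lambda>t. t0 - t) has_real_derivative f t (z t)) (at t within {..t0})"
      using t zt by simp
    then show ?thesis
      by (rule has_field_derivative_transform_within[where d=1]) (use t zt in auto)
  qed
  show thesis
  proof
    show "z t0 = x0" by (simp add: z_def z1(1))
    fix t
    consider "t < t0" | "t = t0" | "t0 < t" by linarith
    then show "(z has_real_derivative f t (z t)) (at t)"
    proof cases
      case 1
      have "at t within {..t0} = at t" by (rule at_within_nhd[of _ "{..<t0}"]) (use 1 in auto)
      then show ?thesis using left[of t] 1 by simp
    next
      case 3
      have "at t within {t0..} = at t" by (rule at_within_nhd[of _ "{t0<..}"]) (use 3 in auto)
      then show ?thesis using right[of t] 3 by simp
    next
      case 2
      have "at t0 = sup (at t0 within {..t0}) (at t0 within {t0..})"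
        unfolding at_within_union[symmetric] by (rule arg_cong[where f="\<lambda>S. at t0 within S"]) auto
      then show ?thesis
        using left[of t0] right[of t0] 2 unfolding has_field_derivative_iff by (simp add: filterlim_sup)
    qed
  qed
qed

section \<open>Energy estimates\<close>

lemma set_integrable_lborel_Icc_const: "set_integrable lborel {a..b::real} (\<lambda>x. c::real)"
  by (simp add: set_integrable_def integrable_real_indicator emeasure_lborel_Icc_eq)

lemma set_integral_lborel_Icc_const: "a \<le> b \<Longrightarrow> (LINT x:{a..b::real}|lborel. (c::real)) = c * (b - a)"
  by (simp add: set_lebesgue_integral_def)

lemma set_integrable_subset_UNIV:
  fixes f :: "real \<Rightarrow> real"
  assumes "integrable lborel f"
  shows "set_integrable lborel {a..b} f"
  using assms unfolding set_integrable_def by (intro integrable_mult_indicator) auto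

lemma set_integral_power2_diff_const:
  fixes F :: "real \<Rightarrow> real"
  assumes F: "F \<in> borel_measurable borel" and int: "integrable lborel (\<lambda>x. (F x)\<^sup>2)" and ab: "a \<le> b"
  shows "(LINT x:{a..b}|lborel. (F x - c)\<^sup>2) =
    (LINT x:{a..b}|lborel. (F x)\<^sup>2) - 2 * c * (LINT x:{a..b}|lborel. F x) + c\<^sup>2 * (b - a)"
proof -
  note i = set_integrable_subset_UNIV[OF int, of a b] set_integrable_power2_imp[OF F int, of a b]
  have "(LINT x:{a..b}|lborel. (F x - c)\<^sup>2) = (LINT x:{a..b}|lborel. ((F x)\<^sup>2 - 2 * c * F x) + c\<^sup>2)"
    by (intro set_lebesgue_integral_cong) (auto simp: power2_diff)
  also have "\<dots> = (LINT x:{a..b}|lborel. (F x)\<^sup>2 - 2 * c * F x) + (LINT x:{a..b}|lborel. c\<^sup>2)"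
    by (intro set_integral_add(2) set_integral_diff(1) set_integrable_mult_right i set_integrable_lborel_Icc_const)
  also have "(LINT x:{a..b}|lborel. (F x)\<^sup>2 - 2 * c * F x) = (LINT x:{a..b}|lborel. (F x)\<^sup>2) - (LINT x:{a..b}|lborel. 2 * c * F x)"
    by (intro set_integral_diff(2) set_integrable_mult_right i)
  finally show ?thesis using ab by (simp add: set_integral_lborel_Icc_const)
qed

lemma set_integral_lborel_nonneg:
  fixes f :: "real \<Rightarrow> real"
  shows "(\<And>x. 0 \<le> f x) \<Longrightarrow> 0 \<le> (LINT x:A|lborel. f x)"
  unfolding set_lebesgue_integral_def by (intro integral_nonneg_AE) auto

text \<open>Nonnegativity of the integral of (F - c)^2 with \<open>c\<close> the mean of
  \<open>F\<close>.\<close>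

lemma set_integral_Cauchy_Schwarz:
  fixes F :: "real \<Rightarrow> real"
  assumes F: "F \<in> borel_measurable borel" and int: "integrable lborel (\<lambda>x. (F x)\<^sup>2)" and ab: "a \<le> b"
  shows "(LINT x:{a..b}|lborel. F x)\<^sup>2 \<le> (b - a) * (LINT x:{a..b}|lborel. (F x)\<^sup>2)"
proof (cases "a = b")
  case True
  have "(LINT x:{b..b}|lborel. F x) = (LINT x:{b..b}|lborel. 0)"
    unfolding set_lebesgue_integral_def
  proof (rule integral_cong_AE)
    show "AE x in lborel. indicat_real {b..b} x *\<^sub>R F x = indicat_real {b..b} x *\<^sub>R 0"
      using AE_lborel_singleton[of b] by eventually_elim (auto simp: indicator_def)
  qed (use F in auto)
  then show ?thesis using True by simp
next
  case False
  define c where "c = (LINT x:{a..b}|lborel. F x) / (b - a)"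
  have "0 \<le> (LINT x:{a..b}|lborel. (F x - c)\<^sup>2)" by (rule set_integral_lborel_nonneg) simp
  then have "0 \<le> (b - a) * ((LINT x:{a..b}|lborel. (F x)\<^sup>2) - 2 * c * (LINT x:{a..b}|lborel. F x) + c\<^sup>2 * (b - a))"
    using set_integral_power2_diff_const[OF assms, of c] ab by simp
  also have "\<dots> = (b - a) * (LINT x:{a..b}|lborel. (F x)\<^sup>2) - (LINT x:{a..b}|lborel. F x)\<^sup>2"
  proof -
    have "l * (Q - 2 * (L / l) * L + (L / l)\<^sup>2 * l) = l * Q - L\<^sup>2" if "l \<noteq> 0" for l Q L :: real
      using that by (simp add: field_simps power2_eq_square)
    then show ?thesis unfolding c_def using False by simp
  qed
  finally show ?thesis by simp
qed

locale camassa_holm =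
  fixes u ux :: "real \<Rightarrow> real \<Rightarrow> real" and u0 :: "real \<Rightarrow> real"
  assumes diss: "dissipative u ux u0"
begin

lemma cont_u: "continuous_on ({0..} \<times> UNIV) (\<lambda>p. u (fst p) (snd p))"
  and meas_ux [measurable]: "(\<lambda>p. ux (fst p) (snd p)) \<in> borel_measurable borel"
  and in_H1: "0 \<le> t \<Longrightarrow> in_H1 (u t) (ux t)"
  using diss by (auto simp: dissipative_def weak_solution_def)

lemma meas_u_t: "0 \<le> t \<Longrightarrow> u t \<in> borel_measurable borel"
  and meas_ux_t: "0 \<le> t \<Longrightarrow> ux t \<in> borel_measurable borel"
  and int_u2: "0 \<le> t \<Longrightarrow> integrable lborel (\<lambda>x. (u t x)\<^sup>2)"
  and int_ux2: "0 \<le> t \<Longrightarrow> integrable lborel (\<lambda>x. (ux t x)\<^sup>2)"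
  using in_H1 by (auto simp: in_H1_def)

definition E0 :: real where "E0 = (LINT x|lborel. (u 0 x)\<^sup>2) + (LINT x|lborel. (ux 0 x)\<^sup>2)"

text \<open>A bound for |u| at all times, by \<open>abs_u_le\<close>.\<close>

definition B0 :: real where "B0 = 1 + E0"

lemma E0_nonneg: "0 \<le> E0" unfolding E0_def by (intro add_nonneg_nonneg integral_nonneg_AE) auto

lemma B0_pos: "1 \<le> B0" using E0_nonneg by (simp add: B0_def)

lemma energy_le:
  assumes "0 \<le> t"
  shows "(LINT x|lborel. (u t x)\<^sup>2) + (LINT x|lborel. (ux t x)\<^sup>2) \<le> E0"
proof (cases "t = 0")
  case False
  then have "H1norm (u t) (ux t) \<le> H1norm (u 0) (ux 0)" using diss assms by (simp add: dissipative_def)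
  then show ?thesis
    using int_u2[OF assms] int_ux2[OF assms] int_u2[of 0] int_ux2[of 0]
    by (simp add: H1norm_def E0_def)
qed (simp add: E0_def)

lemma integral_power2_nonneg: "0 \<le> (LINT x|lborel. (f x)\<^sup>2)" for f :: "real \<Rightarrow> real"
  by (intro integral_nonneg_AE) auto

lemma energy_ux_le: "0 \<le> t \<Longrightarrow> (LINT x|lborel. (ux t x)\<^sup>2) \<le> E0"
  using energy_le[of t] integral_power2_nonneg[of "u t"] by linarith

lemma energy_u_le: "0 \<le> t \<Longrightarrow> (LINT x|lborel. (u t x)\<^sup>2) \<le> E0"
  using energy_le[of t] integral_power2_nonneg[of "ux t"] by linarith

lemma set_integral_ux2_le: "0 \<le> t \<Longrightarrow> (LINT x:{a..b}|lborel. (ux t x)\<^sup>2) \<le> E0"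
proof -
  assume t: "0 \<le> t"
  have "(LINT x:{a..b}|lborel. (ux t x)\<^sup>2) \<le> (LINT x|lborel. (ux t x)\<^sup>2)"
    unfolding set_lebesgue_integral_def
    by (rule integral_mono) (use int_ux2[OF t] set_integrable_subset_UNIV[OF int_ux2[OF t], of a b] in
        \<open>auto simp: set_integrable_def indicator_def\<close>)
  then show ?thesis using energy_ux_le[OF t] by linarith
qed

lemma continuous_u_t: "0 \<le> t \<Longrightarrow> continuous_on S (u t)"
  using continuous_on_compose2[OF cont_u, of S "\<lambda>x. (t, x)"] by (simp add: continuous_on_Pair image_subset_iff)

lemma u_diff_eq:
  assumes t: "0 \<le> t" and ab: "a \<le> b"
  shows "u t b - u t a = (LINT x:{a..b}|lborel. ux t x)"
proof (rule weak_derivative_imp_FTC[OF ab, of "b + 1"])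
  show "continuous_on {a..b + 1} (u t)" by (rule continuous_u_t[OF t])
  show "set_integrable lborel {a..b + 1} (ux t)"
    by (rule set_integrable_power2_imp[OF meas_ux_t[OF t] int_ux2[OF t]])
  show "(LINT x|lborel. u t x * \<phi>' x) = - (LINT x|lborel. ux t x * \<phi> x)" if "test1 \<phi> \<phi>'" for \<phi> \<phi>'
    using in_H1[OF t] that by (simp add: in_H1_def weak_deriv_def)
qed simp

lemma u_diff_power2_le:
  assumes t: "0 \<le> t" and ab: "a \<le> b"
  shows "(u t b - u t a)\<^sup>2 \<le> (b - a) * (LINT x:{a..b}|lborel. (ux t x)\<^sup>2)"
  unfolding u_diff_eq[OF assms] by (rule set_integral_Cauchy_Schwarz[OF meas_ux_t[OF t] int_ux2[OF t] ab])

text \<open>|u x| is compared with |u y| by the Hoelder estimate and then averaged over y in {x..x +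
  1}. The inequality |a| \<le> (1 + a^2) / 2 brings in the energy, and the parts add up to (1 + E0)
  / 2 + 1 / 2 + E0 / 2 = 1 + E0.\<close>

lemma abs_u_le:
  assumes t: "0 \<le> t"
  shows "\<bar>u t x\<bar> \<le> B0"
proof -
  have abs_le: "\<bar>a\<bar> \<le> (1 + a\<^sup>2) / 2" for a :: real
    using zero_le_power2[of "\<bar>a\<bar> - 1"] by (simp add: power2_diff)
  have 1: "\<bar>u t x\<bar> \<le> \<bar>u t y\<bar> + (1 + E0) / 2" if y: "y \<in> {x..x + 1}" for y
  proof -
    have "\<bar>u t y - u t x\<bar> \<le> (1 + (u t y - u t x)\<^sup>2) / 2" by (rule abs_le)
    moreover have "(1 + (u t y - u t x)\<^sup>2) / 2 \<le> (1 + E0) / 2"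
    proof -
    have "(u t y - u t x)\<^sup>2 \<le> 1 * E0"
    proof (rule order_trans)
      show "(u t y - u t x)\<^sup>2 \<le> (y - x) * (LINT z:{x..y}|lborel. (ux t z)\<^sup>2)"
        using y by (intro u_diff_power2_le[OF t]) auto
      show "(y - x) * (LINT z:{x..y}|lborel. (ux t z)\<^sup>2) \<le> 1 * E0"
        using y set_integral_ux2_le[OF t] by (intro mult_mono set_integral_lborel_nonneg) auto
    qed
    then show ?thesis by simp
    qed
    ultimately have "\<bar>u t y - u t x\<bar> \<le> (1 + E0) / 2" by (rule order_trans)
    then show ?thesis by linarith
  qed
  have le: "\<bar>u t x\<bar> \<le> (1 + E0 / 2) + 1 / 2 * (u t y)\<^sup>2" if "y \<in> {x..x + 1}" for y
    using 1[OF that] abs_le[of "u t y"] by (simp add: field_simps)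
  have si: "set_integrable lborel {x..x + 1} (\<lambda>y. 1 / 2 * (u t y)\<^sup>2)"
    by (intro set_integrable_mult_right set_integrable_subset_UNIV int_u2 t)
  have "(LINT y:{x..x+1}|lborel. \<bar>u t x\<bar>) \<le> (LINT y:{x..x+1}|lborel. (1 + E0 / 2) + 1 / 2 * (u t y)\<^sup>2)"
    by (intro set_integral_mono set_integrable_lborel_Icc_const set_integral_add(1) si le)
  also have "\<dots> = (LINT y:{x..x+1}|lborel. (1 + E0 / 2)) + (LINT y:{x..x+1}|lborel. 1 / 2 * (u t y)\<^sup>2)"
    by (intro set_integral_add(2) set_integrable_lborel_Icc_const si)
  also have "\<dots> = 1 + E0 / 2 + 1 / 2 * (LINT y:{x..x+1}|lborel. (u t y)\<^sup>2)"
    by (simp add: set_integral_lborel_Icc_const)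
  also have "(LINT y:{x..x+1}|lborel. (u t y)\<^sup>2) \<le> (LINT y|lborel. (u t y)\<^sup>2)"
    unfolding set_lebesgue_integral_def
    by (rule integral_mono) (use int_u2[OF t] set_integrable_subset_UNIV[OF int_u2[OF t]] in
        \<open>auto simp: set_integrable_def indicator_def\<close>)
  also have "(LINT y|lborel. (u t y)\<^sup>2) \<le> E0" by (rule energy_u_le[OF t])
  finally show ?thesis by (simp add: set_integral_lborel_Icc_const B0_def)
qed

lemma B0_nonneg: "0 \<le> B0" using B0_pos by simp

section \<open>The kernel of P_x and its increments\<close>

definition energy_density :: "real \<Rightarrow> real \<Rightarrow> real" where
  "energy_density t y = (u t y)\<^sup>2 + 1 / 2 * (ux t y)\<^sup>2"

lemma energy_density_nonneg: "0 \<le> energy_density t y" by (simp add: energy_density_def)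

lemma integrable_energy_density: "0 \<le> t \<Longrightarrow> integrable lborel (energy_density t)"
  unfolding energy_density_def[abs_def] using int_u2 int_ux2 by auto

lemma integral_energy_density_le:
  assumes t: "0 \<le> t"
  shows "(LINT y|lborel. energy_density t y) \<le> E0"
proof -
  have "(LINT y|lborel. energy_density t y) = (LINT y|lborel. (u t y)\<^sup>2) + 1 / 2 * (LINT y|lborel. (ux t y)\<^sup>2)"
    unfolding energy_density_def using int_u2[OF t] int_ux2[OF t] by simp
  then show ?thesis using energy_le[OF t] integral_power2_nonneg[of "ux t"] by linarith
qed

definition kernel :: "real \<Rightarrow> real \<Rightarrow> real" where
  "kernel x y = sgn (y - x) * exp (- \<bar>x - y\<bar>)"

lemma abs_kernel_le: "\<bar>kernel x y\<bar> \<le> 1"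
  by (simp add: kernel_def abs_mult abs_sgn_eq)

lemma exp_diff_bounds:
  assumes "0 \<le> p" "p \<le> (q::real)"
  shows "exp (- q) \<le> exp (- p)" "exp (- p) - exp (- q) \<le> q - p"
proof -
  show "exp (- q) \<le> exp (- p)" using assms by simp
  have "exp (- p) - exp (- q) = exp (- p) * (1 - exp (- (q - p)))"
    by (simp add: algebra_simps exp_add[symmetric])
  also have "\<dots> \<le> 1 * (q - p)"
  proof (rule mult_mono)
    show "1 - exp (- (q - p)) \<le> q - p" using exp_ge_add_one_self[of "- (q - p)"] by linarith
  qed (use assms in auto)
  finally show "exp (- p) - exp (- q) \<le> q - p" by simp
qed

text \<open>The sign in the kernel accounts for a jump of 2 on (a, b). Outside [a, b] a difference
  of exponentials remains, which lies between - (b - a) and 0. Integrated against the energy density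
  this is the identity P_xx = P - (u^2 + ux^2 / 2) in the form of inequalities.\<close>

lemma kernel_diff_bounds:
  assumes "a \<le> b"
  shows "kernel a y - kernel b y \<le> 2 * indicator {a..b} y"
    "2 * indicator {a<..<b} y - (b - a) \<le> kernel a y - kernel b y"
proof -
  consider "y < a" | "y = a" "a < b" | "y = b" "a < b" | "y = a" "y = b" | "a < y" "y < b" | "b < y" using assms by linarith
  then have "kernel a y - kernel b y \<le> 2 * indicator {a..b} y \<and>
    2 * indicator {a<..<b} y - (b - a) \<le> kernel a y - kernel b y"
  proof cases
    case 1
    then have "kernel a y - kernel b y = exp (- (b - y)) - exp (- (a - y))"
      using assms by (simp add: kernel_def)
    then show ?thesis using exp_diff_bounds[of "a - y" "b - y"] 1 assms by (simp add: indicator_def)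
  next
    case 2
    then have "kernel a y - kernel b y = exp (- (b - a))" by (simp add: kernel_def)
    moreover have "exp (- (b - a)) \<le> 1" using assms by simp
    moreover have "0 < exp (- (b - a))" by simp
    moreover have "indicator {a..b} y = (1::real)" "indicator {a<..<b} y = (0::real)" using 2 by auto
    ultimately show ?thesis using 2 by linarith
  next
    case 3
    then have "kernel a y - kernel b y = exp (- (b - a))" by (simp add: kernel_def)
    moreover have "exp (- (b - a)) \<le> 1" using assms by simp
    moreover have "0 < exp (- (b - a))" by simp
    moreover have "indicator {a..b} y = (1::real)" "indicator {a<..<b} y = (0::real)" using 3 by auto
    ultimately show ?thesis using 3 by linarith
  next
    case 4
    then show ?thesis by simp
  next
    case 5
    then have "kernel a y - kernel b y = exp (- (y - a)) + exp (- (b - y))" by (simp add: kernel_def)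
    moreover have "exp (- (y - a)) \<le> 1" "exp (- (b - y)) \<le> 1" using 5 by auto
    moreover have "1 - (y - a) \<le> exp (- (y - a))" "1 - (b - y) \<le> exp (- (b - y))"
      using exp_ge_add_one_self[of "- (y - a)"] exp_ge_add_one_self[of "- (b - y)"] by linarith+
    moreover have "indicator {a..b} y = (1::real)" "indicator {a<..<b} y = (1::real)" using 5 by auto
    ultimately show ?thesis using 5 by linarith
  next
    case 6
    then have "kernel a y - kernel b y = exp (- (y - a)) - exp (- (y - b))"
      using assms by (simp add: kernel_def)
    then show ?thesis using exp_diff_bounds[of "y - b" "y - a"] 6 assms by (simp add: indicator_def)
  qed
  then show "kernel a y - kernel b y \<le> 2 * indicator {a..b} y"
    "2 * indicator {a<..<b} y - (b - a) \<le> kernel a y - kernel b y" by auto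
qed

lemma CH_Px_eq: "CH_Px u ux t x = 1 / 2 * (LINT y|lborel. kernel x y * energy_density t y)"
  by (simp add: CH_Px_def kernel_def energy_density_def mult.assoc)

lemma integrable_kernel_density:
  assumes t: "0 \<le> t"
  shows "integrable lborel (\<lambda>y. kernel x y * energy_density t y)"
proof (rule Bochner_Integration.integrable_bound[OF integrable_energy_density[OF t]])
  have [measurable]: "energy_density t \<in> borel_measurable borel" using integrable_energy_density[OF t] by auto
  have "kernel x \<in> borel_measurable borel" unfolding kernel_def[abs_def] by measurable
  then show "(\<lambda>y. kernel x y * energy_density t y) \<in> borel_measurable lborel" by simp
  show "AE y in lborel. norm (kernel x y * energy_density t y) \<le> norm (energy_density t y)"
    using abs_kernel_le energy_density_nonneg by (auto simp: abs_mult intro!: mult_left_le_one_le)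
qed

lemma abs_CH_Px_le:
  assumes t: "0 \<le> t"
  shows "\<bar>CH_Px u ux t x\<bar> \<le> E0"
proof -
  have "\<bar>LINT y|lborel. kernel x y * energy_density t y\<bar> \<le> (LINT y|lborel. \<bar>kernel x y * energy_density t y\<bar>)"
    by (rule integral_abs_bound)
  also have "\<dots> \<le> (LINT y|lborel. energy_density t y)"
    by (intro integral_mono integrable_abs integrable_kernel_density integrable_energy_density t)
      (use abs_kernel_le energy_density_nonneg in \<open>auto simp: abs_mult intro!: mult_left_le_one_le\<close>)
  finally show ?thesis using integral_energy_density_le[OF t] E0_nonneg by (simp add: CH_Px_eq abs_mult)
qed

text \<open>One constant that dominates both u^2 and \<open>E0\<close>.\<close>

definition C0 :: real where "C0 = B0\<^sup>2"

lemma C0_bounds: "0 \<le> C0" "E0 \<le> C0"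
proof -
  show "0 \<le> C0" by (simp add: C0_def)
  have "E0 \<le> B0 * 1" by (simp add: B0_def)
  also have "\<dots> \<le> B0 * B0" using B0_pos by (intro mult_left_mono) auto
  finally show "E0 \<le> C0" by (simp add: C0_def power2_eq_square)
qed

text \<open>Since \<open>u\<close> changes along a characteristic at the rate - P_x, this controls
  the time derivative of u(b) - u(a) between two characteristics. The upper bound feeds the Riccati
  estimate. The lower one, with its nonnegative first term dropped, says that the difference
  decreases at most at the rate C0 * (b - a).\<close>

lemma CH_Px_diff_bounds:
  assumes t: "0 \<le> t" and ab: "a \<le> b"
  shows "CH_Px u ux t a - CH_Px u ux t b \<le> 1 / 2 * (LINT x:{a..b}|lborel. (ux t x)\<^sup>2) + C0 * (b - a)"
    "1 / 2 * (LINT x:{a..b}|lborel. (ux t x)\<^sup>2) - C0 * (b - a) \<le> CH_Px u ux t a - CH_Px u ux t b"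
proof -
  note ik = integrable_kernel_density[OF t]
  note id = integrable_energy_density[OF t]
  have diff: "CH_Px u ux t a - CH_Px u ux t b = 1 / 2 * (LINT y|lborel. (kernel a y - kernel b y) * energy_density t y)"
    using ik by (simp add: CH_Px_eq left_diff_distrib)
  have ikd: "integrable lborel (\<lambda>y. (kernel a y - kernel b y) * energy_density t y)"
    using ik by (simp add: left_diff_distrib)
  have iI: "integrable lborel (\<lambda>y. indicator A y * energy_density t y)" if "A \<in> sets borel" for A
    using integrable_mult_indicator[of A lborel "energy_density t"] id that by simp
  have ux2i: "set_integrable lborel {a..b} (\<lambda>x. (ux t x)\<^sup>2)" by (rule set_integrable_subset_UNIV[OF int_ux2[OF t]])
  have u2i: "set_integrable lborel {a..b} (\<lambda>x. (u t x)\<^sup>2)" by (rule set_integrable_subset_UNIV[OF int_u2[OF t]])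
  have dsplit: "(LINT y|lborel. indicator {a..b} y * energy_density t y) =
      (LINT x:{a..b}|lborel. (u t x)\<^sup>2) + 1 / 2 * (LINT x:{a..b}|lborel. (ux t x)\<^sup>2)"
  proof -
    have "(LINT y|lborel. indicator {a..b} y * energy_density t y) = (LINT x:{a..b}|lborel. (u t x)\<^sup>2 + 1 / 2 * (ux t x)\<^sup>2)"
      by (simp add: set_lebesgue_integral_def energy_density_def)
    also have "\<dots> = (LINT x:{a..b}|lborel. (u t x)\<^sup>2) + (LINT x:{a..b}|lborel. 1 / 2 * (ux t x)\<^sup>2)"
      by (intro set_integral_add(2) u2i set_integrable_mult_right ux2i)
    finally show ?thesis by simp
  qed
  have u2le: "(LINT x:{a..b}|lborel. (u t x)\<^sup>2) \<le> C0 * (b - a)"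
  proof -
    have "(u t x)\<^sup>2 \<le> C0" for x
      unfolding C0_def using abs_u_le[OF t] B0_nonneg by (simp add: power2_le_iff_abs_le)
    then have "(LINT x:{a..b}|lborel. (u t x)\<^sup>2) \<le> (LINT x:{a..b}|lborel. C0)"
      by (intro set_integral_mono u2i set_integrable_lborel_Icc_const)
    then show ?thesis using ab by (simp add: set_integral_lborel_Icc_const)
  qed
  have u2ge: "0 \<le> (LINT x:{a..b}|lborel. (u t x)\<^sup>2)" by (rule set_integral_lborel_nonneg) simp
  have "(LINT y|lborel. (kernel a y - kernel b y) * energy_density t y) \<le> (LINT y|lborel. 2 * (indicator {a..b} y * energy_density t y))"
    by (intro integral_mono ikd integrable_mult_right iI)
      (use kernel_diff_bounds(1)[OF ab] energy_density_nonneg in \<open>auto simp: mult.assoc[symmetric] intro!: mult_right_mono\<close>)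
  then show "CH_Px u ux t a - CH_Px u ux t b \<le> 1 / 2 * (LINT x:{a..b}|lborel. (ux t x)\<^sup>2) + C0 * (b - a)"
    unfolding diff using dsplit u2le by simp
  have eq: "(LINT y|lborel. indicator {a<..<b} y * energy_density t y) = (LINT y|lborel. indicator {a..b} y * energy_density t y)"
  proof (rule integral_cong_AE)
    show "AE y in lborel. indicat_real {a<..<b} y * energy_density t y = indicat_real {a..b} y * energy_density t y"
      using AE_lborel_singleton[of a] AE_lborel_singleton[of b] by eventually_elim (auto simp: indicator_def)
  qed (use iI in auto)
  have "(LINT y|lborel. 2 * (indicator {a<..<b} y * energy_density t y) - (b - a) * energy_density t y)
      \<le> (LINT y|lborel. (kernel a y - kernel b y) * energy_density t y)"
  proof (intro integral_mono ikd Bochner_Integration.integrable_diff integrable_mult_right iI id)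
    fix y
    have "(2 * indicator {a<..<b} y - (b - a)) * energy_density t y \<le> (kernel a y - kernel b y) * energy_density t y"
      using kernel_diff_bounds(2)[OF ab] energy_density_nonneg by (intro mult_right_mono) auto
    then show "2 * (indicator {a<..<b} y * energy_density t y) - (b - a) * energy_density t y \<le> (kernel a y - kernel b y) * energy_density t y"
      by (simp add: algebra_simps)
  qed auto
  also have "(LINT y|lborel. 2 * (indicator {a<..<b} y * energy_density t y) - (b - a) * energy_density t y) =
      2 * (LINT y|lborel. indicator {a..b} y * energy_density t y) - (b - a) * (LINT y|lborel. energy_density t y)"
    using iI[of "{a<..<b}"] id eq by simp
  finally have 1: "2 * (LINT y|lborel. indicator {a..b} y * energy_density t y) - (b - a) * (LINT y|lborel. energy_density t y)
      \<le> (LINT y|lborel. (kernel a y - kernel b y) * energy_density t y)" .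
  have "(b - a) * (LINT y|lborel. energy_density t y) \<le> (b - a) * C0"
    using integral_energy_density_le[OF t] C0_bounds ab by (intro mult_left_mono) auto
  moreover have "0 \<le> C0 * (b - a)" using C0_bounds ab by simp
  ultimately show "1 / 2 * (LINT x:{a..b}|lborel. (ux t x)\<^sup>2) - C0 * (b - a) \<le> CH_Px u ux t a - CH_Px u ux t b"
    unfolding diff using 1 dsplit u2ge by (simp add: mult.commute)
qed

end

section \<open>Characteristics\<close>

text \<open>A bump of class C^1 supported in [0, 4]. It is not normalised: its integral only enters
  as a positive common factor.\<close>

definition bump :: "real \<Rightarrow> real" where "bump y = smooth_step y - smooth_step (y - 2)"

definition bump' :: "real \<Rightarrow> real" where "bump' y = hat y - hat (y - 2)"

lemma bump_has_derivative: "(bump has_real_derivative bump' y) (at y)"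
proof -
  have "((\<lambda>y. y - 2) has_real_derivative 1) (at y)" by (auto intro!: derivative_eq_intros)
  from DERIV_diff[OF smooth_step_has_derivative DERIV_chain2[OF smooth_step_has_derivative this]]
  show ?thesis by (simp add: bump_def[abs_def] bump'_def)
qed

lemma bump_bounds: "0 \<le> bump y" "bump y \<le> 1" "\<bar>bump y\<bar> \<le> 1"
  using smooth_step_mono[of "y - 2" y] smooth_step_bounds[of y] smooth_step_bounds[of "y - 2"] by (auto simp: bump_def)

lemma abs_bump'_le: "\<bar>bump' y\<bar> \<le> 1"
  using hat_bounds[of y] hat_bounds[of "y - 2"] by (simp add: bump'_def)

lemma bump_eq_0: "y \<notin> {0..4} \<Longrightarrow> bump y = 0" and bump'_eq_0: "y \<notin> {0..4} \<Longrightarrow> bump' y = 0"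
  by (auto simp: bump_def bump'_def smooth_step_eq hat_eq_0 not_le)

lemma continuous_bump: "continuous_on A bump" and continuous_bump': "continuous_on A bump'"
  unfolding bump_def[abs_def] bump'_def[abs_def]
  by (intro continuous_intros continuous_on_compose2[OF continuous_smooth_step[of UNIV]]
      continuous_on_compose2[OF continuous_hat[of UNIV]] continuous_smooth_step continuous_hat; simp)+

lemma bump_measurable [measurable]: "bump \<in> borel_measurable borel"
  and bump'_measurable [measurable]: "bump' \<in> borel_measurable borel"
  by (intro borel_measurable_continuous_onI continuous_bump continuous_bump')+

lemma integrable_bounded_support:
  fixes g :: "real \<Rightarrow> real"
  assumes [measurable]: "g \<in> borel_measurable borel" and C: "\<And>y. \<bar>g y\<bar> \<le> C" and out: "\<And>y. y \<notin> {0..4} \<Longrightarrow> g y = 0"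
  shows "integrable lborel g" "\<bar>LINT y|lborel. g y\<bar> \<le> 4 * C"
proof -
  have i: "integrable lborel (\<lambda>y. indicator {0..4::real} y * C)"
    by (intro integrable_mult_left integrable_real_indicator) (auto simp: emeasure_lborel_Icc_eq)
  have le: "\<bar>g y\<bar> \<le> indicator {0..4::real} y * C" for y using C[of y] out[of y] by (cases "y \<in> {0..4}") auto
  have C0: "0 \<le> C" using C[of 0] by linarith
  show g: "integrable lborel g"
    by (rule Bochner_Integration.integrable_bound[OF i]) (use le C0 in \<open>auto simp: abs_mult\<close>)
  have "\<bar>LINT y|lborel. g y\<bar> \<le> (LINT y|lborel. \<bar>g y\<bar>)" by (rule integral_abs_bound)
  also have "\<dots> \<le> (LINT y|lborel. indicator {0..4::real} y * C)" by (intro integral_mono integrable_abs g i le)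
  also have "\<dots> = 4 * C" by simp
  finally show "\<bar>LINT y|lborel. g y\<bar> \<le> 4 * C" .
qed

lemma integrable_bump: "integrable lborel bump"
  by (rule integrable_bounded_support[of _ 1]) (use bump_bounds bump_eq_0 in auto)

lemma integral_bump': "(LINT y|lborel. bump' y) = 0"
proof -
  have "has_bochner_integral lborel (\<lambda>x. bump' x * indicator {0..4} x) (bump 4 - bump 0)"
    by (rule has_bochner_integral_FTC_Icc_real)
      (use bump_has_derivative continuous_bump'[of UNIV] in \<open>auto simp: continuous_on_eq_continuous_at\<close>)
  moreover have "(\<lambda>x. bump' x * indicator {0..4} x) = bump'"
  proof
    show "bump' x * indicator {0..4} x = bump' x" for x
      using bump'_eq_0[of x] by (cases "x \<in> {0..4}") auto
  qed
  moreover have "bump 4 - bump 0 = 0" by (simp add: bump_def smooth_step_eq)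
  ultimately show ?thesis by (simp add: has_bochner_integral_iff)
qed

lemma integral_bump_pos: "0 < (LINT y|lborel. bump y)"
proof -
  have ss: "smooth_step 1 = 1 / 2" by (simp add: smooth_step_def)
  have "indicator {2..3} y * (1 / 2) \<le> bump y" for y :: real
  proof (cases "y \<in> {2..3}")
    case True
    then have "smooth_step (y - 2) \<le> smooth_step 1" by (intro smooth_step_mono) auto
    then show ?thesis using True ss by (simp add: bump_def smooth_step_eq)
  qed (use bump_bounds in auto)
  moreover have "integrable lborel (\<lambda>y. indicator {2..3::real} y * (1 / 2 :: real))"
    by (intro integrable_mult_left integrable_real_indicator) (auto simp: emeasure_lborel_Icc_eq)
  ultimately have "(LINT y|lborel. indicator {2..3::real} y * (1 / 2)) \<le> (LINT y|lborel. bump y)"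
    by (intro integral_mono integrable_bump)
  then show ?thesis by simp
qed

context camassa_holm
begin

text \<open>\<open>max 0\<close> freezes \<open>u\<close> at its initial values for negative times,
  so that the vector field is continuous on the whole plane, as \<open>peano_existence\<close>
  requires.\<close>

lemma continuous_u_ext: "continuous_on UNIV (\<lambda>p. u (max 0 (fst p)) (snd p))"
  using continuous_on_compose2[OF cont_u, of UNIV "\<lambda>p. (max 0 (fst p), snd p)"]
  by (simp add: continuous_on_Pair continuous_on_max continuous_on_fst continuous_on_snd image_subset_iff)

lemma meas_u_ext [measurable]: "(\<lambda>p. u (max 0 (fst p)) (snd p)) \<in> borel_measurable borel"
  by (rule borel_measurable_continuous_onI[OF continuous_u_ext])

lemma meas_u_ext' [measurable (raw)]:
  assumes [measurable]: "f \<in> borel_measurable M" "g \<in> borel_measurable M"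
  shows "(\<lambda>w. u (max 0 (f w)) (g w)) \<in> borel_measurable M"
proof -
  have "(\<lambda>w. (f w, g w)) \<in> measurable M borel" unfolding borel_prod[symmetric] by measurable
  from measurable_compose[OF this meas_u_ext] show ?thesis by simp
qed

lemma meas_ux' [measurable (raw)]:
  assumes [measurable]: "f \<in> borel_measurable M" "g \<in> borel_measurable M"
  shows "(\<lambda>w. ux (f w) (g w)) \<in> borel_measurable M"
proof -
  have "(\<lambda>w. (f w, g w)) \<in> measurable M borel" unfolding borel_prod[symmetric] by measurable
  from measurable_compose[OF this meas_ux] show ?thesis by simp
qed

lemma meas_kernel' [measurable (raw)]:
  assumes [measurable]: "f \<in> borel_measurable M" "g \<in> borel_measurable M"
  shows "(\<lambda>w. kernel (f w) (g w)) \<in> borel_measurable M"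
  unfolding kernel_def by measurable

lemma meas_CH_Px [measurable (raw)]:
  assumes [measurable]: "f \<in> borel_measurable M" "g \<in> borel_measurable M"
  shows "(\<lambda>w. CH_Px u ux (max 0 (f w)) (g w)) \<in> borel_measurable M"
  unfolding CH_Px_eq energy_density_def
  by (intro borel_measurable_times borel_measurable_const lborel.borel_measurable_lebesgue_integral) measurable

text \<open>The kernel jumps only at y = x, which is a null set of the integration variable.\<close>

lemma isCont_CH_Px:
  assumes t: "0 \<le> t"
  shows "isCont (CH_Px u ux t) x"
proof (rule continuous_at_sequentiallyI)
  fix X assume X: "X \<longlonglongrightarrow> x"
  have [measurable]: "energy_density t \<in> borel_measurable borel" using integrable_energy_density[OF t] by auto
  have "(\<lambda>n. LINT y|lborel. kernel (X n) y * energy_density t y) \<longlonglongrightarrow> (LINT y|lborel. kernel x y * energy_density t y)"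
  proof (rule integral_dominated_convergence[where w="energy_density t"])
    show "AE y in lborel. (\<lambda>n. kernel (X n) y * energy_density t y) \<longlonglongrightarrow> kernel x y * energy_density t y"
      using AE_lborel_singleton[of x]
    proof eventually_elim
      case (elim y)
      then have "y - x \<noteq> 0" by simp
      then have "(\<lambda>n. sgn (y - X n)) \<longlonglongrightarrow> sgn (y - x)" by (intro tendsto_sgn tendsto_intros X)
      then show ?case unfolding kernel_def
        by (rule tendsto_mult[OF tendsto_mult tendsto_const]) (intro tendsto_intros X)
    qed
    show "AE y in lborel. norm (kernel (X n) y * energy_density t y) \<le> energy_density t y" for n
      using abs_kernel_le energy_density_nonneg by (auto simp: abs_mult intro!: mult_left_le_one_le)
  qed (use integrable_energy_density[OF t] in auto)
  then show "(\<lambda>n. CH_Px u ux t (X n)) \<longlonglongrightarrow> CH_Px u ux t x"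
    unfolding CH_Px_eq by (intro tendsto_intros)
qed

text \<open>The interval of width 4 / (n + 1) is the support of the rescaled
  \<open>bump\<close>.\<close>

lemma local_energy_tendsto_0:
  assumes t: "0 \<le> t"
  shows "(\<lambda>n. LINT y:{x..x + 4 / real (Suc n)}|lborel. (ux t y)\<^sup>2) \<longlonglongrightarrow> 0"
  unfolding set_lebesgue_integral_def
proof (rule dominated_convergence_0[where w="\<lambda>y. (ux t y)\<^sup>2"])
  have [measurable]: "ux t \<in> borel_measurable borel" by (rule meas_ux_t[OF t])
  show "(\<lambda>y. indicat_real {x..x + 4 / real (Suc n)} y *\<^sub>R (ux t y)\<^sup>2) \<in> borel_measurable lborel" for n by measurable
  show "AE y in lborel. (\<lambda>n. indicat_real {x..x + 4 / real (Suc n)} y *\<^sub>R (ux t y)\<^sup>2) \<longlonglongrightarrow> 0"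
    using AE_lborel_singleton[of x]
  proof eventually_elim
    case (elim y)
    have "(\<lambda>n. 4 * inverse (real (Suc n))) \<longlonglongrightarrow> 4 * 0" by (intro tendsto_intros LIMSEQ_inverse_real_of_nat)
    then have l: "(\<lambda>n. x + 4 / real (Suc n)) \<longlonglongrightarrow> x + 4 * 0" by (intro tendsto_intros) (simp add: divide_inverse)
    have "eventually (\<lambda>n. y \<notin> {x..x + 4 / real (Suc n)}) sequentially"
    proof (cases "y < x")
      case False
      then have "x + 4 * 0 < y" using elim by simp
      from order_tendstoD(2)[OF l this] show ?thesis by eventually_elim auto
    qed auto
    then have "eventually (\<lambda>n. indicat_real {x..x + 4 / real (Suc n)} y *\<^sub>R (ux t y)\<^sup>2 = 0) sequentially"
      by eventually_elim auto
    then show ?case by (rule tendsto_eventually)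
  qed
qed (use int_ux2[OF t] in \<open>auto simp: indicator_def\<close>)

text \<open>Testing with \<open>g t * bump (m * (x - z t))\<close>: the transport terms combine to
  \<open>bump' * (u - u(z))\<^sup>2 / 2\<close>, which is negligible because \<open>u\<close> is Hoelder-1/2 with a local energy constant.\<close>

lemma weak_equation_along_curve:
  assumes z: "\<And>t. (z has_real_derivative u (max 0 t) (z t)) (at t)"
    and g: "test1 g g'" and supp: "\<And>t. t \<notin> {a..b} \<Longrightarrow> g t = 0 \<and> g' t = 0" and a: "0 < a" and ab: "a < b"
  shows "(LINT t|lborel. u (max 0 t) (z t) * g' t) = (LINT t|lborel. CH_Px u ux (max 0 t) (z t) * g t)"
proof -
  define v where "v t = u (max 0 t) (z t)" for t
  define Px where "Px t x = CH_Px u ux (max 0 t) x" for t x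
  have z': "(z has_real_derivative v t) (at t)" for t using z by (simp add: v_def)
  have contz: "continuous_on S z" for S using z' by (meson DERIV_continuous_on DERIV_subset top_greatest)
  have contv: "continuous_on S v" for S
    unfolding v_def using continuous_on_compose2[OF continuous_u_ext, of S "\<lambda>t. (t, z t)"] contz[of S]
    by (simp add: continuous_on_Pair)
  have gD: "(g has_real_derivative g' t) (at t)" for t using g by (simp add: test1_def)
  have contg: "continuous_on S g" for S using gD by (meson DERIV_continuous_on DERIV_subset top_greatest)
  have contg': "continuous_on S g'" for S using g by (meson test1_def continuous_on_subset top_greatest)
  have [measurable]: "z \<in> borel_measurable borel" "v \<in> borel_measurable borel" "g \<in> borel_measurable borel" "g' \<in> borel_measurable borel"
    by (intro borel_measurable_continuous_onI contz contv contg contg')+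
  obtain X where X: "\<And>t. \<bar>g t\<bar> \<le> X" "\<And>t. \<bar>g' t\<bar> \<le> X"
  proof -
    have "compact (g ` {a..b} \<union> g' ` {a..b})"
      by (intro compact_Un compact_continuous_image contg contg') auto
    then obtain X where X: "\<forall>w\<in>g ` {a..b} \<union> g' ` {a..b}. norm w \<le> X"
      using compact_imp_bounded bounded_iff by meson
    have "0 \<le> X" using X ab by (meson UnI1 atLeastAtMost_iff imageI less_imp_le norm_ge_zero order_refl order_trans)
    have "\<bar>g t\<bar> \<le> X \<and> \<bar>g' t\<bar> \<le> X" for t
      using X supp[of t] \<open>0 \<le> X\<close> by (cases "t \<in> {a..b}") auto
    then show ?thesis using that by blast
  qed
  have X0: "0 \<le> X" using X(1)[of 0] by linarith
  define m where "m n = real (Suc n)" for n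
  have m: "0 < m n" "1 \<le> m n" for n by (auto simp: m_def)
  have mtop: "filterlim m at_top sequentially"
    unfolding m_def using filterlim_compose[OF filterlim_real_sequentially filterlim_Suc] .
  define \<phi> where "\<phi> n t x = g t * bump (m n * (x - z t))" for n t x
  define \<phi>t where "\<phi>t n t x = g' t * bump (m n * (x - z t)) - g t * (m n * v t * bump' (m n * (x - z t)))" for n t x
  define \<phi>x where "\<phi>x n t x = g t * (m n * bump' (m n * (x - z t)))" for n t x
  have test: "test2 (\<phi> n) (\<phi>t n) (\<phi>x n)" for n
    unfolding test2_def
  proof (intro conjI allI)
    fix t x :: real
    have 1: "((\<lambda>p. g (fst p)) has_derivative (\<lambda>h. fst h * g' t)) (at (t, x))"
      by (rule DERIV_compose_FDERIV[where g=fst]) (use gD in \<open>auto intro!: derivative_intros\<close>)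
    have 2: "((\<lambda>p. z (fst p)) has_derivative (\<lambda>h. fst h * v t)) (at (t, x))"
      by (rule DERIV_compose_FDERIV[where g=fst]) (use z' in \<open>auto intro!: derivative_intros\<close>)
    have 3: "((\<lambda>p. m n * (snd p - z (fst p))) has_derivative (\<lambda>h. m n * (snd h - fst h * v t))) (at (t, x))"
      by (intro derivative_intros 2)
    have 4: "((\<lambda>p. bump (m n * (snd p - z (fst p)))) has_derivative (\<lambda>h. (m n * (snd h - fst h * v t)) * bump' (m n * (x - z t)))) (at (t, x))"
      by (rule DERIV_compose_FDERIV[OF _ 3]) (use bump_has_derivative in auto)
    show "((\<lambda>p. \<phi> n (fst p) (snd p)) has_derivative (\<lambda>h. fst h * \<phi>t n t x + snd h * \<phi>x n t x)) (at (t, x))"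
      unfolding \<phi>_def
      by (rule has_derivative_eq_rhs[OF has_derivative_mult[OF 1 4]])
        (auto simp: \<phi>t_def \<phi>x_def algebra_simps)
  next
    have c: "continuous_on UNIV (\<lambda>p. z (fst p :: real))" "continuous_on UNIV (\<lambda>p. v (fst p :: real))"
      "continuous_on UNIV (\<lambda>p. g (fst p :: real))" "continuous_on UNIV (\<lambda>p. g' (fst p :: real))" 
      by (intro continuous_on_compose2[OF contz[of UNIV]] continuous_on_compose2[OF contv[of UNIV]]
        continuous_on_compose2[OF contg[of UNIV]] continuous_on_compose2[OF contg'[of UNIV]] continuous_on_fst continuous_on_id; simp)+
    have c': "continuous_on UNIV (\<lambda>p. bump (m n * (snd p - z (fst p))))" "continuous_on UNIV (\<lambda>p. bump' (m n * (snd p - z (fst p))))"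
      by (intro continuous_on_compose2[OF continuous_bump[of UNIV]] continuous_on_compose2[OF continuous_bump'[of UNIV]]
        continuous_intros c; simp)+
    show "continuous_on UNIV (\<lambda>p. \<phi>t n (fst p) (snd p))" "continuous_on UNIV (\<lambda>p. \<phi>x n (fst p) (snd p))"
      unfolding \<phi>t_def \<phi>x_def by (intro continuous_intros c c')+
    have "compact (z ` {a..b})" by (intro compact_continuous_image contz) auto
    then obtain Z where Z: "\<forall>w\<in>z ` {a..b}. norm w \<le> Z" using compact_imp_bounded bounded_iff by meson
    show "\<exists>a b R. 0 < a \<and> a < b \<and> (\<forall>t x. \<phi> n t x \<noteq> 0 \<longrightarrow> a \<le> t \<and> t \<le> b \<and> \<bar>x\<bar> \<le> R)"
    proof (rule exI[of _ a], rule exI[of _ b], rule exI[of _ "Z + 4"], intro conjI a ab allI impI)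
      fix t x :: real assume nz: "\<phi> n t x \<noteq> 0"
      then have t: "t \<in> {a..b}" using supp[of t] unfolding \<phi>_def by fastforce
      then show "a \<le> t" "t \<le> b" by auto
      have "m n * (x - z t) \<in> {0..4}" using nz bump_eq_0 unfolding \<phi>_def by fastforce
      then have p: "0 \<le> m n * (x - z t)" "m n * (x - z t) \<le> 4" by auto
      then have "0 \<le> x - z t" using m[of n] by (simp add: zero_le_mult_iff)
      then have "x - z t \<le> m n * (x - z t)" using m[of n] by (simp add: mult_le_cancel_right1)
      moreover have "\<bar>z t\<bar> \<le> Z" using Z t by simp
      ultimately show "\<bar>x\<bar> \<le> Z + 4" using p \<open>0 \<le> x - z t\<close> by linarith
    qed
  qed
  define F where "F n p = u (fst p) (snd p) * \<phi>t n (fst p) (snd p) + (u (fst p) (snd p))\<^sup>2 / 2 * \<phi>x n (fst p) (snd p)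
       - CH_Px u ux (fst p) (snd p) * \<phi> n (fst p) (snd p)" for n p
  have "weak_solution u ux u0" using diss by (simp add: dissipative_def)
  then have F: "integrable lborel (F n)" "(LINT p|lborel. F n p) = 0" for n
    using test[of n] unfolding weak_solution_def Let_def F_def by blast+
  have F': "integrable (lborel \<Otimes>\<^sub>M lborel) (F n)" for n using F(1)[of n] by (simp add: lborel_prod)
  have Fiter: "(LINT t|lborel. (LINT x|lborel. F n (t, x))) = 0" for n
    using lborel_pair.integral_fst'[OF F'] F(2) by (simp add: lborel_prod)
  have Fint: "integrable lborel (\<lambda>t. LINT x|lborel. F n (t, x))" for n
    by (rule lborel_pair.integrable_fst'[OF F'])
  \<comment> \<open>The factor \<open>m n\<close> compensates for the bump having width of order 1 /
    m n.\<close>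
  define J where "J n t = m n * (LINT x|lborel. F n (t, x))" for n t
  define c where "c = (LINT y|lborel. bump y)"
  have c0: "0 < c" unfolding c_def by (rule integral_bump_pos)
  define A where "A n t = (LINT y|lborel. u t (z t + y / m n) * bump y)" for n t
  define Q where "Q n t = (LINT y|lborel. CH_Px u ux t (z t + y / m n) * bump y)" for n t
  define D where "D n t = (LINT y|lborel. m n / 2 * ((u t (z t + y / m n) - v t)\<^sup>2 * bump' y))" for n t
  have J0: "J n t = 0" if "t \<notin> {a..b}" for n t
  proof -
    have "F n (t, x) = 0" for x using supp[OF that] by (simp add: F_def \<phi>_def \<phi>t_def \<phi>x_def)
    then show ?thesis by (simp add: J_def)
  qed
  have main: "J n t = g' t * A n t + g t * D n t - g t * Q n t \<and> \<bar>A n t\<bar> \<le> 4 * B0 \<and> \<bar>Q n t\<bar> \<le> 4 * E0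
     \<and> \<bar>D n t\<bar> \<le> 8 * (LINT y:{z t..z t + 4 / m n}|lborel. (ux t y)\<^sup>2)" if t: "t \<in> {a..b}" for n t
  proof -
    have t0: "0 \<le> t" using t a by simp
    then have vt: "v t = u t (z t)" by (simp add: v_def)
    have [measurable]: "u t \<in> borel_measurable borel" by (rule meas_u_t[OF t0])
    have [measurable]: "CH_Px u ux t \<in> borel_measurable borel"
      by (intro borel_measurable_continuous_onI) (use isCont_CH_Px[OF t0] in \<open>simp add: continuous_on_eq_continuous_at\<close>)
    have "\<bar>u t (z t + y / m n) * bump y\<bar> \<le> B0 * 1" for y
      unfolding abs_mult using abs_u_le[OF t0] bump_bounds B0_nonneg by (intro mult_mono) auto
    then have iA: "integrable lborel (\<lambda>y. u t (z t + y / m n) * bump y)" "\<bar>A n t\<bar> \<le> 4 * B0"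
      unfolding A_def by (intro integrable_bounded_support[where C=B0]; use bump_eq_0 in force)+
    have "\<bar>CH_Px u ux t (z t + y / m n) * bump y\<bar> \<le> E0 * 1" for y
      unfolding abs_mult using abs_CH_Px_le[OF t0] bump_bounds E0_nonneg by (intro mult_mono) auto
    then have iQ: "integrable lborel (\<lambda>y. CH_Px u ux t (z t + y / m n) * bump y)" "\<bar>Q n t\<bar> \<le> 4 * E0"
      unfolding Q_def by (intro integrable_bounded_support[where C=E0]; use bump_eq_0 in force)+
    define e where "e = (LINT y:{z t..z t + 4 / m n}|lborel. (ux t y)\<^sup>2)"
    have e0: "0 \<le> e" unfolding e_def by (rule set_integral_lborel_nonneg) simp
    \<comment> \<open>By the Hoelder estimate the square is at most 4 / m n times the local energy
      \<open>e\<close>. The prefactor m n / 2 thus leaves 2 * e, which tends to 0 as the interval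
      shrinks.\<close>
    have Dle: "\<bar>m n / 2 * ((u t (z t + y / m n) - v t)\<^sup>2 * bump' y)\<bar> \<le> 2 * e" for y
    proof (cases "y \<in> {0..4}")
      case True
      have "(u t (z t + y / m n) - u t (z t))\<^sup>2 \<le> (y / m n) * (LINT x:{z t..z t + y / m n}|lborel. (ux t x)\<^sup>2)"
        using u_diff_power2_le[OF t0, of "z t" "z t + y / m n"] True m(1)[of n] by simp
      also have "\<dots> \<le> (4 / m n) * e"
      proof (rule mult_mono)
        show "y / m n \<le> 4 / m n" using True m(1)[of n] by (simp add: divide_right_mono)
        then show "(LINT x:{z t..z t + y / m n}|lborel. (ux t x)\<^sup>2) \<le> e"
          unfolding e_def set_lebesgue_integral_def
          by (intro integral_mono) (use set_integrable_subset_UNIV[OF int_ux2[OF t0]] in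
            \<open>auto simp: set_integrable_def indicator_def\<close>)
      qed (use m(1)[of n] in \<open>auto intro!: set_integral_lborel_nonneg\<close>)
      finally have "(u t (z t + y / m n) - v t)\<^sup>2 * \<bar>bump' y\<bar> \<le> (4 / m n * e) * 1"
        unfolding vt using abs_bump'_le e0 m(1)[of n] by (intro mult_mono) auto
      then have "m n / 2 * ((u t (z t + y / m n) - v t)\<^sup>2 * \<bar>bump' y\<bar>) \<le> m n / 2 * (4 / m n * e)"
        using m(1)[of n] by (intro mult_left_mono) auto
      also have "\<dots> = 2 * e" using m(1)[of n] by simp
      finally show ?thesis using m(1)[of n] by (simp add: abs_mult)
    next
      case False
      then show ?thesis using bump'_eq_0 e0 by simp
    qed
    have iD: "integrable lborel (\<lambda>y. m n / 2 * ((u t (z t + y / m n) - v t)\<^sup>2 * bump' y))" "\<bar>D n t\<bar> \<le> 4 * (2 * e)"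
      unfolding D_def by (intro integrable_bounded_support[OF _ Dle]; use bump'_eq_0 in force)+
    have ib': "integrable lborel bump'"
      by (rule integrable_bounded_support[OF _ abs_bump'_le]) (use bump'_eq_0 in auto)
    have lin: "(LINT y|lborel. c1 * f1 y + c2 * f2 y - c3 * f3 y - c4 * f4 y) = c1 * (LINT y|lborel. f1 y)
        + c2 * (LINT y|lborel. f2 y) - c3 * (LINT y|lborel. f3 y) - c4 * (LINT y|lborel. f4 y)"
      if "integrable lborel f1" "integrable lborel f2" "integrable lborel f3" "integrable lborel f4"
      for c1 c2 c3 c4 :: real and f1 f2 f3 f4 :: "real \<Rightarrow> real"
      using that by simp
    have "(LINT x|lborel. F n (t, x)) = \<bar>1 / m n\<bar> *\<^sub>R (LINT y|lborel. F n (t, z t + 1 / m n * y))"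
      by (rule lborel_integral_real_affine) (use m(1)[of n] in simp)
    then have "J n t = (LINT y|lborel. F n (t, z t + 1 / m n * y))"
      using m(1)[of n] by (simp add: J_def)
    also have "\<dots> = (LINT y|lborel. g' t * (u t (z t + y / m n) * bump y)
        + g t * (m n / 2 * ((u t (z t + y / m n) - v t)\<^sup>2 * bump' y))
        - g t * (CH_Px u ux t (z t + y / m n) * bump y) - g t * m n * (v t)\<^sup>2 / 2 * bump' y)"
    proof (rule Bochner_Integration.integral_cong[OF refl])
      fix y
      have my: "m n * (z t + 1 / m n * y - z t) = y" using m(1)[of n] by simp
      \<comment> \<open>The two transport terms are completed to a square. The remainder, a multiple
        of k * w^2 * b', does not involve \<open>U\<close> and drops out because
        \<open>bump'\<close> has integral 0.\<close>
      have alg: "U * (c1 * b - c2 * (k * w * b')) + U\<^sup>2 / 2 * (c2 * (k * b')) - P * (c2 * b) =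
        c1 * (U * b) + c2 * (k / 2 * ((U - w)\<^sup>2 * b')) - c2 * (P * b) - c2 * k * w\<^sup>2 / 2 * b'" for U c1 b c2 k w b' P :: real
        by (simp add: field_simps power2_eq_square)
      show "F n (t, z t + 1 / m n * y) = g' t * (u t (z t + y / m n) * bump y)
        + g t * (m n / 2 * ((u t (z t + y / m n) - v t)\<^sup>2 * bump' y))
        - g t * (CH_Px u ux t (z t + y / m n) * bump y) - g t * m n * (v t)\<^sup>2 / 2 * bump' y"
        unfolding F_def \<phi>_def \<phi>t_def \<phi>x_def fst_conv snd_conv my alg by simp
    qed
    also have "\<dots> = g' t * A n t + g t * D n t - g t * Q n t - g t * m n * (v t)\<^sup>2 / 2 * (LINT y|lborel. bump' y)"
      unfolding A_def D_def Q_def by (rule lin[OF iA(1) iD(1) iQ(1) ib'])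
    finally have "J n t = g' t * A n t + g t * D n t - g t * Q n t" by (simp add: integral_bump')
    then show ?thesis using iA(2) iD(2) iQ(2) by (simp add: e_def)
  qed
  have Jlim: "(\<lambda>n. LINT t|lborel. J n t) \<longlonglongrightarrow> (LINT t|lborel. c * (v t * g' t - Px t (z t) * g t))"
  proof (rule integral_dominated_convergence[where w="\<lambda>t. indicator {a..b} t * (X * (4 * B0 + 8 * E0 + 4 * E0))"])
    show "(\<lambda>t. c * (v t * g' t - Px t (z t) * g t)) \<in> borel_measurable lborel"
      unfolding Px_def by measurable
    show "J n \<in> borel_measurable lborel" for n using Fint[of n] unfolding J_def[abs_def] by auto
    show "integrable lborel (\<lambda>t. indicat_real {a..b} t * (X * (4 * B0 + 8 * E0 + 4 * E0)))"
      by (intro integrable_mult_left integrable_real_indicator) (auto simp: emeasure_lborel_Icc_eq)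
    show "AE t in lborel. norm (J n t) \<le> indicat_real {a..b} t * (X * (4 * B0 + 8 * E0 + 4 * E0))" for n
    proof (rule AE_I2)
      fix t
      show "norm (J n t) \<le> indicat_real {a..b} t * (X * (4 * B0 + 8 * E0 + 4 * E0))"
      proof (cases "t \<in> {a..b}")
        case True
        note M = main[OF True, of n]
        have t0: "0 \<le> t" using True a by simp
        have "\<bar>g' t * A n t\<bar> \<le> X * (4 * B0)" unfolding abs_mult using M X X0 by (intro mult_mono) auto
        moreover have "\<bar>g t * D n t\<bar> \<le> X * (8 * E0)"
          unfolding abs_mult using M X X0 set_integral_ux2_le[OF t0, of "z t" "z t + 4 / m n"]
          by (intro mult_mono) auto
        moreover have "\<bar>g t * Q n t\<bar> \<le> X * (4 * E0)" unfolding abs_mult using M X X0 by (intro mult_mono) auto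
        ultimately show ?thesis using M True by (simp add: distrib_left)
      qed (simp add: J0)
    qed
    show "AE t in lborel. (\<lambda>n. J n t) \<longlonglongrightarrow> c * (v t * g' t - Px t (z t) * g t)"
    proof (rule AE_I2)
      fix t
      show "(\<lambda>n. J n t) \<longlonglongrightarrow> c * (v t * g' t - Px t (z t) * g t)"
      proof (cases "t \<in> {a..b}")
        case False
        then show ?thesis using supp[OF False] J0[OF False] by simp
      next
        case True
        then have t0: "0 \<le> t" using a by simp
        have [measurable]: "u t \<in> borel_measurable borel" by (rule meas_u_t[OF t0])
        have [measurable]: "CH_Px u ux t \<in> borel_measurable borel"
          by (intro borel_measurable_continuous_onI) (use isCont_CH_Px[OF t0] in \<open>simp add: continuous_on_eq_continuous_at\<close>)
        have isu: "isCont (u t) x" for x using continuous_u_t[OF t0, of UNIV] by (simp add: continuous_on_eq_continuous_at)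
        have 1: "(\<lambda>n. A n t) \<longlonglongrightarrow> u t (z t) * c" unfolding A_def c_def
          by (rule approximate_identity[OF _ abs_u_le[OF t0] isu integrable_bump mtop]) simp
        have 2: "(\<lambda>n. Q n t) \<longlonglongrightarrow> CH_Px u ux t (z t) * c" unfolding Q_def c_def
          by (rule approximate_identity[OF _ abs_CH_Px_le[OF t0] isCont_CH_Px[OF t0] integrable_bump mtop]) simp
        have 3: "(\<lambda>n. D n t) \<longlonglongrightarrow> 0"
        proof (rule tendsto_rabs_zero_cancel, rule tendsto_sandwich[of "\<lambda>_. 0" _ _ "\<lambda>n. 8 * (LINT y:{z t..z t + 4 / m n}|lborel. (ux t y)\<^sup>2)"])
          show "\<forall>\<^sub>F n in sequentially. \<bar>D n t\<bar> \<le> 8 * (LINT y:{z t..z t + 4 / m n}|lborel. (ux t y)\<^sup>2)"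
            using main[OF True] by auto
          show "(\<lambda>n. 8 * (LINT y:{z t..z t + 4 / m n}|lborel. (ux t y)\<^sup>2)) \<longlonglongrightarrow> 0"
            unfolding m_def by (rule tendsto_mult_right_zero[OF local_energy_tendsto_0[OF t0]])
        qed auto
        have "(\<lambda>n. g' t * A n t + g t * D n t - g t * Q n t) \<longlonglongrightarrow> g' t * (u t (z t) * c) + g t * 0 - g t * (CH_Px u ux t (z t) * c)"
          by (intro tendsto_intros 1 2 3)
        moreover have "J n t = g' t * A n t + g t * D n t - g t * Q n t" for n using main[OF True] by blast
        ultimately have "(\<lambda>n. J n t) \<longlonglongrightarrow> g' t * (u t (z t) * c) + g t * 0 - g t * (CH_Px u ux t (z t) * c)"
          by (simp only:)
        then show ?thesis using t0 by (simp add: v_def Px_def algebra_simps)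
      qed
    qed
  qed
  have "(LINT t|lborel. J n t) = 0" for n using Fiter[of n] by (simp add: J_def)
  \<comment> \<open>All integrals of \<open>J n\<close> vanish by the weak equation, hence so does
    their limit.\<close>
  then have "(LINT t|lborel. c * (v t * g' t - Px t (z t) * g t)) = 0"
    using Jlim by (simp only: LIMSEQ_const_iff)
  then have eq: "(LINT t|lborel. v t * g' t - Px t (z t) * g t) = 0" using c0 by simp
  have ind: "integrable lborel (\<lambda>t. indicat_real {a..b} t * C)" for C
    by (intro integrable_mult_left integrable_real_indicator) (auto simp: emeasure_lborel_Icc_eq)
  have i1: "integrable lborel (\<lambda>t. v t * g' t)"
  proof (rule Bochner_Integration.integrable_bound[OF ind[of "B0 * X"]])
    have "\<bar>v t\<bar> * \<bar>g' t\<bar> \<le> B0 * X" for t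
      unfolding v_def using abs_u_le X B0_nonneg by (intro mult_mono) auto
    then show "AE t in lborel. norm (v t * g' t) \<le> norm (indicat_real {a..b} t * (B0 * X))"
      using supp X0 B0_nonneg by (auto simp: indicator_def abs_mult)
  qed simp
  have i2: "integrable lborel (\<lambda>t. Px t (z t) * g t)"
  proof (rule Bochner_Integration.integrable_bound[OF ind[of "E0 * X"]])
    have "\<bar>Px t (z t)\<bar> * \<bar>g t\<bar> \<le> E0 * X" for t
      unfolding Px_def using abs_CH_Px_le X E0_nonneg by (intro mult_mono) auto
    then show "AE t in lborel. norm (Px t (z t) * g t) \<le> norm (indicat_real {a..b} t * (E0 * X))"
      using supp X0 E0_nonneg by (auto simp: indicator_def abs_mult)
    show "(\<lambda>t. Px t (z t) * g t) \<in> borel_measurable lborel" unfolding Px_def by measurable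
  qed
  show ?thesis using eq i1 i2 by (simp add: v_def Px_def)
qed

end

section \<open>One-sided Lipschitz estimates\<close>

text \<open>Working with \<open>d\<^sup>2\<close> covers both signs of \<open>d\<close> at once. The
  rate \<open>k\<close> may depend on time and enters through a primitive \<open>Kp\<close>, for
  instance 2 * ln r for the rate 2 / r.\<close>

lemma one_sided_Lipschitz_upper:
  fixes d d' k Kp :: "real \<Rightarrow> real"
  assumes st: "s \<le> t" and contd: "continuous_on {s..t} d" and contK: "continuous_on {s..t} Kp"
    and d: "\<And>r. s < r \<Longrightarrow> r < t \<Longrightarrow> (d has_real_derivative d' r) (at r)"
    and K: "\<And>r. s < r \<Longrightarrow> r < t \<Longrightarrow> (Kp has_real_derivative k r) (at r)"
    and le: "\<And>r. s < r \<Longrightarrow> r < t \<Longrightarrow> d r * d' r \<le> k r * (d r)\<^sup>2"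
  shows "\<bar>d t\<bar> \<le> exp (Kp t - Kp s) * \<bar>d s\<bar>"
proof -
  define f where "f r = (d r)\<^sup>2 * exp (- 2 * Kp r)" for r
  have "f t \<le> f s"
  proof (rule DERIV_nonpos_imp_nonincreasing_open[where f=f and a=s and b=t])
    show "continuous_on {s..t} f" unfolding f_def by (intro continuous_intros contd contK)
    fix r assume r: "s < r" "r < t"
    have 1: "((\<lambda>r. (d r)\<^sup>2) has_real_derivative 2 * d r * d' r) (at r)"
      using DERIV_power[OF d[OF r], of 2] by (simp add: mult_ac)
    have 2: "((\<lambda>r. exp (- 2 * Kp r)) has_real_derivative exp (- 2 * Kp r) * (- 2 * k r)) (at r)"
      using DERIV_fun_exp[OF DERIV_cmult[OF K[OF r], of "- 2"]] by simp
    have "(f has_real_derivative 2 * exp (- 2 * Kp r) * (d r * d' r - k r * (d r)\<^sup>2)) (at r)"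
      unfolding f_def by (rule DERIV_cong[OF DERIV_mult[OF 1 2]]) (simp add: algebra_simps)
    moreover have "2 * exp (- 2 * Kp r) * (d r * d' r - k r * (d r)\<^sup>2) \<le> 0"
      using le[OF r] by (intro mult_nonneg_nonpos) auto
    ultimately show "\<exists>y. (f has_real_derivative y) (at r) \<and> y \<le> 0" by blast
  qed (rule st)
  have E: "exp (- 2 * Kp s) * exp (2 * Kp t) = (exp (Kp t - Kp s))\<^sup>2"
    by (simp add: exp_add[symmetric] power2_eq_square)
  have "(d t)\<^sup>2 = (d t)\<^sup>2 * exp (- 2 * Kp t) * exp (2 * Kp t)"
    by (simp add: mult.assoc exp_add[symmetric])
  also have "\<dots> \<le> (d s)\<^sup>2 * exp (- 2 * Kp s) * exp (2 * Kp t)"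
    using \<open>f t \<le> f s\<close> unfolding f_def by (intro mult_right_mono) auto
  also have "\<dots> = (exp (Kp t - Kp s) * \<bar>d s\<bar>)\<^sup>2"
    by (simp only: mult.assoc E) (simp add: power_mult_distrib mult.commute)
  finally have "(d t)\<^sup>2 \<le> (exp (Kp t - Kp s) * \<bar>d s\<bar>)\<^sup>2" .
  then show ?thesis by (simp add: abs_le_square_iff[symmetric] abs_mult)
qed

section \<open>Partitions and the variance on their cells\<close>

lemma set_integral_lborel_combine:
  fixes f :: "real \<Rightarrow> real"
  assumes "integrable lborel f" "a \<le> b" "b \<le> c"
  shows "(LINT x:{a..b}|lborel. f x) + (LINT x:{b..c}|lborel. f x) = (LINT x:{a..c}|lborel. f x)"
proof -
  note i = set_integrable_subset_UNIV[OF assms(1)]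
  have "(LINT x:{a..c}|lborel. f x) = (LINT x|lborel. indicator {a..b} x *\<^sub>R f x + indicator {b..c} x *\<^sub>R f x)"
    unfolding set_lebesgue_integral_def
  proof (rule integral_cong_AE)
    show "AE x in lborel. indicat_real {a..c} x *\<^sub>R f x = indicat_real {a..b} x *\<^sub>R f x + indicat_real {b..c} x *\<^sub>R f x"
      using AE_lborel_singleton[of b] by eventually_elim (use assms in \<open>auto simp: indicator_def\<close>)
  qed (use i in \<open>auto simp: set_integrable_def\<close>)
  also have "\<dots> = (LINT x:{a..b}|lborel. f x) + (LINT x:{b..c}|lborel. f x)"
    using i by (simp add: set_lebesgue_integral_def set_integrable_def)
  finally show ?thesis by simp
qed

lemma sum_set_integral_partition:
  fixes f :: "real \<Rightarrow> real" and y :: "nat \<Rightarrow> real"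
  assumes "integrable lborel f" "\<And>i. i < n \<Longrightarrow> y i \<le> y (Suc i)"
  shows "y 0 \<le> y n" "(\<Sum>i<n. LINT x:{y i..y (Suc i)}|lborel. f x) = (LINT x:{y 0..y n}|lborel. f x) \<or> n = 0"
proof -
  have "y 0 \<le> y n \<and> ((\<Sum>i<n. LINT x:{y i..y (Suc i)}|lborel. f x) = (LINT x:{y 0..y n}|lborel. f x) \<or> n = 0)"
    using assms(2)
  proof (induction n)
    case (Suc n)
    then have IH: "y 0 \<le> y n" "(\<Sum>i<n. LINT x:{y i..y (Suc i)}|lborel. f x) = (LINT x:{y 0..y n}|lborel. f x) \<or> n = 0"
      and s: "y n \<le> y (Suc n)" by auto
    then show ?case
      using set_integral_lborel_combine[OF assms(1) IH(1) s] by (cases "n = 0") auto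
  qed simp
  then show "y 0 \<le> y n" "(\<Sum>i<n. LINT x:{y i..y (Suc i)}|lborel. f x) = (LINT x:{y 0..y n}|lborel. f x) \<or> n = 0" by auto
qed

lemma set_integral_le_UNIV:
  fixes f :: "real \<Rightarrow> real"
  assumes "integrable lborel f" "\<And>x. 0 \<le> f x"
  shows "(LINT x:{a..b}|lborel. f x) \<le> (LINT x|lborel. f x)"
  unfolding set_lebesgue_integral_def
  by (rule integral_mono) (use assms set_integrable_subset_UNIV[OF assms(1), of a b] in
      \<open>auto simp: set_integrable_def indicator_def\<close>)

text \<open>The integral of (F - mean)^2 over the cell, not divided by its length: the defect in the
  Cauchy-Schwarz inequality. For F = ux the second integral is the increment of \<open>u\<close>.
  Where a = b the quotient is 0 by convention.\<close>

definition cell_variance :: "(real \<Rightarrow> real) \<Rightarrow> real \<Rightarrow> real \<Rightarrow> real" where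
  "cell_variance F a b = (LINT x:{a..b}|lborel. (F x)\<^sup>2) - (LINT x:{a..b}|lborel. F x)\<^sup>2 / (b - a)"

lemma cell_variance_bounds:
  assumes F: "F \<in> borel_measurable borel" and int: "integrable lborel (\<lambda>x. (F x)\<^sup>2)" and ab: "a \<le> b"
  shows "0 \<le> cell_variance F a b" "cell_variance F a b \<le> (LINT x:{a..b}|lborel. (F x)\<^sup>2)"
    "cell_variance F a b \<le> (LINT x:{a..b}|lborel. (F x - c)\<^sup>2)"
proof -
  note CS = set_integral_Cauchy_Schwarz[OF assms]
  show "cell_variance F a b \<le> (LINT x:{a..b}|lborel. (F x)\<^sup>2)" using ab by (simp add: cell_variance_def)
  show "0 \<le> cell_variance F a b"
  proof (cases "a = b")
    case True
    then show ?thesis by (simp add: cell_variance_def set_integral_lborel_nonneg)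
  next
    case False
    then show ?thesis using CS ab by (simp add: cell_variance_def divide_le_eq mult.commute)
  qed
  have e: "(LINT x:{a..b}|lborel. (F x - c)\<^sup>2) =
    (LINT x:{a..b}|lborel. (F x)\<^sup>2) - 2 * c * (LINT x:{a..b}|lborel. F x) + c\<^sup>2 * (b - a)"
    by (rule set_integral_power2_diff_const[OF assms])
  show "cell_variance F a b \<le> (LINT x:{a..b}|lborel. (F x - c)\<^sup>2)"
  proof (cases "a = b")
    case True
    then show ?thesis using CS e by (simp add: cell_variance_def)
  next
    case False
    have alg: "0 \<le> W\<^sup>2 / l - 2 * c * W + c\<^sup>2 * l" if "0 < l" for W l :: real
    proof -
      have "0 \<le> (W - c * l)\<^sup>2 / l" using that by simp
      also have "\<dots> = W\<^sup>2 / l - 2 * c * W + c\<^sup>2 * l" using that by (simp add: field_simps power2_eq_square)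
      finally show ?thesis .
    qed
    show ?thesis using alg[of "b - a" "LINT x:{a..b}|lborel. F x"] False ab e by (simp add: cell_variance_def)
  qed
qed

text \<open>The variance is the least squared distance to a constant. On each cell the mean may
  therefore be replaced by a value of a continuous function close to \<open>F\<close>, which hardly
  varies on short cells.\<close>

lemma sum_cell_variance_small:
  fixes F :: "real \<Rightarrow> real"
  assumes F[measurable]: "F \<in> borel_measurable borel" and int: "integrable lborel (\<lambda>x. (F x)\<^sup>2)" and e: "0 < e" and L: "0 \<le> L"
  obtains \<delta> where "0 < \<delta>" "\<And>n (y::nat \<Rightarrow> real). (\<And>i. i < n \<Longrightarrow> y i \<le> y (Suc i) \<and> y (Suc i) - y i \<le> \<delta>) \<Longrightarrow> y n - y 0 \<le> L \<Longrightarrow>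
     (\<Sum>i<n. cell_variance F (y i) (y (Suc i))) \<le> e"
proof -
  obtain G R where G: "continuous_on UNIV G" "0 < R" "\<And>x. R \<le> \<bar>x\<bar> \<Longrightarrow> G x = 0"
      "integrable lborel (\<lambda>x. (F x - G x)\<^sup>2)" "(LINT x|lborel. (F x - G x)\<^sup>2) \<le> e / 4"
    by (rule L2_dense_continuous[OF F int, of "e / 4"]) (use e that in auto)
  have [measurable]: "G \<in> borel_measurable borel" using G(1) by (rule borel_measurable_continuous_onI)
  \<comment> \<open>The variation of \<open>G\<close> contributes 2 * \<open>\<eta>\<^sup>2\<close>
    * L \<le> e / 2, the distance from \<open>F\<close> to \<open>G\<close> the other e / 2.\<close>
  define \<eta> where "\<eta> = sqrt (e / (4 * (L + 1)))"
  have \<eta>: "0 < \<eta>" "\<eta>\<^sup>2 = e / (4 * (L + 1))" using e L by (auto simp: \<eta>_def)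
  have "uniformly_continuous_on {-R-1..R+1} G"
    by (rule compact_uniformly_continuous) (use G(1) continuous_on_subset in auto)
  then obtain \<delta> where \<delta>: "0 < \<delta>" "\<And>x y. x \<in> {-R-1..R+1} \<Longrightarrow> y \<in> {-R-1..R+1} \<Longrightarrow> dist y x < \<delta> \<Longrightarrow> dist (G y) (G x) < \<eta>"
    unfolding uniformly_continuous_on_def using \<eta>(1) by metis
  have uc: "\<bar>G x - G y\<bar> \<le> \<eta>" if "\<bar>x - y\<bar> < min \<delta> 1" for x y
  proof (cases "x \<in> {-R-1..R+1} \<and> y \<in> {-R-1..R+1}")
    case True
    then show ?thesis using \<delta>(2)[of y x] that by (simp add: dist_real_def)
  next
    case False
    then have "R \<le> \<bar>x\<bar>" "R \<le> \<bar>y\<bar>" using that by auto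
    then show ?thesis using G(3) \<eta>(1) by simp
  qed
  show thesis
  proof
    show "0 < min \<delta> 1 / 2" using \<delta>(1) by simp
    fix n and y :: "nat \<Rightarrow> real"
    assume y: "\<And>i. i < n \<Longrightarrow> y i \<le> y (Suc i) \<and> y (Suc i) - y i \<le> min \<delta> 1 / 2" and yL: "y n - y 0 \<le> L"
    have cell: "cell_variance F (y i) (y (Suc i)) \<le> 2 * (LINT x:{y i..y (Suc i)}|lborel. (F x - G x)\<^sup>2) + 2 * \<eta>\<^sup>2 * (y (Suc i) - y i)"
      if i: "i < n" for i
    proof -
      have yi: "y i \<le> y (Suc i)" "y (Suc i) - y i \<le> min \<delta> 1 / 2" using y[OF i] by auto
      have "cell_variance F (y i) (y (Suc i)) \<le> (LINT x:{y i..y (Suc i)}|lborel. (F x - G (y i))\<^sup>2)"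
        by (rule cell_variance_bounds(3)[OF F int yi(1)])
      also have "\<dots> \<le> (LINT x:{y i..y (Suc i)}|lborel. 2 * (F x - G x)\<^sup>2 + 2 * \<eta>\<^sup>2)"
      proof (rule set_integral_mono)
        show "set_integrable lborel {y i..y (Suc i)} (\<lambda>x. 2 * (F x - G x)\<^sup>2 + 2 * \<eta>\<^sup>2)"
          by (intro set_integral_add(1) set_integrable_mult_right set_integrable_subset_UNIV G(4) set_integrable_lborel_Icc_const)
        have "set_integrable lborel {y i..y (Suc i)} (\<lambda>x. (F x)\<^sup>2 - 2 * G (y i) * F x + (G (y i))\<^sup>2)"
          by (intro set_integral_add(1) set_integral_diff(1) set_integrable_mult_right set_integrable_subset_UNIV[OF int]
              set_integrable_power2_imp[OF F int] set_integrable_lborel_Icc_const)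
        then show "set_integrable lborel {y i..y (Suc i)} (\<lambda>x. (F x - G (y i))\<^sup>2)"
          by (simp add: power2_diff algebra_simps)
        fix x assume x: "x \<in> {y i..y (Suc i)}"
        have "\<bar>x - y i\<bar> < min \<delta> 1" using x yi(2) \<delta>(1) by (auto simp: min_def split: if_splits)
        then have "\<bar>G x - G (y i)\<bar> \<le> \<bar>\<eta>\<bar>" using uc \<eta>(1) by simp
        then have "(G x - G (y i))\<^sup>2 \<le> \<eta>\<^sup>2" by (simp add: abs_le_square_iff)
        then show "(F x - G (y i))\<^sup>2 \<le> 2 * (F x - G x)\<^sup>2 + 2 * \<eta>\<^sup>2"
          using power2_add_le[of "F x - G x" "G x - G (y i)"] by simp
      qed
      also have "\<dots> = (LINT x:{y i..y (Suc i)}|lborel. 2 * (F x - G x)\<^sup>2) + (LINT x:{y i..y (Suc i)}|lborel. 2 * \<eta>\<^sup>2)"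
        by (intro set_integral_add(2) set_integrable_mult_right set_integrable_subset_UNIV G(4) set_integrable_lborel_Icc_const)
      finally show ?thesis unfolding set_integral_lborel_Icc_const[OF yi(1)] by simp
    qed
    have "(\<Sum>i<n. cell_variance F (y i) (y (Suc i))) \<le> (\<Sum>i<n. 2 * (LINT x:{y i..y (Suc i)}|lborel. (F x - G x)\<^sup>2) + 2 * \<eta>\<^sup>2 * (y (Suc i) - y i))"
      by (intro sum_mono cell) auto
    also have "\<dots> = 2 * (\<Sum>i<n. LINT x:{y i..y (Suc i)}|lborel. (F x - G x)\<^sup>2) + 2 * \<eta>\<^sup>2 * (\<Sum>i<n. y (Suc i) - y i)"
      by (simp add: sum.distrib sum_distrib_left)
    also have "(\<Sum>i<n. y (Suc i) - y i) = y n - y 0" by (rule sum_lessThan_telescope)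
    also have "(\<Sum>i<n. LINT x:{y i..y (Suc i)}|lborel. (F x - G x)\<^sup>2) \<le> e / 4"
    proof (cases "n = 0")
      case False
      then have "(\<Sum>i<n. LINT x:{y i..y (Suc i)}|lborel. (F x - G x)\<^sup>2) = (LINT x:{y 0..y n}|lborel. (F x - G x)\<^sup>2)"
        using sum_set_integral_partition(2)[OF G(4), of n y] y by auto
      also have "\<dots> \<le> (LINT x|lborel. (F x - G x)\<^sup>2)" by (rule set_integral_le_UNIV[OF G(4)]) simp
      finally show ?thesis using G(5) by linarith
    qed (use e in simp)
    also have "2 * \<eta>\<^sup>2 * (y n - y 0) \<le> 2 * \<eta>\<^sup>2 * L" using yL by (intro mult_left_mono) auto
    also have "2 * \<eta>\<^sup>2 * L \<le> e / 2" unfolding \<eta>(2) using e L by (simp add: field_simps)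
    finally show "(\<Sum>i<n. cell_variance F (y i) (y (Suc i))) \<le> e" by simp
  qed
qed

context camassa_holm
begin

section \<open>Existence, order and separation of characteristics\<close>

definition char_curve :: "(real \<Rightarrow> real) \<Rightarrow> bool" where
  "char_curve z \<longleftrightarrow> characteristic u ux (z 0) z"

lemma characteristic_iff: "characteristic u ux \<zeta> z \<longleftrightarrow> char_curve z \<and> z 0 = \<zeta>"
  by (auto simp: char_curve_def characteristic_def)

lemma char_curve_deriv: "char_curve z \<Longrightarrow> 0 \<le> t \<Longrightarrow> (z has_real_derivative u t (z t)) (at t within {0..})"
  by (simp add: char_curve_def characteristic_def)

lemma char_curve_deriv_at: "char_curve z \<Longrightarrow> 0 < t \<Longrightarrow> (z has_real_derivative u t (z t)) (at t)"
proof -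
  assume "char_curve z" "0 < t"
  moreover from this have "at t within {0..} = at t" by (intro at_within_nhd[of _ "{0<..}"]) auto
  ultimately show ?thesis using char_curve_deriv[of z t] by simp
qed

lemma char_curve_cont: "char_curve z \<Longrightarrow> S \<subseteq> {0..} \<Longrightarrow> continuous_on S z"
  by (rule continuous_on_subset[of "{0..}"]) (auto intro!: DERIV_continuous_on char_curve_deriv)

lemma char_curve_u:
  assumes z: "char_curve z" and st: "0 \<le> s" "s \<le> t"
  shows "((\<lambda>r. CH_Px u ux r (z r)) has_integral (u s (z s) - u t (z t))) {s..t}"
proof -
  have 0: "((\<lambda>r. CH_Px u ux r (z r)) has_integral (u 0 (z 0) - u t (z t))) {0..t}" if "0 \<le> t" for t
    using z that by (simp add: char_curve_def characteristic_def)
  have "(\<lambda>r. CH_Px u ux r (z r)) integrable_on {0..t}" using 0[of t] st by (auto simp: integrable_on_def)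
  then have i: "(\<lambda>r. CH_Px u ux r (z r)) integrable_on {s..t}"
    by (rule integrable_on_subinterval) (use st in auto)
  have "((\<lambda>r. CH_Px u ux r (z r)) has_integral (u 0 (z 0) - u s (z s) + integral {s..t} (\<lambda>r. CH_Px u ux r (z r)))) {0..t}"
    by (rule has_integral_combine[OF st(1) st(2) 0[OF st(1)] integrable_integral[OF i]])
  then have "u 0 (z 0) - u s (z s) + integral {s..t} (\<lambda>r. CH_Px u ux r (z r)) = u 0 (z 0) - u t (z t)"
    by (rule has_integral_unique[OF _ 0]) (use st in auto)
  then have "integral {s..t} (\<lambda>r. CH_Px u ux r (z r)) = u s (z s) - u t (z t)" by linarith
  then show ?thesis using integrable_integral[OF i] by simp
qed

lemma CH_Px_along_curve_integrable:
  assumes z: "continuous_on {0..} z"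
  shows "set_integrable lborel {a..b} (\<lambda>t. CH_Px u ux (max 0 t) (z (max 0 t)))"
  unfolding set_integrable_def
proof (rule Bochner_Integration.integrable_bound[where f="\<lambda>t. indicator {a..b} t * E0"])
  show "integrable lborel (\<lambda>t. indicator {a..b} t * E0)"
    by (intro integrable_mult_left integrable_real_indicator) (auto simp: emeasure_lborel_Icc_eq)
  have "continuous_on UNIV (\<lambda>t. z (max 0 t))"
    by (rule continuous_on_compose2[OF z]) (auto intro!: continuous_intros)
  then have [measurable]: "(\<lambda>t. z (max 0 t)) \<in> borel_measurable borel" by (rule borel_measurable_continuous_onI)
  show "(\<lambda>t. indicat_real {a..b} t *\<^sub>R CH_Px u ux (max 0 t) (z (max 0 t))) \<in> borel_measurable lborel" by measurable
  show "AE t in lborel. norm (indicat_real {a..b} t *\<^sub>R CH_Px u ux (max 0 t) (z (max 0 t))) \<le> norm (indicat_real {a..b} t * E0)"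
    using abs_CH_Px_le E0_nonneg by (auto simp: indicator_def)
qed

text \<open>The equation for \<open>u\<close> along the curve follows from the ordinary differential
  equation: by \<open>weak_equation_along_curve\<close> the continuous function u(t, z t) has the
  weak derivative - P_x at positive times, and continuity extends the integrated identity to time
  0.\<close>

lemma char_curve_if_ode:
  assumes z: "\<And>t. (z has_real_derivative u (max 0 t) (z t)) (at t)"
  shows "char_curve z"
proof -
  have contz: "continuous_on S z" for S
    by (rule DERIV_continuous_on[where D="\<lambda>t. u (max 0 t) (z t)"]) (rule has_field_derivative_at_within[OF z])
  define G where "G t = u (max 0 t) (z t)" for t
  define P where "P t = CH_Px u ux (max 0 t) (z (max 0 t))" for t
  have contG: "continuous_on S G" for S
    unfolding G_def using continuous_on_compose2[OF continuous_u_ext, of S "\<lambda>t. (t, z t)"] contz[of S]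
    by (simp add: continuous_on_Pair)
  have Pint: "set_integrable lborel {a..b} P" for a b
    unfolding P_def[abs_def] by (rule CH_Px_along_curve_integrable[OF contz])
  have eq: "G b - G a = (LINT t:{a..b}|lborel. - P t)" if ab: "0 < a" "a \<le> b" for a b
  proof (rule weak_derivative_imp_FTC[OF ab(2), of "b + 1"])
    show "set_integrable lborel {a..b + 1} (\<lambda>t. - P t)" using Pint[of a "b + 1"] by (simp add: set_integrable_def)
    fix g g' assume g: "test1 g g'" "\<And>x. x \<notin> {a..b + 1} \<Longrightarrow> g x = 0 \<and> g' x = 0"
    have "(LINT t|lborel. G t * g' t) = (LINT t|lborel. CH_Px u ux (max 0 t) (z t) * g t)"
      unfolding G_def by (rule weak_equation_along_curve[OF z g(1) g(2) ab(1)]) (use ab in auto)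
    also have "\<dots> = (LINT t|lborel. P t * g t)"
    proof (rule Bochner_Integration.integral_cong[OF refl])
      fix t
      show "CH_Px u ux (max 0 t) (z t) * g t = P t * g t"
        using g(2)[of t] ab by (cases "t \<in> {a..b + 1}") (auto simp: P_def)
    qed
    finally show "(LINT t|lborel. G t * g' t) = - (LINT t|lborel. - P t * g t)" by simp
  qed (use contG in auto)
  have HK: "(P has_integral (LINT t:{a..b}|lborel. P t)) {a..b}" for a b
    using set_borel_integral_eq_integral[OF Pint[of a b]] by (simp add: has_integral_iff)
  have P0: "(P has_integral (G 0 - G t)) {0..t}" if t: "0 \<le> t" for t
  proof (cases "t = 0")
    case False
    have int: "P integrable_on {0..t}" using HK by (auto simp: integrable_on_def)
    have "isCont G 0" using contG[of UNIV] by (simp add: continuous_on_eq_continuous_at)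
    have lim1: "((\<lambda>a. G a - G t) \<longlongrightarrow> G 0 - G t) (at_right 0)"
      using \<open>isCont G 0\<close> by (intro tendsto_intros) (auto simp: isCont_def intro: tendsto_within_subset)
    have "((\<lambda>a. integral {a..t} P) \<longlongrightarrow> integral {0..t} P) (at 0 within {0..t})"
      using indefinite_integral_continuous_1'[OF int] t by (auto simp: continuous_on_def)
    then have lim2: "((\<lambda>a. integral {a..t} P) \<longlongrightarrow> integral {0..t} P) (at_right 0)"
      using False t by (simp add: at_within_Icc_at_right)
    have "\<forall>\<^sub>F a in at_right 0. G a - G t = integral {a..t} P"
    proof (rule eventually_at_rightI)
      show "0 < t" using t False by simp
      fix a assume "a \<in> {0<..<t}"
      then have "G t - G a = - (LINT t:{a..t}|lborel. P t)" using eq[of a t] by (simp add: set_lebesgue_integral_def)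
      then show "G a - G t = integral {a..t} P" using integral_unique[OF HK[of a t]] by linarith
    qed
    then have "((\<lambda>a. G a - G t) \<longlongrightarrow> integral {0..t} P) (at_right 0)"
      using lim2 by (simp add: filterlim_cong)
    then have "integral {0..t} P = G 0 - G t" using lim1 tendsto_unique[OF trivial_limit_at_right_real] by blast
    then show ?thesis using integrable_integral[OF int] by simp
  qed (simp add: has_integral_refl)
  show ?thesis unfolding char_curve_def characteristic_def
  proof (intro conjI allI impI refl)
    fix t :: real assume t: "0 \<le> t"
    show "(z has_real_derivative u t (z t)) (at t within {0..})"
      using z[of t] t by (simp add: has_field_derivative_at_within max_def split: if_splits)
    show "((\<lambda>s. CH_Px u ux s (z s)) has_integral (u 0 (z 0) - u t (z t))) {0..t}"
    proof (rule has_integral_eq)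
      show "(P has_integral (u 0 (z 0) - u t (z t))) {0..t}" using P0[OF t] t by (simp add: G_def max_def split: if_splits)
      show "P s = CH_Px u ux s (z s)" if "s \<in> {0..t}" for s using that by (simp add: P_def max_def)
    qed
  qed
qed

text \<open>Used at time 0 to transport end points of intervals, at positive times to define flows
  and partitions, and at the final time to trace a given point back.\<close>

lemma char_curve_through: obtains z where "char_curve z" "z t0 = x0"
proof -
  obtain z where "z t0 = x0" "\<And>t. (z has_real_derivative u (max 0 t) (z t)) (at t)"
    by (rule peano_existence[OF continuous_u_ext, of B0 t0 x0]) (use abs_u_le that in auto)
  then show thesis using char_curve_if_ode that by blast
qed

lemma oleinik_ex: "\<exists>c\<ge>0. \<forall>t>0. \<forall>a b. a \<le> b \<longrightarrow> u t b - u t a \<le> c * (1 + 1 / t) * (b - a)"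
proof -
  obtain c where c: "\<And>t. 0 < t \<Longrightarrow> AE x in lborel. ux t x \<le> c * (1 + 1 / t)"
    using diss by (auto simp: dissipative_def)
  have "u t b - u t a \<le> \<bar>c\<bar> * (1 + 1 / t) * (b - a)" if t: "0 < t" and ab: "a \<le> b" for t a b
  proof -
    have le: "c * (1 + 1 / t) \<le> \<bar>c\<bar> * (1 + 1 / t)" using t by (intro mult_right_mono) auto
    have "u t b - u t a = (LINT x:{a..b}|lborel. ux t x)" using u_diff_eq[of t a b] t ab by simp
    also have "\<dots> \<le> (LINT x:{a..b}|lborel. \<bar>c\<bar> * (1 + 1 / t))"
      unfolding set_lebesgue_integral_def
    proof (rule integral_mono_AE)
      show "AE x in lborel. indicat_real {a..b} x *\<^sub>R ux t x \<le> indicat_real {a..b} x *\<^sub>R (\<bar>c\<bar> * (1 + 1 / t))"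
        using c[OF t] by eventually_elim (use le in \<open>auto simp: indicator_def intro: order_trans\<close>)
    qed (use set_integrable_power2_imp[OF meas_ux_t int_ux2, of t a b] set_integrable_lborel_Icc_const[of a b] t
        in \<open>auto simp: set_integrable_def\<close>)
    also have "\<dots> = \<bar>c\<bar> * (1 + 1 / t) * (b - a)" by (rule set_integral_lborel_Icc_const[OF ab])
    finally show ?thesis .
  qed
  then show ?thesis by (intro exI[of _ "\<bar>c\<bar>"]) auto
qed

text \<open>The constant of the dissipativity condition, taken nonnegative and for the integrated
  bound, in which no exceptional null set is left.\<close>

definition Kc :: real where
  "Kc = (SOME c. 0 \<le> c \<and> (\<forall>t>0. \<forall>a b. a \<le> b \<longrightarrow> u t b - u t a \<le> c * (1 + 1 / t) * (b - a)))"

text \<open>An upper bound for the slopes of \<open>u\<close> at all times from \<tau> on. It may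
  blow up as \<tau> tends to 0.\<close>

definition K :: "real \<Rightarrow> real" where "K \<tau> = Kc * (1 + 1 / \<tau>)"

lemma Kc: "0 \<le> Kc" "0 < t \<Longrightarrow> a \<le> b \<Longrightarrow> u t b - u t a \<le> Kc * (1 + 1 / t) * (b - a)"
proof -
  have "0 \<le> Kc \<and> (\<forall>t>0. \<forall>a b. a \<le> b \<longrightarrow> u t b - u t a \<le> Kc * (1 + 1 / t) * (b - a))"
    unfolding Kc_def by (rule someI_ex) (use oleinik_ex in blast)
  then show "0 \<le> Kc" "0 < t \<Longrightarrow> a \<le> b \<Longrightarrow> u t b - u t a \<le> Kc * (1 + 1 / t) * (b - a)" by auto
qed

lemma K_nonneg: "0 < \<tau> \<Longrightarrow> 0 \<le> K \<tau>" using Kc(1) by (simp add: K_def)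

lemma oleinik:
  assumes "0 < \<tau>" "\<tau> \<le> s" "a \<le> b"
  shows "u s b - u s a \<le> K \<tau> * (b - a)"
proof -
  have "Kc * (1 + 1 / s) \<le> K \<tau>"
    unfolding K_def using Kc(1) assms by (intro mult_left_mono) (auto simp: frac_le)
  then have "Kc * (1 + 1 / s) * (b - a) \<le> K \<tau> * (b - a)" using assms by (intro mult_right_mono) auto
  moreover have "u s b - u s a \<le> Kc * (1 + 1 / s) * (b - a)" using assms by (intro Kc(2)) auto
  ultimately show ?thesis by linarith
qed

lemma mult_diff_u_le:
  assumes "\<And>a b. a \<le> b \<Longrightarrow> u s b - u s a \<le> k * (b - a)"
  shows "(y - x) * (u s y - u s x) \<le> k * (y - x)\<^sup>2"
proof (cases "x \<le> y")
  case True
  then have "(y - x) * (u s y - u s x) \<le> (y - x) * (k * (y - x))"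
    using assms by (intro mult_left_mono) auto
  then show ?thesis by (simp add: power2_eq_square mult_ac)
next
  case False
  then have "(x - y) * (u s x - u s y) \<le> (x - y) * (k * (x - y))"
    using assms by (intro mult_left_mono) auto
  then show ?thesis by (simp add: power2_eq_square algebra_simps)
qed

lemma char_curve_diff_deriv:
  assumes "char_curve z1" "char_curve z2" "0 < r"
  shows "((\<lambda>r. z2 r - z1 r) has_real_derivative u r (z2 r) - u r (z1 r)) (at r)"
  using assms by (intro DERIV_diff char_curve_deriv_at)

lemma char_curve_diff_upper:
  assumes z: "char_curve z1" "char_curve z2" and st: "0 < \<tau>" "\<tau> \<le> s" "s \<le> t"
  shows "\<bar>z2 t - z1 t\<bar> \<le> exp (K \<tau> * (t - s)) * \<bar>z2 s - z1 s\<bar>"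
proof -
  have "\<bar>z2 t - z1 t\<bar> \<le> exp (K \<tau> * t - K \<tau> * s) * \<bar>z2 s - z1 s\<bar>"
  proof (rule one_sided_Lipschitz_upper[where d="\<lambda>r. z2 r - z1 r" and d'="\<lambda>r. u r (z2 r) - u r (z1 r)"
        and k="\<lambda>r. K \<tau>" and Kp="\<lambda>r. K \<tau> * r"])
    show "continuous_on {s..t} (\<lambda>r. z2 r - z1 r)"
      using z st by (intro continuous_intros char_curve_cont) auto
    fix r assume r: "s < r" "r < t"
    then have r0: "0 < r" "\<tau> \<le> r" using st by auto
    show "((\<lambda>r. z2 r - z1 r) has_real_derivative u r (z2 r) - u r (z1 r)) (at r)"
      by (rule char_curve_diff_deriv[OF z r0(1)])
    show "((*) (K \<tau>) has_real_derivative K \<tau>) (at r)" by (auto intro!: derivative_eq_intros)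
    show "(z2 r - z1 r) * (u r (z2 r) - u r (z1 r)) \<le> K \<tau> * (z2 r - z1 r)\<^sup>2"
      by (rule mult_diff_u_le) (rule oleinik[OF st(1) r0(2)])
  qed (use st in \<open>auto intro!: continuous_intros\<close>)
  then show ?thesis by (simp add: right_diff_distrib)
qed

text \<open>The upper bound on the slopes of \<open>u\<close> is available at positive times only;
  from time 0 characteristics may split.\<close>

lemma char_curve_unique:
  assumes z: "char_curve z1" "char_curve z2" and st: "0 < s" "s \<le> t" and eq: "z1 s = z2 s"
  shows "z1 t = z2 t"
  using char_curve_diff_upper[OF z st(1) order_refl st(2)] eq by simp

text \<open>Curves that change their order must meet, and if they meet at a positive time they
  coincide afterwards. For s = 0 the starting points have to differ, since curves from a common one
  may separate in either order.\<close>

lemma char_curve_order: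
  assumes z: "char_curve z1" "char_curve z2" and st: "0 \<le> s" "s \<le> t" and ord: "z1 s \<le> z2 s" and strict: "0 < s \<or> z1 s < z2 s"
  shows "z1 t \<le> z2 t"
proof (rule ccontr)
  assume neg: "\<not> z1 t \<le> z2 t"
  have "\<exists>r\<ge>s. r \<le> t \<and> z1 r - z2 r = 0"
  proof (rule IVT'[of "\<lambda>r. z1 r - z2 r" s 0 t])
    show "continuous_on {s..t} (\<lambda>r. z1 r - z2 r)"
      using z st by (intro continuous_on_diff char_curve_cont) auto
  qed (use st ord neg in auto)
  then obtain r where r: "s \<le> r" "r \<le> t" "z1 r = z2 r" by auto
  have "0 < r" using r strict st by (cases "r = s") auto
  then have "z1 t = z2 t" by (rule char_curve_unique[OF z _ r(2,3)])
  then show False using neg by simp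
qed

lemma char_curve_lipschitz:
  assumes z: "char_curve z" and st: "0 \<le> s" "0 \<le> t"
  shows "\<bar>z t - z s\<bar> \<le> B0 * \<bar>t - s\<bar>"
  using field_differentiable_bound[of "{0..}" z "\<lambda>t. u t (z t)" B0 t s] char_curve_deriv[OF z] abs_u_le st
  by auto

section \<open>The sharp Oleinik bound from the variance on transported cells\<close>

lemma meas_cell_variance:
  assumes "continuous_on {0..} z1" "continuous_on {0..} z2"
  shows "(\<lambda>s. cell_variance (ux (max 0 s)) (z1 (max 0 s)) (z2 (max 0 s))) \<in> borel_measurable borel"
proof -
  have "continuous_on UNIV (\<lambda>t. z1 (max 0 t))" "continuous_on UNIV (\<lambda>t. z2 (max 0 t))"
    by (rule continuous_on_compose2[OF assms(1)] continuous_on_compose2[OF assms(2)]; auto intro!: continuous_intros)+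
  then have [measurable]: "(\<lambda>t. z1 (max 0 t)) \<in> borel_measurable borel" "(\<lambda>t. z2 (max 0 t)) \<in> borel_measurable borel"
    by (auto intro: borel_measurable_continuous_onI)
  have ind: "indicat_real {z1 (max 0 s)..z2 (max 0 s)} x = (if z1 (max 0 s) \<le> x \<and> x \<le> z2 (max 0 s) then 1 else 0)" for s x
    by (auto simp: indicator_def)
  have "(\<lambda>s. LINT x|lborel. (if z1 (max 0 s) \<le> x \<and> x \<le> z2 (max 0 s) then 1 else 0) *\<^sub>R (ux (max 0 s) x)\<^sup>2) \<in> borel_measurable borel"
    by (rule lborel.borel_measurable_lebesgue_integral) measurable
  moreover have "(\<lambda>s. LINT x|lborel. (if z1 (max 0 s) \<le> x \<and> x \<le> z2 (max 0 s) then 1 else 0) *\<^sub>R ux (max 0 s) x) \<in> borel_measurable borel"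
    by (rule lborel.borel_measurable_lebesgue_integral) measurable
  ultimately show ?thesis
    unfolding cell_variance_def set_lebesgue_integral_def ind by measurable
qed

lemma cell_variance_integrable:
  assumes z: "char_curve z1" "char_curve z2" and t1: "0 \<le> t1" and ord: "\<And>s. s \<in> {t1..t} \<Longrightarrow> z1 s \<le> z2 s"
  shows "(\<lambda>s. cell_variance (ux s) (z1 s) (z2 s)) integrable_on {t1..t}"
proof -
  have i: "set_integrable lborel {t1..t} (\<lambda>s. cell_variance (ux (max 0 s)) (z1 (max 0 s)) (z2 (max 0 s)))"
    unfolding set_integrable_def
  proof (rule Bochner_Integration.integrable_bound[where f="\<lambda>s. indicator {t1..t} s * E0"])
    show "integrable lborel (\<lambda>s. indicator {t1..t} s * E0)"
      by (intro integrable_mult_left integrable_real_indicator) (auto simp: emeasure_lborel_Icc_eq)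
    have "(\<lambda>s. cell_variance (ux (max 0 s)) (z1 (max 0 s)) (z2 (max 0 s))) \<in> borel_measurable borel"
      by (rule meas_cell_variance) (use z in \<open>auto intro: char_curve_cont\<close>)
    then show "(\<lambda>s. indicat_real {t1..t} s *\<^sub>R cell_variance (ux (max 0 s)) (z1 (max 0 s)) (z2 (max 0 s))) \<in> borel_measurable lborel"
      by measurable
    have "\<bar>cell_variance (ux s) (z1 s) (z2 s)\<bar> \<le> E0" if s: "s \<in> {t1..t}" for s
    proof -
      have s0: "0 \<le> s" using s t1 by auto
      note b = cell_variance_bounds[OF meas_ux_t[OF s0] int_ux2[OF s0] ord[OF s]]
      show ?thesis using b(1,2) set_integral_ux2_le[OF s0, of "z1 s" "z2 s"] by linarith
    qed
    then show "AE s in lborel. norm (indicat_real {t1..t} s *\<^sub>R cell_variance (ux (max 0 s)) (z1 (max 0 s)) (z2 (max 0 s))) \<le> norm (indicat_real {t1..t} s * E0)"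
      using t1 E0_nonneg by (intro AE_I2) (auto simp: indicator_def max_def)
  qed
  have "(\<lambda>s. cell_variance (ux (max 0 s)) (z1 (max 0 s)) (z2 (max 0 s))) integrable_on {t1..t}"
    using set_borel_integral_eq_integral(1)[OF i] .
  then show ?thesis by (rule integrable_eq) (use t1 in \<open>auto simp: max_def\<close>)
qed

lemma continuous_on_u_along:
  assumes "char_curve z" "S \<subseteq> {0..}"
  shows "continuous_on S (\<lambda>s. u s (z s))"
  using continuous_on_compose2[OF cont_u, of S "\<lambda>s. (s, z s)"] char_curve_cont[OF assms] assms(2)
  by (auto simp: continuous_on_Pair)

text \<open>The excess \<open>w = \<Delta>u - g \<Delta>x\<close> of a cell over the Riccati profile \<open>g = 2 / (s - \<tau>) + 2 B0\<close>
  satisfies \<open>w' \<le> variance / 2 + w\<^sup>2 / (2 \<Delta>x)\<close> wherever it is positive.\<close>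

lemma cell_estimate:
  fixes z1 z2 :: "real \<Rightarrow> real"
  assumes z: "char_curve z1" "char_curve z2" and \<tau>: "0 < \<tau>" "\<tau> < t1" "t1 \<le> t"
    and ord: "\<And>s. s \<in> {t1..t} \<Longrightarrow> z1 s \<le> z2 s" and K1: "K \<tau> \<le> 2 / (t1 - \<tau>)"
  shows "u t (z2 t) - u t (z1 t) - (2 / (t - \<tau>) + 2 * B0) * (z2 t - z1 t)
    \<le> integral {t1..t} (\<lambda>s. 1 / 2 * cell_variance (ux s) (z1 s) (z2 s)) * exp (K \<tau> / 2 * (t - t1))"
proof -
  define l where "l s = z2 s - z1 s" for s
  define W where "W s = u s (z2 s) - u s (z1 s)" for s
  \<comment> \<open>2 / (s - \<tau>) solves the Riccati equation g' = - g^2 / 2, and the additional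
    2 * B0 absorbs C0 = \<open>B0\<^sup>2\<close>: together C0 - g' \<le> g^2 / 2.\<close>
  define g where "g s = 2 / (s - \<tau>) + 2 * B0" for s
  define g' where "g' s = - 2 / (s - \<tau>)\<^sup>2" for s
  define V where "V s = cell_variance (ux s) (z1 s) (z2 s)" for s
  define w where "w s = W s - g s * l s" for s
  have sub: "{t1..t} \<subseteq> {0..}" using \<tau> by auto
  have contl: "continuous_on {t1..t} l" unfolding l_def using z sub by (intro continuous_intros char_curve_cont)
  have contW: "continuous_on {t1..t} W" unfolding W_def using z sub by (intro continuous_intros continuous_on_u_along)
  have contg: "continuous_on {t1..t} g" unfolding g_def using \<tau> by (intro continuous_intros) auto
  have contw: "continuous_on {t1..t} w" unfolding w_def by (intro continuous_intros contl contW contg)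
  have Vi: "V integrable_on {t1..t}" unfolding V_def by (rule cell_variance_integrable[OF z _ ord]) (use \<tau> in auto)
  have l0: "0 \<le> l s" and WK: "W s \<le> K \<tau> * l s" and V0: "0 \<le> V s"
    and Veq: "V s = (LINT x:{z1 s..z2 s}|lborel. (ux s x)\<^sup>2) - (W s)\<^sup>2 / l s" if s: "s \<in> {t1..t}" for s
  proof -
    have s0: "0 \<le> s" "\<tau> \<le> s" using s \<tau> by auto
    show "0 \<le> l s" using ord[OF s] by (simp add: l_def)
    show "W s \<le> K \<tau> * l s" unfolding W_def l_def by (rule oleinik[OF \<tau>(1) s0(2) ord[OF s]])
    show "0 \<le> V s" unfolding V_def by (rule cell_variance_bounds(1)[OF meas_ux_t[OF s0(1)] int_ux2[OF s0(1)] ord[OF s]])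
    show "V s = (LINT x:{z1 s..z2 s}|lborel. (ux s x)\<^sup>2) - (W s)\<^sup>2 / l s"
      by (simp add: V_def cell_variance_def W_def l_def u_diff_eq[OF s0(1) ord[OF s]])
  qed
  have "w t \<le> integral {t1..t} (\<lambda>s. 1 / 2 * V s) * exp (K \<tau> / 2 * (t - t1))"
  \<comment> \<open>The quadratic term is made linear only where \<open>w\<close> is nonnegative,
    whence the positive-part form of Gronwall.\<close>
  proof (rule gronwall_positive_part[OF \<tau>(3) _ contw])
    show "0 \<le> K \<tau> / 2" using K_nonneg[OF \<tau>(1)] by simp
    \<comment> \<open>\<open>K1\<close> places the crude Oleinik bound below the profile at the
      starting time.\<close>
    have "W t1 \<le> g t1 * l t1"
    proof -
      have "K \<tau> * l t1 \<le> g t1 * l t1"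
        using K1 B0_nonneg l0[of t1] \<tau> by (intro mult_right_mono) (auto simp: g_def)
      then show ?thesis using WK[of t1] \<tau> by simp
    qed
    then show "w t1 \<le> 0" by (simp add: w_def)
    show "0 \<le> 1 / 2 * V s" if "s \<in> {t1..t}" for s using V0[OF that] by simp
    show "(\<lambda>s. 1 / 2 * V s) integrable_on {t1..t}" using integrable_on_cmult_left[OF Vi, of "1/2"] by simp
    fix s1 s2 assume s: "t1 \<le> s1" "s1 \<le> s2" "s2 \<le> t" and pos: "\<And>s. s1 < s \<Longrightarrow> s \<le> s2 \<Longrightarrow> 0 < w s"
    show "w s2 - w s1 \<le> integral {s1..s2} (\<lambda>s. 1 / 2 * V s) + K \<tau> / 2 * integral {s1..s2} w"
    proof (cases "s1 = s2")
      case False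
      then have s12: "s1 < s2" using s by simp
      have subs: "{s1..s2} \<subseteq> {t1..t}" using s by auto
      have pos0: "0 \<le> w r" if "r \<in> {s1..s2}" for r
      proof (rule continuous_ge_on_closure[of "{s1<..<s2}" w])
        show "continuous_on (closure {s1<..<s2}) w" using s12 subs contw by (simp add: continuous_on_subset)
        show "r \<in> closure {s1<..<s2}" using s12 that by simp
        show "0 \<le> w x" if "x \<in> {s1<..<s2}" for x using pos[of x] that by auto
      qed
      define h where "h s = (CH_Px u ux s (z1 s) - CH_Px u ux s (z2 s)) - (g' s * l s + g s * W s)" for s
      have P: "((\<lambda>s. CH_Px u ux s (z1 s) - CH_Px u ux s (z2 s)) has_integral
          (u s1 (z1 s1) - u s2 (z1 s2)) - (u s1 (z2 s1) - u s2 (z2 s2))) {s1..s2}"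
        using s \<tau> by (intro has_integral_diff char_curve_u z) auto
      have "((\<lambda>s. g' s * l s + g s * W s) has_integral (g s2 * l s2 - g s1 * l s1)) {s1..s2}"
      proof (rule fundamental_theorem_of_calculus[OF s(2)])
        fix r assume "r \<in> {s1..s2}"
        then have r: "\<tau> < r" "0 < r" using s \<tau> by auto
        have "(g has_real_derivative g' r) (at r)"
          unfolding g_def g'_def using r by (auto intro!: derivative_eq_intros simp: power2_eq_square)
        moreover have "(l has_real_derivative W r) (at r)"
          unfolding l_def[abs_def] W_def by (rule char_curve_diff_deriv[OF z r(2)])
        ultimately have "((\<lambda>r. g r * l r) has_real_derivative g' r * l r + g r * W r) (at r)"
          using DERIV_mult[of g "g' r" r UNIV l "W r"] by (simp add: add.commute mult.commute)
        then show "((\<lambda>r. g r * l r) has_vector_derivative g' r * l r + g r * W r) (at r within {s1..s2})"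
          by (simp add: has_real_derivative_iff_has_vector_derivative has_vector_derivative_at_within)
      qed
      from has_integral_diff[OF P this] have hi: "(h has_integral (w s2 - w s1)) {s1..s2}"
        unfolding h_def w_def W_def by (simp add: algebra_simps)
      have i1: "(\<lambda>s. 1 / 2 * V s) integrable_on {s1..s2}"
        using integrable_on_cmult_left[OF integrable_on_subinterval[OF Vi subs], of "1/2"] by simp
      have i2: "(\<lambda>s. K \<tau> / 2 * w s) integrable_on {s1..s2}"
        by (intro integrable_continuous_real continuous_intros continuous_on_subset[OF contw subs])
      have "w s2 - w s1 \<le> integral {s1..s2} (\<lambda>s. 1 / 2 * V s + K \<tau> / 2 * w s)"
      proof (rule has_integral_le[OF hi integrable_integral[OF integrable_add[OF i1 i2]]])
        fix r assume r': "r \<in> {s1..s2}"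
        then have r: "r \<in> {t1..t}" using subs by auto
        have r0: "0 \<le> r" "\<tau> < r" using r \<tau> by auto
        have Px: "CH_Px u ux r (z1 r) - CH_Px u ux r (z2 r) \<le> 1 / 2 * (LINT x:{z1 r..z2 r}|lborel. (ux r x)\<^sup>2) + C0 * l r"
          unfolding l_def by (rule CH_Px_diff_bounds(1)[OF r0(1) ord[OF r]])
        show "h r \<le> 1 / 2 * V r + K \<tau> / 2 * w r"
        proof (cases "l r = 0")
          case True
          then have "W r = 0" by (simp add: l_def W_def)
          then show ?thesis using Px True Veq[OF r] by (simp add: h_def w_def)
        next
          case False
          then have lp: "0 < l r" using l0[OF r] by simp
          define q where "q = 1 / (r - \<tau>)"
          have q: "0 < q" "g r = 2 * q + 2 * B0" "g' r = - 2 * q\<^sup>2" using r0 by (auto simp: q_def g_def g'_def power_divide)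
          have g0: "0 \<le> g r" using q B0_nonneg by simp
          \<comment> \<open>The crude bound W \<le> K \<tau> * l turns the quadratic term into a
            linear one.\<close>
          have wl: "(w r)\<^sup>2 / l r \<le> K \<tau> * w r"
          proof -
            have "0 \<le> g r * l r" using g0 lp by simp
            then have "w r \<le> K \<tau> * l r" using WK[OF r] unfolding w_def by linarith
            then have "w r * w r \<le> K \<tau> * l r * w r" using pos0[OF r'] by (intro mult_right_mono) auto
            then show ?thesis using lp by (simp add: divide_le_eq power2_eq_square mult_ac)
          qed
          have sq: "(w r)\<^sup>2 / l r = (W r)\<^sup>2 / l r - 2 * g r * W r + (g r)\<^sup>2 * l r"
            unfolding w_def using lp by (simp add: field_simps power2_eq_square)
          have "C0 - g' r \<le> (g r)\<^sup>2 / 2"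
            unfolding q C0_def using q(1) B0_nonneg by (simp add: power2_sum power_mult_distrib)
          then have "(C0 - g' r) * l r \<le> (g r)\<^sup>2 / 2 * l r" using lp by (intro mult_right_mono) auto
          then show ?thesis using Px Veq[OF r] wl sq unfolding h_def by (simp add: algebra_simps)
        qed
      qed
      also have "\<dots> = integral {s1..s2} (\<lambda>s. 1 / 2 * V s) + K \<tau> / 2 * integral {s1..s2} w"
        unfolding integral_add[OF i1 i2] by simp
      finally show ?thesis .
    qed simp
  qed
  then show ?thesis by (simp add: w_def W_def g_def l_def V_def)
qed

text \<open>The interval is split into \<open>n\<close> cells transported by the flow. The cell
  estimates telescope, and at each time the sum of the variances tends to 0 with the mesh because
  \<open>ux\<close> is square integrable. Dominated convergence in time, with majorant
  \<open>E0\<close>, removes the error.\<close>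

lemma oleinik_from_time:
  assumes \<tau>: "0 < \<tau>" "\<tau> < t" and ab: "a \<le> b"
  shows "u t b - u t a \<le> (2 / (t - \<tau>) + 2 * B0) * (b - a)"
proof (cases "a = b")
  case False
  then have "a < b" using ab by simp
  \<comment> \<open>\<open>t1\<close> is so close to \<tau> that 2 / (t1 - \<tau>) exceeds the crude
    constant K \<tau>, as \<open>cell_estimate\<close> demands.\<close>
  define t1 where "t1 = \<tau> + min ((t - \<tau>) / 2) (1 / (K \<tau> + 1))"
  have K0: "0 \<le> K \<tau>" by (rule K_nonneg[OF \<tau>(1)])
  have "t1 \<le> \<tau> + (t - \<tau>) / 2" unfolding t1_def by (intro add_left_mono min.cobounded1)
  moreover have "0 < 1 / (K \<tau> + 1)" using K0 by simp
  then have "0 < min ((t - \<tau>) / 2) (1 / (K \<tau> + 1))" using \<tau> by simp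
  ultimately have t1: "\<tau> < t1" "t1 < t" using \<tau> by (auto simp: t1_def)
  have "t1 - \<tau> \<le> 1 / (K \<tau> + 1)" by (simp add: t1_def)
  then have "(K \<tau> + 1) * (t1 - \<tau>) \<le> 1" using K0 by (simp add: field_simps)
  then have "K \<tau> * (t1 - \<tau>) \<le> 2" using t1 by (simp add: algebra_simps)
  then have K1: "K \<tau> \<le> 2 / (t1 - \<tau>)" using t1 by (simp add: pos_le_divide_eq)
  have t10: "0 < t1" using t1 \<tau> by simp
  obtain p where p: "char_curve p" "p t = a" by (rule char_curve_through)
  obtain q where q: "char_curve q" "q t = b" by (rule char_curve_through)
  have pq: "p t1 \<le> q t1"
    using char_curve_order[OF q(1) p(1), of t1 t] p(2) q(2) \<open>a < b\<close> t1 t10 by fastforce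
  have "\<exists>z. char_curve z \<and> z t1 = x" for x by (rule char_curve_through) blast
  then obtain Zc where Zc: "\<And>x. char_curve (Zc x)" "\<And>x. Zc x t1 = x" by metis
  \<comment> \<open>Equidistant points at time \<open>t1\<close>. Forward from \<open>t1\<close>
    distances grow at most by the factor \<open>E\<close>, so the mesh stays of order 1 / n at all
    later times up to \<open>t\<close>.\<close>
  define x where "x n i = p t1 + real i * ((q t1 - p t1) / real n)" for n i
  define y where "y n i s = Zc (x n i) s" for n i s
  define E where "E = exp (K \<tau> * (t - t1))"
  define L where "L = E * (q t1 - p t1)"
  have L0: "0 \<le> L" using pq by (simp add: L_def E_def)
  have ymono: "y n i s \<le> y n (Suc i) s" and ymesh: "y n (Suc i) s - y n i s \<le> L / real n" if s: "s \<in> {t1..t}" for n i s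
  proof -
    have xs: "x n (Suc i) - x n i = (q t1 - p t1) / real n"
      by (simp add: x_def distrib_right del: times_divide_eq_right)
    moreover have "0 \<le> (q t1 - p t1) / real n" using pq by simp
    ultimately have xm: "x n i \<le> x n (Suc i)" by linarith
    show "y n i s \<le> y n (Suc i) s"
      unfolding y_def by (rule char_curve_order[OF Zc(1) Zc(1), of t1]) (use xm Zc(2) t10 s in auto)
    have "\<bar>y n (Suc i) s - y n i s\<bar> \<le> exp (K \<tau> * (s - t1)) * \<bar>x n (Suc i) - x n i\<bar>"
      using char_curve_diff_upper[OF Zc(1)[of "x n i"] Zc(1)[of "x n (Suc i)"] \<tau>(1), of t1 s] t1 s by (simp add: y_def Zc(2))
    also have "\<dots> \<le> E * \<bar>x n (Suc i) - x n i\<bar>"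
      unfolding E_def using K0 s by (intro mult_right_mono) (auto intro!: mult_left_mono)
    also have "\<dots> = L / real n" unfolding xs L_def using pq by simp
    finally show "y n (Suc i) s - y n i s \<le> L / real n" by linarith
  qed
  define V where "V n i s = cell_variance (ux s) (y n i s) (y n (Suc i) s)" for n i s
  have ych: "char_curve (y n i)" for n i unfolding y_def[abs_def] by (rule Zc(1))
  have yends: "y n 0 t = a" "n \<noteq> 0 \<Longrightarrow> y n n t = b" for n
  proof -
    have "y n 0 t = p t" by (rule char_curve_unique[OF ych p(1) t10 less_imp_le[OF t1(2)]]) (simp add: y_def x_def Zc(2))
    then show "y n 0 t = a" using p(2) by simp
    assume "n \<noteq> 0"
    then have "y n n t = q t"
      by (intro char_curve_unique[OF ych q(1) t10 less_imp_le[OF t1(2)]]) (simp add: y_def x_def Zc(2))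
    then show "y n n t = b" using q(2) by simp
  qed
  have Vi: "(\<lambda>s. 1 / 2 * V n i s) integrable_on {t1..t}" for n i
    using integrable_on_cmult_left[OF cell_variance_integrable[OF ych[of n i] ych[of n "Suc i"], of t1 t], of "1/2"] t10 ymono
    by (simp add: V_def)
  define R where "R n = integral {t1..t} (\<lambda>s. \<Sum>i<n. 1 / 2 * V n i s)" for n
  have main: "u t b - u t a - (2 / (t - \<tau>) + 2 * B0) * (b - a) \<le> R n * exp (K \<tau> / 2 * (t - t1))" if n: "n \<noteq> 0" for n
  proof -
    define gt where "gt = 2 / (t - \<tau>) + 2 * B0"
    define f where "f i = u t (y n i t) - gt * y n i t" for i
    have "f (Suc i) - f i \<le> integral {t1..t} (\<lambda>s. 1 / 2 * V n i s) * exp (K \<tau> / 2 * (t - t1))" for i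
      using cell_estimate[OF ych[of n i] ych[of n "Suc i"] \<tau>(1) t1(1) less_imp_le[OF t1(2)] ymono K1]
      unfolding gt_def[symmetric] by (simp add: f_def V_def algebra_simps)
    then have "(\<Sum>i<n. f (Suc i) - f i) \<le> (\<Sum>i<n. integral {t1..t} (\<lambda>s. 1 / 2 * V n i s) * exp (K \<tau> / 2 * (t - t1)))"
      by (intro sum_mono)
    also have "\<dots> = R n * exp (K \<tau> / 2 * (t - t1))"
      unfolding R_def sum_distrib_right[symmetric] by (subst integral_sum) (use Vi in auto)
    also have "(\<Sum>i<n. f (Suc i) - f i) = f n - f 0" by (rule sum_lessThan_telescope)
    also have "\<dots> = u t b - u t a - (2 / (t - \<tau>) + 2 * B0) * (b - a)"
      using yends(1)[of n] yends(2)[OF n] unfolding gt_def[symmetric] by (simp add: f_def algebra_simps)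
    finally show ?thesis .
  qed
  have "R \<longlonglongrightarrow> integral {t1..t} (\<lambda>s. 0)"
    unfolding R_def
  proof (rule dominated_convergence(2)[where h="\<lambda>s. E0"])
    show "(\<lambda>s. \<Sum>i<n. 1 / 2 * V n i s) integrable_on {t1..t}" for n
      by (intro integrable_sum Vi) auto
    show "norm (\<Sum>i<n. 1 / 2 * V n i s) \<le> E0" if s: "s \<in> {t1..t}" for n s
    proof -
      have s0: "0 \<le> s" using s t10 by simp
      note b = cell_variance_bounds[OF meas_ux_t[OF s0] int_ux2[OF s0] ymono[OF s]]
      have "0 \<le> (\<Sum>i<n. 1 / 2 * V n i s)" using b(1) by (intro sum_nonneg) (simp add: V_def)
      moreover have "(\<Sum>i<n. 1 / 2 * V n i s) \<le> (\<Sum>i<n. LINT x:{y n i s..y n (Suc i) s}|lborel. (ux s x)\<^sup>2)"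
      proof (rule sum_mono)
        fix i
        show "1 / 2 * V n i s \<le> (LINT x:{y n i s..y n (Suc i) s}|lborel. (ux s x)\<^sup>2)"
          using b(1)[of n i] b(2)[of n i] unfolding V_def by linarith
      qed
      moreover have "(\<Sum>i<n. LINT x:{y n i s..y n (Suc i) s}|lborel. (ux s x)\<^sup>2) \<le> E0"
        using sum_set_integral_partition(2)[OF int_ux2[OF s0], of n "\<lambda>i. y n i s"] ymono[OF s]
          set_integral_ux2_le[OF s0] E0_nonneg by auto
      ultimately show ?thesis by simp
    qed
    show "(\<lambda>n. \<Sum>i<n. 1 / 2 * V n i s) \<longlonglongrightarrow> 0" if s: "s \<in> {t1..t}" for s
    proof (rule LIMSEQ_I)
      fix e :: real assume e: "0 < e"
      have s0: "0 \<le> s" using s t10 by simp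
      note b = cell_variance_bounds[OF meas_ux_t[OF s0] int_ux2[OF s0] ymono[OF s]]
      have "\<exists>\<delta>>0. \<forall>n (y::nat \<Rightarrow> real). (\<forall>i<n. y i \<le> y (Suc i) \<and> y (Suc i) - y i \<le> \<delta>) \<longrightarrow> y n - y 0 \<le> L \<longrightarrow>
         (\<Sum>i<n. cell_variance (ux s) (y i) (y (Suc i))) \<le> e"
        by (rule sum_cell_variance_small[OF meas_ux_t[OF s0] int_ux2[OF s0] e L0]) blast
      then obtain \<delta> where \<delta>: "0 < \<delta>" "\<forall>n (y::nat \<Rightarrow> real). (\<forall>i<n. y i \<le> y (Suc i) \<and> y (Suc i) - y i \<le> \<delta>) \<longrightarrow> y n - y 0 \<le> L \<longrightarrow>
         (\<Sum>i<n. cell_variance (ux s) (y i) (y (Suc i))) \<le> e" by blast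
      obtain N :: nat where N: "L / \<delta> < real N" using reals_Archimedean2 by blast
      show "\<exists>N. \<forall>n\<ge>N. norm ((\<Sum>i<n. 1 / 2 * V n i s) - 0) < e"
      proof (intro exI[of _ N] allI impI)
        fix n assume n: "N \<le> n"
        have n0: "0 < real n"
        proof -
          have "0 \<le> L / \<delta>" using L0 \<delta>(1) by simp
          then have "0 < real N" using N by linarith
          then show ?thesis using n by simp
        qed
        have "L / \<delta> < real n" using N n by (meson less_le_trans of_nat_le_iff)
        then have "L / real n \<le> \<delta>" using \<delta>(1) n0 by (simp add: field_simps)
        then have m: "y n i s \<le> y n (Suc i) s \<and> y n (Suc i) s - y n i s \<le> \<delta>" for i
          using ymono[OF s, of n i] ymesh[OF s, of n i] by linarith
        have tot: "y n n s - y n 0 s \<le> L"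
        proof -
          have "y n n s - y n 0 s = (\<Sum>i<n. y n (Suc i) s - y n i s)"
            by (rule sum_lessThan_telescope[symmetric, of "\<lambda>i. y n i s"])
          also have "\<dots> \<le> (\<Sum>i<n. L / real n)" by (intro sum_mono ymesh[OF s])
          also have "\<dots> = L" using n0 by simp
          finally show ?thesis .
        qed
        have le: "(\<Sum>i<n. V n i s) \<le> e" unfolding V_def by (rule \<delta>(2)[rule_format, of n "\<lambda>i. y n i s"]) (use m tot in simp_all)
        have "0 \<le> (\<Sum>i<n. V n i s)" using b(1) by (intro sum_nonneg) (simp add: V_def)
        moreover have "(\<Sum>i<n. 1 / 2 * V n i s) = 1 / 2 * (\<Sum>i<n. V n i s)" by (simp add: sum_distrib_left)
        ultimately show "norm ((\<Sum>i<n. 1 / 2 * V n i s) - 0) < e" using le e unfolding real_norm_def by linarith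
      qed
    qed
  qed auto
  then have "(\<lambda>n. R n * exp (K \<tau> / 2 * (t - t1))) \<longlonglongrightarrow> 0 * exp (K \<tau> / 2 * (t - t1))"
    by (intro tendsto_intros) simp
  then have "u t b - u t a - (2 / (t - \<tau>) + 2 * B0) * (b - a) \<le> 0 * exp (K \<tau> / 2 * (t - t1))"
    by (rule LIMSEQ_le_const) (use main in \<open>auto intro!: exI[of _ 1]\<close>)
  then show ?thesis by simp
qed simp

text \<open>Limit of \<open>oleinik_from_time\<close> as \<tau> tends to 0, possible because the
  crude constant K \<tau> has left the estimate.\<close>

theorem sharp_oleinik:
  assumes t: "0 < t" and ab: "a \<le> b"
  shows "u t b - u t a \<le> (2 / t + 2 * B0) * (b - a)"
proof (rule tendsto_lowerbound[where F="at_right 0" and f="\<lambda>\<tau>. (2 / (t - \<tau>) + 2 * B0) * (b - a)"])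
  have "((\<lambda>\<tau>. (2 / (t - \<tau>) + 2 * B0) * (b - a)) \<longlongrightarrow> (2 / (t - 0) + 2 * B0) * (b - a)) (at_right 0)"
    using t by (intro tendsto_intros) auto
  then show "((\<lambda>\<tau>. (2 / (t - \<tau>) + 2 * B0) * (b - a)) \<longlongrightarrow> (2 / t + 2 * B0) * (b - a)) (at_right 0)" by simp
  show "\<forall>\<^sub>F \<tau> in at_right 0. u t b - u t a \<le> (2 / (t - \<tau>) + 2 * B0) * (b - a)"
    by (rule eventually_at_rightI[OF _ t]) (use oleinik_from_time ab in auto)
qed simp

text \<open>The rate 2 / r has the primitive 2 * ln r, which produces (t / s)^2. This square is what
  the lengths o(s^2) near time 0 compensate.\<close>

lemma char_curve_diff_sharp:
  assumes z: "char_curve z1" "char_curve z2" and st: "0 < s" "s \<le> t"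
  shows "\<bar>z2 t - z1 t\<bar> \<le> (t / s)\<^sup>2 * exp (2 * B0 * (t - s)) * \<bar>z2 s - z1 s\<bar>"
proof -
  define Kp where "Kp r = 2 * ln r + 2 * B0 * r" for r
  have "\<bar>z2 t - z1 t\<bar> \<le> exp (Kp t - Kp s) * \<bar>z2 s - z1 s\<bar>"
  proof (rule one_sided_Lipschitz_upper[where d="\<lambda>r. z2 r - z1 r" and d'="\<lambda>r. u r (z2 r) - u r (z1 r)"
        and k="\<lambda>r. 2 / r + 2 * B0" and Kp=Kp])
    show "continuous_on {s..t} (\<lambda>r. z2 r - z1 r)"
      using z st by (intro continuous_on_diff char_curve_cont) auto
    show "continuous_on {s..t} Kp" unfolding Kp_def using st by (intro continuous_intros) auto
    fix r assume r: "s < r" "r < t"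
    then have r0: "0 < r" using st by auto
    show "((\<lambda>r. z2 r - z1 r) has_real_derivative u r (z2 r) - u r (z1 r)) (at r)"
      by (rule char_curve_diff_deriv[OF z r0])
    show "(Kp has_real_derivative 2 / r + 2 * B0) (at r)"
      unfolding Kp_def using r0 by (auto intro!: derivative_eq_intros)
    show "(z2 r - z1 r) * (u r (z2 r) - u r (z1 r)) \<le> (2 / r + 2 * B0) * (z2 r - z1 r)\<^sup>2"
      by (rule mult_diff_u_le) (rule sharp_oleinik[OF r0])
  qed (rule st)
  moreover have "exp (Kp t - Kp s) = (t / s)\<^sup>2 * exp (2 * B0 * (t - s))"
  proof -
    have "Kp t - Kp s = ln (t / s) + ln (t / s) + 2 * B0 * (t - s)"
      using st by (simp add: Kp_def ln_div algebra_simps)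
    then have "exp (Kp t - Kp s) = exp (ln (t / s)) * exp (ln (t / s)) * exp (2 * B0 * (t - s))"
      by (simp only: exp_add)
    then show ?thesis using st by (simp add: power2_eq_square)
  qed
  ultimately show ?thesis by simp
qed

section \<open>Strong continuity at the initial time\<close>

text \<open>\<open>u s\<close> converges to \<open>u 0\<close> uniformly on compact sets, so no mass
  of (u 0)^2 is lost in the limit. By the energy inequality the integral of (ux s)^2 then exceeds
  that of (ux 0)^2 by at most e for small s.\<close>

lemma energy_u_lower_semicontinuous:
  assumes e: "0 < e"
  shows "\<exists>s0>0. \<forall>s\<in>{0..s0}. (LINT x|lborel. (u 0 x)\<^sup>2) - e \<le> (LINT x|lborel. (u s x)\<^sup>2)"
proof -
  have lim: "(\<lambda>n. LINT x:{- real n..real n}|lborel. (u 0 x)\<^sup>2) \<longlonglongrightarrow> (LINT x|lborel. (u 0 x)\<^sup>2)"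
    unfolding set_lebesgue_integral_def
  proof (rule integral_dominated_convergence[where w="\<lambda>x. (u 0 x)\<^sup>2"])
    have [measurable]: "u 0 \<in> borel_measurable borel" by (rule meas_u_t) simp
    show "(\<lambda>x. indicat_real {- real n..real n} x *\<^sub>R (u 0 x)\<^sup>2) \<in> borel_measurable lborel" for n by measurable
    show "(\<lambda>x. (u 0 x)\<^sup>2) \<in> borel_measurable lborel" by measurable
    show "AE x in lborel. (\<lambda>n. indicat_real {- real n..real n} x *\<^sub>R (u 0 x)\<^sup>2) \<longlonglongrightarrow> (u 0 x)\<^sup>2"
    proof (rule AE_I2)
      fix x
      have "eventually (\<lambda>n. real n \<ge> \<bar>x\<bar>) sequentially"
        using filterlim_real_sequentially by (simp add: filterlim_at_top)
      then have "eventually (\<lambda>n. indicat_real {- real n..real n} x *\<^sub>R (u 0 x)\<^sup>2 = (u 0 x)\<^sup>2) sequentially"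
        by eventually_elim (auto simp: indicator_def)
      then show "(\<lambda>n. indicat_real {- real n..real n} x *\<^sub>R (u 0 x)\<^sup>2) \<longlonglongrightarrow> (u 0 x)\<^sup>2" by (rule tendsto_eventually)
    qed
  qed (use int_u2[of 0] in \<open>auto simp: indicator_def\<close>)
  have "eventually (\<lambda>n. (LINT x|lborel. (u 0 x)\<^sup>2) - e / 2 < (LINT x:{- real n..real n}|lborel. (u 0 x)\<^sup>2)) sequentially"
    by (rule order_tendstoD(1)[OF lim]) (use e in simp)
  then obtain n :: nat where n: "(LINT x|lborel. (u 0 x)\<^sup>2) - e / 2 < (LINT x:{- real n..real n}|lborel. (u 0 x)\<^sup>2)"
    by (auto simp: eventually_sequentially)
  define R where "R = real n"
  have R0: "0 \<le> R" by (simp add: R_def)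
  \<comment> \<open>On [-R, R] the square of \<open>u\<close> drops by at most 2 * B0 * \<eta>;
    integrated this is at most e / 2.\<close>
  define \<eta> where "\<eta> = e / (2 * (2 * B0) * (2 * R + 1))"
  have \<eta>: "0 < \<eta>" using e B0_pos R0 by (simp add: \<eta>_def)
  have "continuous_on ({0..1} \<times> {-R..R}) (\<lambda>p. u (fst p) (snd p))"
    by (rule continuous_on_subset[OF cont_u]) auto
  then have "uniformly_continuous_on ({0..1} \<times> {-R..R}) (\<lambda>p. u (fst p) (snd p))"
    by (rule compact_uniformly_continuous) (auto intro: compact_Times)
  then obtain d where d: "0 < d" "\<And>p q. p \<in> {0..1} \<times> {-R..R} \<Longrightarrow> q \<in> {0..1} \<times> {-R..R} \<Longrightarrow> dist q p < d \<Longrightarrow>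
      dist (u (fst q) (snd q)) (u (fst p) (snd p)) < \<eta>"
    unfolding uniformly_continuous_on_def using \<eta> by metis
  show ?thesis
  proof (intro exI[of _ "min 1 (d / 2)"] conjI ballI)
    show "0 < min 1 (d / 2)" using d(1) by simp
    fix s assume s: "s \<in> {0..min 1 (d / 2)}"
    then have s0: "0 \<le> s" "s \<le> 1" "s < d" using d(1) by auto
    have pt: "(u 0 x)\<^sup>2 - 2 * B0 * \<eta> \<le> (u s x)\<^sup>2" if x: "x \<in> {-R..R}" for x
    proof -
      have "dist (u s x) (u 0 x) < \<eta>"
        using d(2)[of "(0, x)" "(s, x)"] s0 x by (simp add: dist_Pair_Pair dist_real_def)
      then have a: "\<bar>u s x - u 0 x\<bar> \<le> \<eta>" by (simp add: dist_real_def)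
      have "\<bar>u 0 x + u s x\<bar> \<le> 2 * B0" using abs_u_le[of 0 x] abs_u_le[OF s0(1), of x] by linarith
      then have "\<bar>(u 0 x + u s x) * (u s x - u 0 x)\<bar> \<le> 2 * B0 * \<eta>"
        unfolding abs_mult using a B0_nonneg by (intro mult_mono) auto
      then show ?thesis by (simp add: algebra_simps power2_eq_square abs_le_iff)
    qed
    note i = set_integrable_subset_UNIV[OF int_u2[of 0], of "-R" R]
    have "(LINT x:{-R..R}|lborel. (u 0 x)\<^sup>2) - 2 * B0 * \<eta> * (2 * R) = (LINT x:{-R..R}|lborel. (u 0 x)\<^sup>2 - 2 * B0 * \<eta>)"
      using i R0 set_integrable_lborel_Icc_const[of "-R" R "2 * B0 * \<eta>"]
      by (simp add: set_integral_diff set_integral_lborel_Icc_const)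
    also have "\<dots> \<le> (LINT x:{-R..R}|lborel. (u s x)\<^sup>2)"
      by (intro set_integral_mono set_integral_diff(1) set_integrable_lborel_Icc_const
          set_integrable_subset_UNIV int_u2 s0 order_refl pt)
    also have "\<dots> \<le> (LINT x|lborel. (u s x)\<^sup>2)" by (rule set_integral_le_UNIV[OF int_u2[OF s0(1)]]) simp
    finally have 1: "(LINT x:{-R..R}|lborel. (u 0 x)\<^sup>2) - 2 * B0 * \<eta> * (2 * R) \<le> (LINT x|lborel. (u s x)\<^sup>2)" .
    have "2 * B0 * \<eta> * (2 * R) \<le> 2 * B0 * \<eta> * (2 * R + 1)" using \<eta> B0_nonneg by (intro mult_left_mono) auto
    also have "\<dots> = e / 2"
    proof -
      have "b * (e / (2 * b * c)) * c = e / 2" if "b \<noteq> 0" "c \<noteq> 0" for b c :: real using that by simp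
      from this[of "2 * B0" "2 * R + 1"] show ?thesis using B0_pos R0 by (simp add: \<eta>_def)
    qed
    finally show "(LINT x|lborel. (u 0 x)\<^sup>2) - e \<le> (LINT x|lborel. (u s x)\<^sup>2)"
      using 1 n by (simp add: R_def)
  qed
qed

text \<open>Weak convergence of \<open>ux s\<close> to \<open>ux 0\<close> (tested on step functions) and
  \<open>limsup \<parallel>ux s\<parallel> \<le> \<parallel>ux 0\<parallel>\<close>, which is the energy inequality, give strong convergence.\<close>

lemma equi_integrable_at_0:
  assumes e: "0 < e"
  obtains \<delta> s0 where "0 < \<delta>" "0 < s0"
    "\<And>s A. s \<in> {0..s0} \<Longrightarrow> A \<in> sets borel \<Longrightarrow> emeasure lborel A \<le> ennreal \<delta> \<Longrightarrow> (LINT x:A|lborel. (ux s x)\<^sup>2) \<le> e"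
proof -
  have m0: "ux 0 \<in> borel_measurable borel" and i0: "integrable lborel (\<lambda>x. (ux 0 x)\<^sup>2)"
    using meas_ux_t[of 0] int_ux2[of 0] by auto
  have "0 < e / 16" using e by simp
  then have "\<exists>(n::nat) (a::real) (h::real) (c::nat \<Rightarrow> real). 0 < h \<and> (LINT x|lborel. (ux 0 x - (\<Sum>i<n. c i * indicator {a + i * h..<a + Suc i * h} x))\<^sup>2) \<le> e / 16"
    by (rule L2_dense_step[OF m0 i0]) blast
  then obtain n :: nat and a h :: real and c :: "nat \<Rightarrow> real" where h: "0 < h"
    and D0: "(LINT x|lborel. (ux 0 x - (\<Sum>i<n. c i * indicator {a + i * h..<a + Suc i * h} x))\<^sup>2) \<le> e / 16" by blast
  define x where "x i = a + real i * h" for i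
  define G where "G y = (\<Sum>i<n. c i * indicator {x i..<x (Suc i)} y)" for y
  define C where "C = (\<Sum>i<n. \<bar>c i\<bar>) + 1"
  have C0: "1 \<le> C" unfolding C_def by (simp add: sum_nonneg)
  have xm: "x i \<le> x (Suc i)" for i using h by (simp add: x_def distrib_right)
  have Gm[measurable]: "G \<in> borel_measurable borel" unfolding G_def[abs_def] by measurable
  have GC: "\<bar>G y\<bar> \<le> C" for y
  proof -
    have "\<bar>G y\<bar> \<le> (\<Sum>i<n. \<bar>c i * indicator {x i..<x (Suc i)} y\<bar>)" unfolding G_def by (rule sum_abs)
    also have "\<dots> \<le> (\<Sum>i<n. \<bar>c i\<bar>)" by (intro sum_mono) (auto simp: indicator_def)
    finally show ?thesis by (simp add: C_def)
  qed
  have Gi: "integrable lborel G"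
    unfolding G_def[abs_def] by (intro Bochner_Integration.integrable_sum integrable_mult_right integrable_real_indicator)
      (auto simp: emeasure_lborel_Ico xm)
  have G2i: "integrable lborel (\<lambda>y. (G y)\<^sup>2)"
  proof (rule Bochner_Integration.integrable_bound[where f="\<lambda>y. C * G y"])
    have "(G y)\<^sup>2 \<le> C * \<bar>G y\<bar>" for y
      using mult_right_mono[OF GC, of "\<bar>G y\<bar>" y] by (simp add: power2_eq_square flip: abs_mult)
    then show "AE y in lborel. norm ((G y)\<^sup>2) \<le> norm (C * G y)" using C0 by (auto simp: abs_mult)
  qed (use Gi in auto)
  \<comment> \<open>The integral of \<open>G\<close> against \<open>ux s\<close>, expressed through
    finitely many values of \<open>u\<close> and therefore continuous in time.\<close>
  define \<Phi> where "\<Phi> s = (\<Sum>i<n. c i * (u s (x (Suc i)) - u s (x i)))" for s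
  have D: "(LINT y|lborel. (ux s y - G y)\<^sup>2) = (LINT y|lborel. (ux s y)\<^sup>2) - 2 * \<Phi> s + (LINT y|lborel. (G y)\<^sup>2)"
    and Di: "integrable lborel (\<lambda>y. (ux s y - G y)\<^sup>2)" if s: "0 \<le> s" for s
  proof -
    have [measurable]: "ux s \<in> borel_measurable borel" by (rule meas_ux_t[OF s])
    have ci: "integrable lborel (\<lambda>y. indicat_real {x i..<x (Suc i)} y * ux s y)"
      and cv: "(LINT y|lborel. indicat_real {x i..<x (Suc i)} y * ux s y) = u s (x (Suc i)) - u s (x i)" for i
    proof -
      have si: "set_integrable lborel {x i..x (Suc i)} (ux s)" by (rule set_integrable_power2_imp[OF meas_ux_t[OF s] int_ux2[OF s]])
      have "set_integrable lborel {x i..<x (Suc i)} (ux s)" by (rule set_integrable_subset[OF si]) auto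
      then show "integrable lborel (\<lambda>y. indicat_real {x i..<x (Suc i)} y * ux s y)" by (simp add: set_integrable_def)
      have "u s (x (Suc i)) - u s (x i) = (LINT y|lborel. indicat_real {x i..x (Suc i)} y * ux s y)"
        using u_diff_eq[OF s xm] by (simp add: set_lebesgue_integral_def)
      also have "\<dots> = (LINT y|lborel. indicat_real {x i..<x (Suc i)} y * ux s y)"
      proof (rule integral_cong_AE)
        show "AE y in lborel. indicat_real {x i..x (Suc i)} y * ux s y = indicat_real {x i..<x (Suc i)} y * ux s y"
          using AE_lborel_singleton[of "x (Suc i)"] by eventually_elim (auto simp: indicator_def)
      qed measurable
      finally show "(LINT y|lborel. indicat_real {x i..<x (Suc i)} y * ux s y) = u s (x (Suc i)) - u s (x i)" by simp
    qed
    have Gx: "G y * ux s y = (\<Sum>i<n. c i * (indicat_real {x i..<x (Suc i)} y * ux s y))" for y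
      unfolding G_def sum_distrib_right by (simp only: mult.assoc)
    have i1: "integrable lborel (\<lambda>y. G y * ux s y)" and v1: "(LINT y|lborel. G y * ux s y) = \<Phi> s"
      unfolding Gx using ci cv by (auto simp: \<Phi>_def)
    have "(ux s y - G y)\<^sup>2 = (ux s y)\<^sup>2 - 2 * (G y * ux s y) + (G y)\<^sup>2" for y
      by (simp add: power2_diff mult_ac)
    then show "(LINT y|lborel. (ux s y - G y)\<^sup>2) = (LINT y|lborel. (ux s y)\<^sup>2) - 2 * \<Phi> s + (LINT y|lborel. (G y)\<^sup>2)"
      "integrable lborel (\<lambda>y. (ux s y - G y)\<^sup>2)"
      using int_ux2[OF s] i1 v1 G2i by simp_all
  qed
  have cu: "continuous_on {0..} (\<lambda>s. u s y)" for y
    using continuous_on_compose2[OF cont_u, of "{0..}" "\<lambda>s. (s, y)"] by (auto simp: continuous_on_Pair)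
  have "continuous_on {0..} \<Phi>" unfolding \<Phi>_def by (intro continuous_intros cu)
  then obtain s1 where s1: "0 < s1" "\<And>s. 0 \<le> s \<Longrightarrow> s < s1 \<Longrightarrow> \<bar>\<Phi> s - \<Phi> 0\<bar> < e / 96"
    using e unfolding continuous_on_iff dist_real_def by (metis atLeast_iff diff_zero divide_pos_pos abs_of_nonneg order_refl zero_less_numeral)
  have "0 < e / 96" using e by simp
  from energy_u_lower_semicontinuous[OF this]
  obtain s2 where s2: "0 < s2" "\<And>s. s \<in> {0..s2} \<Longrightarrow> (LINT x|lborel. (u 0 x)\<^sup>2) - e / 96 \<le> (LINT x|lborel. (u s x)\<^sup>2)"
    by blast
  define s0 where "s0 = min (s1 / 2) s2"
  \<comment> \<open>Compared with its value at s = 0, which is at most e / 16, the integral gains at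
    most e / 96 from the energy of \<open>ux\<close> and 2 * e / 96 from \<Phi>.\<close>
  have D_le: "(LINT y|lborel. (ux s y - G y)\<^sup>2) \<le> e / 8" if s: "s \<in> {0..s0}" for s
  proof -
    have s': "0 \<le> s" "s < s1" "s \<in> {0..s2}" using s s1(1) by (auto simp: s0_def)
    have "(LINT y|lborel. (ux 0 y - G y)\<^sup>2) \<le> e / 16" using D0 by (simp add: G_def x_def)
    then have "(LINT y|lborel. (ux 0 y)\<^sup>2) - 2 * \<Phi> 0 + (LINT y|lborel. (G y)\<^sup>2) \<le> e / 16" using D[of 0] by simp
    moreover have "(LINT y|lborel. (ux s y)\<^sup>2) \<le> (LINT y|lborel. (ux 0 y)\<^sup>2) + e / 96"
      using energy_le[OF s'(1)] s2(2)[OF s'(3)] by (simp add: E0_def)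
    moreover have "\<Phi> 0 - e / 96 \<le> \<Phi> s" using s1(2)[OF s'(1,2)] by linarith
    ultimately show ?thesis unfolding D[OF s'(1)] using e by linarith
  qed
  \<comment> \<open>On a set of measure at most \<delta> the bounded function \<open>G\<close>
    contributes at most 2 * \<open>C\<^sup>2\<close> * \<delta> = e / 2.\<close>
  define \<delta> where "\<delta> = e / (4 * C\<^sup>2)"
  have \<delta>: "0 < \<delta>" using e C0 by (simp add: \<delta>_def)
  show thesis
  proof
    show "0 < \<delta>" "0 < s0" using \<delta> s1 s2 by (auto simp: s0_def)
    fix s and A :: "real set"
    assume s: "s \<in> {0..s0}" and A[measurable]: "A \<in> sets borel" and Ad: "emeasure lborel A \<le> ennreal \<delta>"
    have s': "0 \<le> s" using s by simp
    have fA: "emeasure lborel A < \<infinity>" using Ad by (auto intro: le_less_trans)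
    have mA: "measure lborel A \<le> \<delta>" using enn2real_mono[OF Ad] \<delta> by (simp add: measure_def)
    have iA: "integrable lborel (\<lambda>y. indicat_real A y * (2 * C\<^sup>2))"
      by (intro integrable_mult_left integrable_real_indicator) (use fA in auto)
    have "(LINT x:A|lborel. (ux s x)\<^sup>2) \<le> (LINT y|lborel. 2 * (ux s y - G y)\<^sup>2 + indicat_real A y * (2 * C\<^sup>2))"
      unfolding set_lebesgue_integral_def
    proof (rule integral_mono)
      show "integrable lborel (\<lambda>x. indicat_real A x *\<^sub>R (ux s x)\<^sup>2)"
        by (rule integrable_mult_indicator) (use int_ux2[OF s'] in auto)
      show "integrable lborel (\<lambda>y. 2 * (ux s y - G y)\<^sup>2 + indicat_real A y * (2 * C\<^sup>2))" using Di[OF s'] iA by simp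
      fix y
      have "(ux s y)\<^sup>2 \<le> 2 * (ux s y - G y)\<^sup>2 + 2 * (G y)\<^sup>2" using power2_add_le[of "ux s y - G y" "G y"] by simp
      moreover have "(G y)\<^sup>2 \<le> C\<^sup>2" using GC[of y] C0 by (simp add: abs_le_square_iff[symmetric])
      ultimately show "indicat_real A y *\<^sub>R (ux s y)\<^sup>2 \<le> 2 * (ux s y - G y)\<^sup>2 + indicat_real A y * (2 * C\<^sup>2)"
        by (auto simp: indicator_def)
    qed
    also have "\<dots> = 2 * (LINT y|lborel. (ux s y - G y)\<^sup>2) + measure lborel A * (2 * C\<^sup>2)"
      using Di[OF s'] iA by simp
    also have "\<dots> \<le> 2 * (e / 8) + \<delta> * (2 * C\<^sup>2)"
      using D_le[OF s] mA by (intro add_mono mult_left_mono mult_right_mono) auto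
    also have "\<delta> * (2 * C\<^sup>2) = e / 2" using C0 by (simp add: \<delta>_def)
    finally show "(LINT x:A|lborel. (ux s x)\<^sup>2) \<le> e" using e by simp
  qed
qed

end

text \<open>These are the connected components, recorded by their end points because it is end
  points that the flow transports.\<close>

lemma open_bounded_Union_intervals:
  fixes U :: "real set"
  assumes "open U" "bounded U"
  obtains C :: "(real \<times> real) set" where "countable C" "\<And>a b. (a, b) \<in> C \<Longrightarrow> a < b"
    "\<And>a b a' b'. (a, b) \<in> C \<Longrightarrow> (a', b') \<in> C \<Longrightarrow> (a, b) \<noteq> (a', b') \<Longrightarrow> b \<le> a' \<or> b' \<le> a"
    "U = (\<Union>(a, b)\<in>C. {a<..<b})"
proof -
  define f where "f c = (Inf c, Sup c)" for c :: "real set"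
  have comp: "c = {Inf c<..<Sup c} \<and> Inf c < Sup c" if c: "c \<in> components U" for c
  proof -
    have oc: "open c" using open_components[OF \<open>open U\<close> c] .
    have cc: "connected c" using in_components_connected[OF c] .
    have ne: "c \<noteq> {}" using in_components_nonempty[OF c] .
    have bc: "bounded c" using \<open>bounded U\<close> in_components_subset[OF c] bounded_subset by blast
    then have bb: "bdd_below c" "bdd_above c" by (auto simp: bounded_imp_bdd_below bounded_imp_bdd_above)
    have out: "Inf c < x" "x < Sup c" if x: "x \<in> c" for x
    proof -
      obtain r where r: "0 < r" "ball x r \<subseteq> c" using oc x openE by blast
      then have "x - r / 2 \<in> c" "x + r / 2 \<in> c" by (auto simp: dist_real_def subset_iff)
      then have "Inf c \<le> x - r / 2" "x + r / 2 \<le> Sup c" using bb by (auto intro: cInf_lower cSup_upper)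
      then show "Inf c < x" "x < Sup c" using r(1) by auto
    qed
    have "x \<in> c" if x: "Inf c < x" "x < Sup c" for x
    proof -
      obtain y where "y \<in> c" "y < x" using x(1) ne bb cInf_less_iff by blast
      moreover obtain z where "z \<in> c" "x < z" using x(2) ne bb less_cSup_iff by blast
      ultimately show ?thesis using cc unfolding connected_iff_interval by (meson less_imp_le)
    qed
    then have "c = {Inf c<..<Sup c}" using out by auto
    moreover obtain x where "x \<in> c" using ne by blast
    ultimately show ?thesis using out[of x] by auto
  qed
  show thesis
  proof
    have "countable (components U)"
    proof (rule countable_disjoint_open_subsets)
      show "pairwise disjnt (components U)" using pairwise_disjoint_components[of U] by (simp add: pairwise_def disjnt_def)
    qed (rule open_components[OF \<open>open U\<close>])
    then show "countable (f ` components U)" by simp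
    show "a < b" if "(a, b) \<in> f ` components U" for a b using that comp by (auto simp: f_def)
    show "b \<le> a' \<or> b' \<le> a" if h: "(a, b) \<in> f ` components U" "(a', b') \<in> f ` components U" "(a, b) \<noteq> (a', b')" for a b a' b'
    proof (rule ccontr)
      assume neg: "\<not> (b \<le> a' \<or> b' \<le> a)"
      obtain c c' where c: "c \<in> components U" "c' \<in> components U" "a = Inf c" "b = Sup c" "a' = Inf c'" "b' = Sup c'"
        using h by (auto simp: f_def)
      then have ce: "c = {a<..<b}" "c' = {a'<..<b'}" "a < b" "a' < b'" using comp by auto
      have "max a a' < min b b'" using neg ce by auto
      then obtain m where "max a a' < m" "m < min b b'" using dense by blast
      then have "m \<in> c \<inter> c'" by (simp add: ce)
      then have "c = c'" using components_nonoverlap[OF c(1,2)] by auto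
      then show False using h(3) c by simp
    qed
    have "U = \<Union>(components U)" by simp
    also have "\<dots> = (\<Union>(a, b)\<in>f ` components U. {a<..<b})"
      using comp by (auto simp: f_def)
    finally show "U = (\<Union>(a, b)\<in>f ` components U. {a<..<b})" .
  qed
qed

section \<open>Images of null sets\<close>

text \<open>The inequality of arithmetic and geometric means with a free weight. Being linear in
  \<open>l\<close> and \<open>E\<close> it can be summed over intervals, and the best weight is
  inserted afterwards.\<close>

lemma le_weighted_mean_if_power2_le:
  fixes W l E lam :: real
  assumes "W\<^sup>2 \<le> l * E" "0 \<le> l" "0 \<le> E" "0 < lam"
  shows "W \<le> (lam * l + E / lam) / 2"
proof (rule power2_le_imp_le)
  have "l * E \<le> ((lam * l + E / lam) / 2)\<^sup>2"
  proof -
    have "((lam * l + E / lam) / 2)\<^sup>2 - l * E = ((lam * l - E / lam) / 2)\<^sup>2"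
      using assms(4) by (simp add: field_simps power2_eq_square)
    then show ?thesis using zero_le_power2[of "(lam * l - E / lam) / 2"] by linarith
  qed
  then show "W\<^sup>2 \<le> ((lam * l + E / lam) / 2)\<^sup>2" using assms(1) by linarith
  show "0 \<le> (lam * l + E / lam) / 2" using assms by simp
qed

context camassa_holm
begin

section \<open>Finitely many disjoint intervals transported from time 0\<close>

definition tube :: "(real \<Rightarrow> real \<Rightarrow> real) \<Rightarrow> real \<Rightarrow> real \<times> real \<Rightarrow> real set" where
  "tube Zc s i = {Zc (fst i) s<..<Zc (snd i) s}"

definition tube_length :: "(real \<times> real) set \<Rightarrow> (real \<Rightarrow> real \<Rightarrow> real) \<Rightarrow> real \<Rightarrow> real" where
  "tube_length I Zc s = (\<Sum>i\<in>I. Zc (snd i) s - Zc (fst i) s)"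

context
  fixes I :: "(real \<times> real) set" and Zc :: "real \<Rightarrow> real \<Rightarrow> real"
  assumes finI: "finite I" and Zc: "\<And>x. char_curve (Zc x)" "\<And>x. Zc x 0 = x"
    and Ilt: "\<And>a b. (a, b) \<in> I \<Longrightarrow> a < b"
    and Idisj: "\<And>a b a' b'. (a, b) \<in> I \<Longrightarrow> (a', b') \<in> I \<Longrightarrow> (a, b) \<noteq> (a', b') \<Longrightarrow> b \<le> a' \<or> b' \<le> a"
begin

lemma Zc_mono: "a \<le> b \<Longrightarrow> 0 \<le> s \<Longrightarrow> Zc a s \<le> Zc b s"
  using char_curve_order[OF Zc(1) Zc(1), of 0 s a b] by (cases "a = b") (auto simp: Zc(2))

lemma tube_le: "i \<in> I \<Longrightarrow> 0 \<le> s \<Longrightarrow> Zc (fst i) s \<le> Zc (snd i) s"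
  using Ilt[of "fst i" "snd i"] by (intro Zc_mono) auto

lemma disjoint_tubes: "0 \<le> s \<Longrightarrow> disjoint_family_on (tube Zc s) I"
  unfolding disjoint_family_on_def
proof (intro ballI impI)
  fix i j assume s: "0 \<le> s" and ij: "i \<in> I" "j \<in> I" "i \<noteq> j"
  then have "snd i \<le> fst j \<or> snd j \<le> fst i" using Idisj[of "fst i" "snd i" "fst j" "snd j"] by simp
  then have "Zc (snd i) s \<le> Zc (fst j) s \<or> Zc (snd j) s \<le> Zc (fst i) s" using Zc_mono s by blast
  then show "tube Zc s i \<inter> tube Zc s j = {}" by (auto simp: tube_def)
qed

lemma emeasure_tubes:
  assumes s: "0 \<le> s"
  shows "emeasure lborel (\<Union>i\<in>I. tube Zc s i) = ennreal (tube_length I Zc s)"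
proof -
  have "emeasure lborel (\<Union>i\<in>I. tube Zc s i) = (\<Sum>i\<in>I. emeasure lborel (tube Zc s i))"
    by (rule sum_emeasure[symmetric, OF _ disjoint_tubes[OF s] finI]) (auto simp: tube_def)
  also have "\<dots> = (\<Sum>i\<in>I. ennreal (Zc (snd i) s - Zc (fst i) s))"
    by (intro sum.cong refl) (use tube_le[OF _ s] in \<open>auto simp: tube_def\<close>)
  also have "\<dots> = ennreal (tube_length I Zc s)"
    unfolding tube_length_def by (rule sum_ennreal) (use tube_le[OF _ s] in auto)
  finally show ?thesis .
qed

lemma tube_length_nonneg: "0 \<le> s \<Longrightarrow> 0 \<le> tube_length I Zc s"
  unfolding tube_length_def by (intro sum_nonneg) (use tube_le in auto)

lemma tube_energy:
  assumes s: "0 \<le> s"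
  shows "(\<Sum>i\<in>I. LINT x:{Zc (fst i) s..Zc (snd i) s}|lborel. (ux s x)\<^sup>2) = (LINT x:(\<Union>i\<in>I. tube Zc s i)|lborel. (ux s x)\<^sup>2)"
proof -
  have [measurable]: "ux s \<in> borel_measurable borel" by (rule meas_ux_t[OF s])
  have "(LINT x:(\<Union>i\<in>I. tube Zc s i)|lborel. (ux s x)\<^sup>2) = (\<Sum>i\<in>I. LINT x:tube Zc s i|lborel. (ux s x)\<^sup>2)"
  proof (rule set_integral_finite_Union[OF finI disjoint_tubes[OF s]])
    show "set_integrable lborel (tube Zc s i) (\<lambda>x. (ux s x)\<^sup>2)" for i
      unfolding set_integrable_def tube_def by (intro integrable_mult_indicator int_ux2[OF s]) auto
  qed (auto simp: tube_def)
  also have "\<dots> = (\<Sum>i\<in>I. LINT x:{Zc (fst i) s..Zc (snd i) s}|lborel. (ux s x)\<^sup>2)"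
  proof (rule sum.cong[OF refl])
    fix i
    show "(LINT x:tube Zc s i|lborel. (ux s x)\<^sup>2) = (LINT x:{Zc (fst i) s..Zc (snd i) s}|lborel. (ux s x)\<^sup>2)"
      unfolding set_lebesgue_integral_def
    proof (rule integral_cong_AE)
      show "AE x in lborel. indicat_real (tube Zc s i) x *\<^sub>R (ux s x)\<^sup>2 = indicat_real {Zc (fst i) s..Zc (snd i) s} x *\<^sub>R (ux s x)\<^sup>2"
        using AE_lborel_singleton[of "Zc (fst i) s"] AE_lborel_singleton[of "Zc (snd i) s"]
        by eventually_elim (auto simp: indicator_def tube_def)
    qed (auto simp: tube_def)
  qed
  finally show ?thesis by simp
qed

text \<open>Cauchy-Schwarz over all tubes bounds the derivative of the total length L by sqrt
  (\<epsilon> * (L + \<mu>)), so the square root of L + \<mu> grows at most at the rate sqrt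
  \<epsilon> / 2. The summand \<mu> keeps the root differentiable where L vanishes.\<close>

lemma tube_length_growth:
  assumes T: "0 \<le> T" and \<epsilon>: "0 < \<epsilon>" and \<mu>: "0 < \<mu>" "tube_length I Zc 0 \<le> \<mu>"
    and E: "\<And>s. s \<in> {0..T} \<Longrightarrow> (LINT x:(\<Union>i\<in>I. tube Zc s i)|lborel. (ux s x)\<^sup>2) \<le> \<epsilon>"
  shows "sqrt (tube_length I Zc T + \<mu>) \<le> sqrt (2 * \<mu>) + sqrt \<epsilon> / 2 * T"
proof -
  define f where "f s = sqrt (tube_length I Zc s + \<mu>) - sqrt \<epsilon> / 2 * s" for s
  have contL: "continuous_on {0..T} (tube_length I Zc)"
    unfolding tube_length_def[abs_def]
    by (intro continuous_on_sum continuous_on_diff char_curve_cont Zc) auto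
  have "f T \<le> f 0"
  proof (rule DERIV_nonpos_imp_nonincreasing_open[where f=f and a=0 and b=T, OF T])
    show "continuous_on {0..T} f" unfolding f_def by (intro continuous_intros contL)
    fix s assume s: "0 < s" "s < T"
    define W where "W i = u s (Zc (snd i) s) - u s (Zc (fst i) s)" for i
    define l where "l i = Zc (snd i) s - Zc (fst i) s" for i
    define e where "e i = (LINT x:{Zc (fst i) s..Zc (snd i) s}|lborel. (ux s x)\<^sup>2)" for i
    define y where "y = sqrt (tube_length I Zc s + \<mu>)"
    have pos: "0 < tube_length I Zc s + \<mu>" using tube_length_nonneg[of s] s \<mu> by linarith
    then have y: "0 < y" "y\<^sup>2 = tube_length I Zc s + \<mu>" by (auto simp: y_def)
    have dL: "(tube_length I Zc has_real_derivative (\<Sum>i\<in>I. W i)) (at s)"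
      unfolding tube_length_def[abs_def] W_def
      by (intro DERIV_sum) (use char_curve_diff_deriv[OF Zc(1) Zc(1) s(1)] in auto)
    \<comment> \<open>The weight for which lam * \<open>y\<^sup>2\<close> and \<epsilon> / lam
      agree, both being sqrt \<epsilon> * y.\<close>
    define lam where "lam = sqrt \<epsilon> / y"
    have lam: "0 < lam" using \<epsilon> y by (simp add: lam_def)
    have "W i \<le> (lam * l i + e i / lam) / 2" if i: "i \<in> I" for i
    proof (rule le_weighted_mean_if_power2_le[OF _ _ _ lam])
      show "(W i)\<^sup>2 \<le> l i * e i" unfolding W_def l_def e_def
        using s by (intro u_diff_power2_le tube_le[OF i]) auto
      show "0 \<le> l i" using tube_le[OF i] s by (simp add: l_def)
      show "0 \<le> e i" unfolding e_def by (rule set_integral_lborel_nonneg) simp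
    qed
    then have "(\<Sum>i\<in>I. W i) \<le> (\<Sum>i\<in>I. (lam * l i + e i / lam) / 2)" by (intro sum_mono)
    also have "\<dots> = (lam * (\<Sum>i\<in>I. l i) + (\<Sum>i\<in>I. e i) / lam) / 2"
      by (simp add: sum_divide_distrib[symmetric] sum.distrib sum_distrib_left)
    also have "\<dots> \<le> (lam * y\<^sup>2 + \<epsilon> / lam) / 2"
    proof -
      have "(\<Sum>i\<in>I. l i) \<le> y\<^sup>2" using y \<mu> by (simp add: l_def tube_length_def)
      moreover have "(\<Sum>i\<in>I. e i) \<le> \<epsilon>" using E[of s] s tube_energy[of s] by (simp add: e_def)
      ultimately show ?thesis using lam by (intro divide_right_mono add_mono mult_left_mono) auto
    qed
    also have "\<dots> = sqrt \<epsilon> * y"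
    proof -
      have "r / y * y\<^sup>2 = r * y" "r\<^sup>2 / (r / y) = r * y" if "r \<noteq> 0" for r
        using that y(1) by (simp_all add: power2_eq_square)
      from this[of "sqrt \<epsilon>"] show ?thesis using \<epsilon> by (simp add: lam_def)
    qed
    finally have W: "(\<Sum>i\<in>I. W i) \<le> sqrt \<epsilon> * y" .
    have "((\<lambda>s. tube_length I Zc s + \<mu>) has_real_derivative (\<Sum>i\<in>I. W i)) (at s)"
      using DERIV_add[OF dL DERIV_const] by simp
    from DERIV_chain2[OF DERIV_real_sqrt[OF pos] this]
    have "((\<lambda>s. sqrt (tube_length I Zc s + \<mu>)) has_real_derivative inverse y / 2 * (\<Sum>i\<in>I. W i)) (at s)"
      by (simp add: y_def)
    moreover have "((\<lambda>s. sqrt \<epsilon> / 2 * s) has_real_derivative sqrt \<epsilon> / 2) (at s)"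
      by (auto intro!: derivative_eq_intros)
    ultimately have df: "(f has_real_derivative inverse y / 2 * (\<Sum>i\<in>I. W i) - sqrt \<epsilon> / 2) (at s)"
      unfolding f_def by (rule DERIV_diff)
    have "inverse y / 2 * (\<Sum>i\<in>I. W i) \<le> inverse y / 2 * (sqrt \<epsilon> * y)"
      by (rule mult_left_mono[OF W]) (use y(1) in simp)
    moreover have "inverse y / 2 * (sqrt \<epsilon> * y) = sqrt \<epsilon> / 2" using y(1) by simp
    ultimately have "inverse y / 2 * (\<Sum>i\<in>I. W i) - sqrt \<epsilon> / 2 \<le> 0" by linarith
    with df show "\<exists>d. (f has_real_derivative d) (at s) \<and> d \<le> 0" by blast
  qed
  moreover have "sqrt (tube_length I Zc 0 + \<mu>) \<le> sqrt (2 * \<mu>)" using \<mu> by simp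
  ultimately show ?thesis unfolding f_def by linarith
qed

end

text \<open>The growth is estimated twice. The crude bound by the total energy keeps the total
  length below \<delta> up to time \<open>s0\<close>. Equi-integrability then makes the energy
  inside the tubes small, which improves the length at \<open>s0\<close> to \<epsilon> * s0^2, and
  the factor s0^2 cancels against the later expansion.\<close>

theorem negligible_image_of_negligible:
  assumes N: "negligible N" and T: "0 < T"
  shows "negligible {z T | z. char_curve z \<and> z 0 \<in> N}"
proof -
  have "\<exists>z. char_curve z \<and> z 0 = x" for x by (rule char_curve_through) blast
  then obtain Zc where Zc: "\<And>x. char_curve (Zc x)" "\<And>x. Zc x 0 = x" by metis
  have bdd: "negligible {z T | z. char_curve z \<and> z 0 \<in> N \<inter> {-R<..<R}}" for R
    unfolding negligible_outer_le
  proof (intro allI impI)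
    fix e :: real assume e: "0 < e"
    \<comment> \<open>The expansion factor from \<open>s0\<close> to \<open>T\<close> is at most Q /
      s0^2, so a length \<epsilon> * s0^2 becomes at most \<epsilon> * Q = e.\<close>
    define Q where "Q = T\<^sup>2 * exp (2 * B0 * T)"
    have Q: "0 < Q" using T by (simp add: Q_def)
    define \<epsilon> where "\<epsilon> = e / Q"
    have \<epsilon>: "0 < \<epsilon>" using e Q by (simp add: \<epsilon>_def)
    have "\<exists>\<delta> s0. 0 < \<delta> \<and> 0 < s0 \<and> (\<forall>s A. s \<in> {0..s0} \<longrightarrow> A \<in> sets borel \<longrightarrow> emeasure lborel A \<le> ennreal \<delta> \<longrightarrow> (LINT x:A|lborel. (ux s x)\<^sup>2) \<le> \<epsilon>)"
      by (rule equi_integrable_at_0[OF \<epsilon>]) blast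
    then obtain \<delta> s1 where \<delta>: "0 < \<delta>" "0 < s1"
      and equi: "\<And>s A. s \<in> {0..s1} \<Longrightarrow> A \<in> sets borel \<Longrightarrow> emeasure lborel A \<le> ennreal \<delta> \<Longrightarrow> (LINT x:A|lborel. (ux s x)\<^sup>2) \<le> \<epsilon>"
      by blast
    \<comment> \<open>Up to this time the crude growth adds at most sqrt \<delta> / 2 to the square
      root of the length. The energy bound is taken as E0 + 1 because
      \<open>tube_length_growth\<close> wants it positive.\<close>
    define s0 where "s0 = min (min s1 T) (sqrt \<delta> / sqrt (E0 + 1))"
    have s0: "0 < s0" "s0 \<le> s1" "s0 \<le> T" "sqrt (E0 + 1) * s0 \<le> sqrt \<delta>"
    proof -
      show "0 < s0" using \<delta> T E0_nonneg by (simp add: s0_def)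
      show "s0 \<le> s1" "s0 \<le> T" by (simp_all add: s0_def)
      have "0 < sqrt (E0 + 1)" using E0_nonneg by simp
      then show "sqrt (E0 + 1) * s0 \<le> sqrt \<delta>" by (simp add: s0_def min_def field_simps)
    qed
    \<comment> \<open>The length \<mu> of the covering is fixed only after \<open>s0\<close>, as a
      null set has coverings of any small total length. The two bounds serve the crude and the
      refined estimate.\<close>
    define m where "m = min (sqrt \<delta> / 2) (sqrt \<epsilon> * s0 / 2)"
    have m: "0 < m" using \<delta> \<epsilon> s0 by (simp add: m_def)
    define \<mu> where "\<mu> = m\<^sup>2 / 2"
    have \<mu>: "0 < \<mu>" "sqrt (2 * \<mu>) = m" using m by (auto simp: \<mu>_def)
    have "N \<in> sets lebesgue" using N negligible_imp_sets by blast
    then obtain U where U: "open U" "N \<subseteq> U" "U - N \<in> lmeasurable" "emeasure lebesgue (U - N) < ennreal \<mu>"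
      using sets_lebesgue_outer_open[OF _ \<mu>(1)] by blast
    have U\<mu>: "emeasure lborel U \<le> ennreal \<mu>"
    proof -
      have "emeasure lebesgue (U - N) = emeasure lebesgue U"
        by (rule emeasure_Diff_null_set) (use N U in \<open>auto simp: negligible_iff_null_sets\<close>)
      then show ?thesis using U by simp
    qed
    define U' where "U' = U \<inter> {-R<..<R}"
    have "open U'" "bounded U'" using U(1) by (auto simp: U'_def intro: bounded_subset[OF bounded_Ioo])
    then have "\<exists>C::(real \<times> real) set. countable C \<and> (\<forall>a b. (a, b) \<in> C \<longrightarrow> a < b) \<and>
      (\<forall>a b a' b'. (a, b) \<in> C \<longrightarrow> (a', b') \<in> C \<longrightarrow> (a, b) \<noteq> (a', b') \<longrightarrow> b \<le> a' \<or> b' \<le> a) \<and>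
      U' = (\<Union>(a, b)\<in>C. {a<..<b})"
      by (rule open_bounded_Union_intervals) blast
    then obtain C :: "(real \<times> real) set" where C: "countable C" "\<And>a b. (a, b) \<in> C \<Longrightarrow> a < b"
      "\<And>a b a' b'. (a, b) \<in> C \<Longrightarrow> (a', b') \<in> C \<Longrightarrow> (a, b) \<noteq> (a', b') \<Longrightarrow> b \<le> a' \<or> b' \<le> a"
      "U' = (\<Union>(a, b)\<in>C. {a<..<b})" by blast
    define J where "J i = {Zc (fst i) T..Zc (snd i) T}" for i :: "real \<times> real"
    have fin: "measure lebesgue (\<Union> (J ` I)) \<le> e" if I: "I \<subseteq> C" "finite I" for I
    proof -
      have Ilt: "\<And>a b. (a, b) \<in> I \<Longrightarrow> a < b"
        and Id: "\<And>a b a' b'. (a, b) \<in> I \<Longrightarrow> (a', b') \<in> I \<Longrightarrow> (a, b) \<noteq> (a', b') \<Longrightarrow> b \<le> a' \<or> b' \<le> a"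
        using C(2,3) I(1) by blast+
      note ctx = I(2) Zc Ilt Id
      define L where "L = tube_length I Zc"
      define A where "A s = (\<Union>i\<in>I. tube Zc s i)" for s
      have Am: "A s \<in> sets borel" for s unfolding A_def tube_def using I(2) by (intro sets.finite_UN) auto
      have Ae: "emeasure lborel (A s) = ennreal (L s)" if "0 \<le> s" for s
        unfolding A_def L_def by (rule emeasure_tubes[OF ctx that])
      have Ln: "0 \<le> L s" if "0 \<le> s" for s unfolding L_def by (rule tube_length_nonneg[OF ctx that])
      have L0: "L 0 \<le> \<mu>"
      proof -
        have "A 0 \<subseteq> U'" unfolding A_def tube_def C(4) Zc(2) using I(1) by (force simp: case_prod_unfold)
        then have "A 0 \<subseteq> U" by (auto simp: U'_def)
        then have "emeasure lborel (A 0) \<le> emeasure lborel U" by (rule emeasure_mono) (use U in auto)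
        then have "ennreal (L 0) \<le> ennreal \<mu>" using U\<mu> Ae[of 0] by simp
        then show ?thesis using \<mu> by simp
      qed
      have crude: "L s \<le> \<delta>" if s: "s \<in> {0..s0}" for s
      proof -
        have "sqrt (L s + \<mu>) \<le> sqrt (2 * \<mu>) + sqrt (E0 + 1) / 2 * s"
          unfolding L_def
        proof (rule tube_length_growth[OF ctx])
          show "(LINT x:(\<Union>i\<in>I. tube Zc r i)|lborel. (ux r x)\<^sup>2) \<le> E0 + 1" if "r \<in> {0..s}" for r
          proof -
            have r: "0 \<le> r" using that by simp
            have "(LINT x:A r|lborel. (ux r x)\<^sup>2) \<le> (LINT x|lborel. (ux r x)\<^sup>2)"
              unfolding set_lebesgue_integral_def
            proof (rule integral_mono)
              show "integrable lborel (\<lambda>x. indicat_real (A r) x *\<^sub>R (ux r x)\<^sup>2)"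
                by (rule integrable_mult_indicator) (use Am int_ux2[OF r] in auto)
            qed (use int_ux2[OF r] in \<open>auto simp: indicator_def\<close>)
            then show ?thesis using energy_ux_le[OF r] by (simp add: A_def)
          qed
        qed (use s \<mu> L0 E0_nonneg in \<open>auto simp: L_def\<close>)
        also have "\<dots> \<le> sqrt \<delta> / 2 + sqrt \<delta> / 2"
        proof (rule add_mono)
          show "sqrt (2 * \<mu>) \<le> sqrt \<delta> / 2" unfolding \<mu>(2) m_def by (rule min.cobounded1)
          have "sqrt (E0 + 1) * s \<le> sqrt (E0 + 1) * s0" using s E0_nonneg by (intro mult_left_mono) auto
          then show "sqrt (E0 + 1) / 2 * s \<le> sqrt \<delta> / 2" using s0(4) by simp
        qed
        finally have "sqrt (L s + \<mu>) \<le> sqrt \<delta>" by simp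
        then show ?thesis using \<mu> by simp
      qed
      have "sqrt (L s0 + \<mu>) \<le> sqrt (2 * \<mu>) + sqrt \<epsilon> / 2 * s0"
        unfolding L_def
      proof (rule tube_length_growth[OF ctx _ \<epsilon> \<mu>(1)])
        show "(LINT x:(\<Union>i\<in>I. tube Zc r i)|lborel. (ux r x)\<^sup>2) \<le> \<epsilon>" if "r \<in> {0..s0}" for r
          unfolding A_def[symmetric]
        proof (rule equi)
          show "emeasure lborel (A r) \<le> ennreal \<delta>" using Ae[of r] crude[OF that] that by (simp add: ennreal_leI)
        qed (use that s0 Am in auto)
      qed (use s0 L0 in \<open>auto simp: L_def\<close>)
      also have "\<dots> \<le> sqrt \<epsilon> * s0 / 2 + sqrt \<epsilon> * s0 / 2"
      proof (rule add_mono)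
        show "sqrt (2 * \<mu>) \<le> sqrt \<epsilon> * s0 / 2" unfolding \<mu>(2) m_def by (rule min.cobounded2)
      qed simp
      finally have "sqrt (L s0 + \<mu>) \<le> sqrt \<epsilon> * s0" by (simp add: mult.commute)
      then have "(sqrt (L s0 + \<mu>))\<^sup>2 \<le> (sqrt \<epsilon> * s0)\<^sup>2"
        using Ln[of s0] s0 \<mu> by (intro power_mono) auto
      then have Ls0: "L s0 \<le> \<epsilon> * s0\<^sup>2" using Ln[of s0] s0 \<mu> \<epsilon> by (simp add: power_mult_distrib)
      have "measure lebesgue (\<Union> (J ` I)) \<le> (\<Sum>i\<in>I. measure lebesgue (J i))"
        by (rule measure_UNION_le) (use I in \<open>auto simp: J_def\<close>)
      also have "\<dots> \<le> (\<Sum>i\<in>I. (T / s0)\<^sup>2 * exp (2 * B0 * T) * (Zc (snd i) s0 - Zc (fst i) s0))"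
      proof (rule sum_mono)
        fix i assume i: "i \<in> I"
        have le: "Zc (fst i) T \<le> Zc (snd i) T" "Zc (fst i) s0 \<le> Zc (snd i) s0"
          using tube_le[OF ctx i] T s0 by auto
        have "Zc (snd i) T - Zc (fst i) T \<le> (T / s0)\<^sup>2 * exp (2 * B0 * (T - s0)) * (Zc (snd i) s0 - Zc (fst i) s0)"
          using char_curve_diff_sharp[OF Zc(1) Zc(1) s0(1,3), of "snd i" "fst i"] le by simp
        also have "\<dots> \<le> (T / s0)\<^sup>2 * exp (2 * B0 * T) * (Zc (snd i) s0 - Zc (fst i) s0)"
          using le s0 B0_nonneg by (intro mult_right_mono mult_left_mono) (auto intro!: mult_left_mono)
        finally show "measure lebesgue (J i) \<le> (T / s0)\<^sup>2 * exp (2 * B0 * T) * (Zc (snd i) s0 - Zc (fst i) s0)"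
          using le by (simp add: J_def)
      qed
      also have "\<dots> = (T / s0)\<^sup>2 * exp (2 * B0 * T) * L s0"
        by (simp add: L_def tube_length_def sum_distrib_left)
      also have "\<dots> \<le> (T / s0)\<^sup>2 * exp (2 * B0 * T) * (\<epsilon> * s0\<^sup>2)" using Ls0 by (intro mult_left_mono) auto
      also have "\<dots> = Q * \<epsilon>" using s0 by (simp add: Q_def power_divide)
      also have "\<dots> = e" using Q by (simp add: \<epsilon>_def)
      finally show ?thesis .
    qed
    have Jm: "\<Union> (J ` C) \<in> lmeasurable" and Je: "measure lebesgue (\<Union> (J ` C)) \<le> e"
      by (rule fmeasurable_UN_bound[OF C(1) _ fin] measure_UN_bound[OF C(1) _ fin]; auto simp: J_def)+
    \<comment> \<open>A characteristic starting between \<open>a\<close> and \<open>b\<close> stays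
      between the two chosen curves, even if neither it nor they are unique.\<close>
    have "{z T | z. char_curve z \<and> z 0 \<in> N \<inter> {-R<..<R}} \<subseteq> \<Union> (J ` C)"
    proof clarify
      fix z assume z: "char_curve z" "z 0 \<in> N" "z 0 \<in> {-R<..<R}"
      then have "z 0 \<in> U'" using U(2) by (auto simp: U'_def)
      then obtain a b where ab: "(a, b) \<in> C" "a < z 0" "z 0 < b" using C(4) by auto
      have "Zc a T \<le> z T" by (rule char_curve_order[OF Zc(1) z(1), of 0]) (use ab T Zc(2) in auto)
      moreover have "z T \<le> Zc b T" by (rule char_curve_order[OF z(1) Zc(1), of 0]) (use ab T Zc(2) in auto)
      ultimately have "z T \<in> J (a, b)" by (simp add: J_def)
      then show "z T \<in> \<Union> (J ` C)" using ab(1) by blast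
    qed
    then show "\<exists>S. {z T | z. char_curve z \<and> z 0 \<in> N \<inter> {-R<..<R}} \<subseteq> S \<and> S \<in> lmeasurable \<and> measure lebesgue S \<le> e"
      using Jm Je by blast
  qed
  have "negligible (\<Union>n::nat. {z T | z. char_curve z \<and> z 0 \<in> N \<inter> {-real n<..<real n}})"
    by (rule negligible_Union_nat) (rule bdd)
  moreover have "{z T | z. char_curve z \<and> z 0 \<in> N} \<subseteq> (\<Union>n::nat. {z T | z. char_curve z \<and> z 0 \<in> N \<inter> {-real n<..<real n}})"
  proof clarify
    fix z assume z: "char_curve z" "z 0 \<in> N"
    obtain n :: nat where "\<bar>z 0\<bar> < real n" using reals_Archimedean2 by blast
    then have "z 0 \<in> N \<inter> {-real n<..<real n}" using z(2) by auto
    then show "z T \<in> (\<Union>n::nat. {z T | z. char_curve z \<and> z 0 \<in> N \<inter> {-real n<..<real n}})" using z(1) by blast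
  qed
  ultimately show ?thesis using negligible_subset by blast
qed

end

section \<open>Propagation of uniqueness\<close>

text \<open>Only countable quantifiers remain, which makes sets of convergence measurable.\<close>

lemma tendsto_0_iff_countable:
  fixes X :: "nat \<Rightarrow> real"
  shows "X \<longlonglongrightarrow> 0 \<longleftrightarrow> (\<forall>j::nat. \<exists>m. \<forall>k\<ge>m. \<bar>X k\<bar> < 1 / real (Suc j))"
proof
  assume "X \<longlonglongrightarrow> 0"
  show "\<forall>j::nat. \<exists>m. \<forall>k\<ge>m. \<bar>X k\<bar> < 1 / real (Suc j)"
  proof
    fix j :: nat
    show "\<exists>m. \<forall>k\<ge>m. \<bar>X k\<bar> < 1 / real (Suc j)"
      using LIMSEQ_D[OF \<open>X \<longlonglongrightarrow> 0\<close>, of "1 / real (Suc j)"] by simp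
  qed
next
  assume h: "\<forall>j::nat. \<exists>m. \<forall>k\<ge>m. \<bar>X k\<bar> < 1 / real (Suc j)"
  show "X \<longlonglongrightarrow> 0"
  proof (rule LIMSEQ_I)
    fix e :: real assume "0 < e"
    then obtain j where "1 / real (Suc j) < e" using nat_approx_posE by blast
    moreover obtain m where "\<forall>k\<ge>m. \<bar>X k\<bar> < 1 / real (Suc j)" using h by blast
    ultimately show "\<exists>m. \<forall>k\<ge>m. norm (X k - 0) < e" by (intro exI[of _ m]) force
  qed
qed

lemma negligible_if_AE_lborel:
  assumes "AE x in lborel. P x"
  shows "negligible {x. \<not> P x}"
proof -
  obtain N where N: "{x \<in> space lborel. \<not> P x} \<subseteq> N" "emeasure lborel N = 0" "N \<in> sets lborel"
    using AE_E[OF assms] by blast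
  then have "N \<in> null_sets lborel" by (simp add: null_sets_def)
  then have "negligible N" unfolding negligible_iff_null_sets by (rule null_sets_completionI)
  then show ?thesis by (rule negligible_subset) (use N(1) in auto)
qed

lemma AE_lborel_if_negligible:
  assumes "negligible {x. \<not> P x}"
  shows "AE x in lborel. P x"
proof -
  have "AE x in lebesgue. x \<notin> {x. \<not> P x}" using assms unfolding negligible_iff_null_sets by (rule AE_not_in)
  then show ?thesis by (simp add: AE_completion_iff)
qed

context camassa_holm
begin

text \<open>Earlier increments of \<open>u\<close> exceed the one at time \<open>s\<close> by at
  most \<open>M\<close>, because increments decrease at most at the rate C0 times the distance. By
  the mean value theorem one of them equals (D s - D \<tau>) / (s - \<tau>), which is at least - D
  \<tau> / (s - \<tau>) as the curves keep their order. The bound is relative to the distance at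
  \<tau>, so it is bad relative to the distance at \<open>s\<close> only if the interval
  collapses.\<close>

lemma slope_lower_bound:
  assumes z: "char_curve p" "char_curve q" and \<tau>: "0 < \<tau>" "\<tau> < s" and ord: "p \<tau> \<le> q \<tau>"
  shows "- (1 / (s - \<tau>) + C0 * exp (K \<tau> * (s - \<tau>)) * (s - \<tau>)) * (q \<tau> - p \<tau>) \<le> u s (q s) - u s (p s)"
proof -
  define D where "D r = q r - p r" for r
  define W where "W r = u r (q r) - u r (p r)" for r
  define M where "M = C0 * exp (K \<tau> * (s - \<tau>)) * (s - \<tau>) * D \<tau>"
  have D0: "0 \<le> D r" and D1: "D r \<le> exp (K \<tau> * (s - \<tau>)) * D \<tau>" if r: "r \<in> {\<tau>..s}" for r
  proof -
    show "0 \<le> D r" using char_curve_order[OF z, of \<tau> r] \<tau> r ord by (simp add: D_def)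
    have "\<bar>D r\<bar> \<le> exp (K \<tau> * (r - \<tau>)) * \<bar>D \<tau>\<bar>"
      unfolding D_def by (rule char_curve_diff_upper[OF z \<tau>(1) order_refl]) (use r in simp)
    also have "\<dots> \<le> exp (K \<tau> * (s - \<tau>)) * \<bar>D \<tau>\<bar>"
      using r K_nonneg[OF \<tau>(1)] by (intro mult_right_mono) (auto intro!: mult_left_mono)
    finally show "D r \<le> exp (K \<tau> * (s - \<tau>)) * D \<tau>" using ord by (simp add: D_def)
  qed
  have Wle: "W r \<le> W s + M" if r: "r \<in> {\<tau>..s}" for r
  proof -
    have "((\<lambda>t. CH_Px u ux t (p t) - CH_Px u ux t (q t)) has_integral
        (u r (p r) - u s (p s)) - (u r (q r) - u s (q s))) {r..s}"
      using r \<tau> by (intro has_integral_diff char_curve_u z) auto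
    then have i: "((\<lambda>t. CH_Px u ux t (p t) - CH_Px u ux t (q t)) has_integral W s - W r) {r..s}"
      by (simp add: W_def algebra_simps)
    have c: "((\<lambda>t. - (C0 * (exp (K \<tau> * (s - \<tau>)) * D \<tau>))) has_integral (s - r) *\<^sub>R - (C0 * (exp (K \<tau> * (s - \<tau>)) * D \<tau>))) {r..s}"
      using has_integral_const_real[of "- (C0 * (exp (K \<tau> * (s - \<tau>)) * D \<tau>))" r s] r by simp
    have "(s - r) *\<^sub>R - (C0 * (exp (K \<tau> * (s - \<tau>)) * D \<tau>)) \<le> W s - W r"
    proof (rule has_integral_le[OF c i])
      fix t assume t: "t \<in> {r..s}"
      then have t': "t \<in> {\<tau>..s}" "0 \<le> t" using r \<tau> by auto
      have "1 / 2 * (LINT x:{p t..q t}|lborel. (ux t x)\<^sup>2) - C0 * (q t - p t) \<le> CH_Px u ux t (p t) - CH_Px u ux t (q t)"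
        by (rule CH_Px_diff_bounds(2)[OF t'(2)]) (use D0[OF t'(1)] in \<open>simp add: D_def\<close>)
      moreover have "0 \<le> (LINT x:{p t..q t}|lborel. (ux t x)\<^sup>2)" by (rule set_integral_lborel_nonneg) simp
      moreover have "C0 * (q t - p t) \<le> C0 * (exp (K \<tau> * (s - \<tau>)) * D \<tau>)"
        using D1[OF t'(1)] C0_bounds(1) by (intro mult_left_mono) (auto simp: D_def)
      ultimately show "- (C0 * (exp (K \<tau> * (s - \<tau>)) * D \<tau>)) \<le> CH_Px u ux t (p t) - CH_Px u ux t (q t)"
        by linarith
    qed
    moreover have "(s - r) * (C0 * (exp (K \<tau> * (s - \<tau>)) * D \<tau>)) \<le> (s - \<tau>) * (C0 * (exp (K \<tau> * (s - \<tau>)) * D \<tau>))"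
      using r C0_bounds(1) D0[of \<tau>] \<tau> by (intro mult_right_mono) auto
    ultimately show ?thesis by (simp add: M_def mult_ac)
  qed
  have "continuous_on {\<tau>..s} D" unfolding D_def using z \<tau> by (intro continuous_on_diff char_curve_cont) auto
  moreover have Dd: "(D has_real_derivative W r) (at r)" if "\<tau> < r" for r
    unfolding D_def[abs_def] W_def by (rule char_curve_diff_deriv[OF z]) (use that \<tau> in simp)
  ultimately obtain l r where r: "\<tau> < r" "r < s" "(D has_real_derivative l) (at r)" "D s - D \<tau> = (s - \<tau>) * l"
    using MVT[OF \<tau>(2), of D] real_differentiable_def by metis
  then have "l = W r" using DERIV_unique[OF r(3) Dd[OF r(1)]] by simp
  then have "D s - D \<tau> \<le> (s - \<tau>) * (W s + M)" using r Wle[of r] \<tau> by (auto intro!: mult_left_mono)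
  then have "- D \<tau> \<le> (s - \<tau>) * (W s + M)" using D0[of s] \<tau> by simp
  then have "- D \<tau> / (s - \<tau>) \<le> (s - \<tau>) * (W s + M) / (s - \<tau>)" using \<tau> by (intro divide_right_mono) auto
  also have "\<dots> = W s + M" using \<tau> by simp
  finally have "- D \<tau> / (s - \<tau>) \<le> W s + M" .
  then have "- D \<tau> / (s - \<tau>) - M \<le> W s" by linarith
  moreover have alg: "- d / a - b * d = - (1 / a + b) * d" for a b d :: real
    by (simp add: left_diff_distrib)
  have "- D \<tau> / (s - \<tau>) - M = - (1 / (s - \<tau>) + C0 * exp (K \<tau> * (s - \<tau>)) * (s - \<tau>)) * D \<tau>"
    unfolding M_def by (rule alg)
  ultimately show ?thesis by (simp add: D_def W_def)
qed

text \<open>One index serves as radius and as expansion constant, so that countably many closed sets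
  exhaust the points near which the flow map to time \<open>T\<close> is expanding.\<close>

definition expanding :: "real \<Rightarrow> (real \<Rightarrow> real \<Rightarrow> real) \<Rightarrow> nat \<Rightarrow> real set" where
  "expanding T Zt n = {x. \<forall>y. \<bar>y - x\<bar> < 1 / real (Suc n) \<longrightarrow> 1 / real (Suc n) * \<bar>y - x\<bar> \<le> \<bar>Zt y T - Zt x T\<bar>}"

section \<open>The flow from a positive time \<tau> to \<open>T\<close>\<close>

context
  fixes \<tau> T :: real and Zt :: "real \<Rightarrow> real \<Rightarrow> real"
  assumes \<tau>: "0 < \<tau>" "\<tau> < T" and Zt: "\<And>x. char_curve (Zt x)" "\<And>x. Zt x \<tau> = x"
begin

lemma Zt_eq: "char_curve z \<Longrightarrow> \<tau> \<le> s \<Longrightarrow> z s = Zt (z \<tau>) s"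
  by (rule char_curve_unique[OF _ Zt(1) \<tau>(1)]) (simp_all add: Zt(2))

lemma Zt_mono: "\<tau> \<le> s \<Longrightarrow> mono (\<lambda>x. Zt x s)"
  by (rule monoI, rule char_curve_order[OF Zt(1) Zt(1), of \<tau>]) (use \<tau> in \<open>auto simp: Zt(2)\<close>)

lemma Zt_lipschitz: "\<tau> \<le> s \<Longrightarrow> s \<le> T \<Longrightarrow> \<bar>Zt y s - Zt x s\<bar> \<le> exp (K \<tau> * (T - \<tau>)) * \<bar>y - x\<bar>"
proof -
  assume s: "\<tau> \<le> s" "s \<le> T"
  have "\<bar>Zt y s - Zt x s\<bar> \<le> exp (K \<tau> * (s - \<tau>)) * \<bar>y - x\<bar>"
    using char_curve_diff_upper[OF Zt(1)[of x] Zt(1)[of y] \<tau>(1) order_refl s(1)] by (simp add: Zt(2))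
  also have "\<dots> \<le> exp (K \<tau> * (T - \<tau>)) * \<bar>y - x\<bar>"
    using s K_nonneg[OF \<tau>(1)] by (intro mult_right_mono) (auto intro!: mult_left_mono)
  finally show ?thesis .
qed

text \<open>Since the flow expands distances only by a bounded factor, points that are still
  separated at time \<open>T\<close> were separated at all times since \<tau>.\<close>

lemma Zt_final_le: "\<tau> \<le> s \<Longrightarrow> s \<le> T \<Longrightarrow> exp (- K \<tau> * (T - \<tau>)) * \<bar>Zt y T - Zt x T\<bar> \<le> \<bar>Zt y s - Zt x s\<bar>"
proof -
  assume s: "\<tau> \<le> s" "s \<le> T"
  have "\<bar>Zt y T - Zt x T\<bar> \<le> exp (K \<tau> * (T - s)) * \<bar>Zt y s - Zt x s\<bar>"
    by (rule char_curve_diff_upper[OF Zt(1) Zt(1) \<tau>(1) s])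
  also have "\<dots> \<le> exp (K \<tau> * (T - \<tau>)) * \<bar>Zt y s - Zt x s\<bar>"
    using s K_nonneg[OF \<tau>(1)] by (intro mult_right_mono) (auto intro!: mult_left_mono)
  finally have "exp (- K \<tau> * (T - \<tau>)) * \<bar>Zt y T - Zt x T\<bar> \<le> exp (- K \<tau> * (T - \<tau>)) * (exp (K \<tau> * (T - \<tau>)) * \<bar>Zt y s - Zt x s\<bar>)"
    by (intro mult_left_mono) auto
  also have "\<dots> = \<bar>Zt y s - Zt x s\<bar>" by (simp add: mult.assoc[symmetric] exp_add[symmetric])
  finally show ?thesis .
qed

text \<open>Joint continuity provides the measurability for Fubini's theorem. The clamp keeps time
  in {\<tau>..T}, where the flow is Lipschitz in both variables.\<close>

lemma continuous_Zt_joint: "continuous_on UNIV (\<lambda>p. Zt (fst p) (max \<tau> (min T (snd p))))"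
proof -
  define c where "c s = max \<tau> (min T s)" for s
  have c: "\<tau> \<le> c s" "c s \<le> T" "0 \<le> c s" for s using \<tau> by (auto simp: c_def)
  have cc: "\<bar>c s - c s'\<bar> \<le> \<bar>s - s'\<bar>" for s s' using \<tau> by (auto simp: c_def)
  have E: "1 \<le> exp (K \<tau> * (T - \<tau>))" using K_nonneg[OF \<tau>(1)] \<tau> by simp
  have "(exp (K \<tau> * (T - \<tau>)) + B0)-lipschitz_on UNIV (\<lambda>p. Zt (fst p) (c (snd p)))"
  proof (rule lipschitz_onI)
    fix p q :: "real \<times> real"
    have "\<bar>Zt (fst p) (c (snd p)) - Zt (fst q) (c (snd p))\<bar> \<le> exp (K \<tau> * (T - \<tau>)) * \<bar>fst p - fst q\<bar>"
      by (rule Zt_lipschitz[OF c(1,2)])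
    also have "\<dots> \<le> exp (K \<tau> * (T - \<tau>)) * dist p q"
      using dist_fst_le[of p q] by (intro mult_left_mono) (auto simp: dist_real_def)
    finally have 1: "\<bar>Zt (fst p) (c (snd p)) - Zt (fst q) (c (snd p))\<bar> \<le> exp (K \<tau> * (T - \<tau>)) * dist p q" .
    have "\<bar>Zt (fst q) (c (snd p)) - Zt (fst q) (c (snd q))\<bar> \<le> B0 * \<bar>c (snd p) - c (snd q)\<bar>"
      by (rule char_curve_lipschitz[OF Zt(1) c(3) c(3)])
    also have "\<dots> \<le> B0 * dist p q"
      using dist_snd_le[of p q] cc[of "snd p" "snd q"] B0_nonneg by (intro mult_left_mono) (auto simp: dist_real_def)
    finally have 2: "\<bar>Zt (fst q) (c (snd p)) - Zt (fst q) (c (snd q))\<bar> \<le> B0 * dist p q" .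
    show "dist (Zt (fst p) (c (snd p))) (Zt (fst q) (c (snd q))) \<le> (exp (K \<tau> * (T - \<tau>)) + B0) * dist p q"
      using 1 2 unfolding dist_real_def distrib_right by linarith
  qed (use E B0_nonneg in simp)
  then show ?thesis unfolding c_def by (rule lipschitz_on_continuous_on)
qed

lemma continuous_Zt_T: "continuous_on S (\<lambda>x. Zt x T)"
  by (rule continuous_on_if_lipschitz_real[where B="exp (K \<tau> * (T - \<tau>))"]) (rule Zt_lipschitz; use \<tau> in simp)

lemma closed_expanding: "closed (expanding T Zt n)"
proof -
  have "expanding T Zt n = {x. \<forall>y. 1 / real (Suc n) \<le> \<bar>y - x\<bar> \<or> 1 / real (Suc n) * \<bar>y - x\<bar> \<le> \<bar>Zt y T - Zt x T\<bar>}"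
    unfolding expanding_def by (simp only: imp_conv_disj not_less)
  also have "closed \<dots>"
    by (intro closed_Collect_all closed_Collect_disj closed_Collect_le continuous_intros continuous_Zt_T)
  finally show ?thesis .
qed

lemma negligible_image_nonexpanding:
  "negligible ((\<lambda>x. Zt x T) ` (- (\<Union>n. expanding T Zt n)))"
proof (rule negligible_image_nonexpanding_points)
  show "mono (\<lambda>x. Zt x T)" by (rule Zt_mono) (use \<tau> in simp)
  show "\<bar>Zt y T - Zt x T\<bar> \<le> exp (K \<tau> * (T - \<tau>)) * \<bar>y - x\<bar>" for x y
    by (rule Zt_lipschitz) (use \<tau> in auto)
  fix x c d :: real assume x: "x \<in> - (\<Union>n. expanding T Zt n)" and cd: "0 < c" "0 < d"
  obtain n where n: "1 / real (Suc n) < min c d" using nat_approx_posE[of "min c d"] cd by auto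
  have "x \<notin> expanding T Zt n" using x by blast
  then obtain y where y: "\<bar>y - x\<bar> < 1 / real (Suc n)" "\<bar>Zt y T - Zt x T\<bar> < 1 / real (Suc n) * \<bar>y - x\<bar>"
    by (auto simp: expanding_def not_le)
  have "y \<noteq> x" using y(2) by auto
  then have "0 < \<bar>y - x\<bar>" by simp
  moreover have "1 / real (Suc n) * \<bar>y - x\<bar> \<le> c * \<bar>y - x\<bar>" using n by (intro mult_right_mono) auto
  ultimately show "\<exists>y. 0 < \<bar>y - x\<bar> \<and> \<bar>y - x\<bar> < d \<and> \<bar>Zt y T - Zt x T\<bar> < c * \<bar>y - x\<bar>"
    using y n by (intro exI[of _ y]) auto
qed

text \<open>At a fixed time the flow map is expanding on \<open>expanding T Zt n\<close>, so the
  points it sends into the null set of bad oscillation form a null set. Fubini's theorem exchanges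
  the roles of x and s.\<close>

lemma negligible_non_lebesgue:
  "negligible {x. \<not> (AE s in lborel. x \<in> expanding T Zt n \<longrightarrow> s \<in> {\<tau>..T} \<longrightarrow> lebesgue_point (ux s) (Zt x s))}"
proof -
  define c where "c s = max \<tau> (min T s)" for s
  have c: "0 \<le> c s" for s using \<tau> by (auto simp: c_def)
  define osc where "osc k p = oscillation (ux (c (snd p))) (Zt (fst p) (c (snd p))) k" for k p
  have [measurable]: "(\<lambda>p. Zt (fst p) (c (snd p))) \<in> borel_measurable (borel \<Otimes>\<^sub>M borel)"
    unfolding c_def borel_prod by (rule borel_measurable_continuous_onI[OF continuous_Zt_joint])
  have [measurable]: "c \<in> borel_measurable borel" unfolding c_def by measurable
  have [measurable]: "expanding T Zt n \<in> sets borel" using closed_expanding by auto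
  have oscm[measurable]: "osc k \<in> borel_measurable (borel \<Otimes>\<^sub>M borel)" for k
  proof -
    have ind: "indicat_real {a..b} y = (if a \<le> y \<and> y \<le> b then 1 else 0)" for a b y :: real
      by (auto simp: indicator_def)
    show ?thesis unfolding osc_def oscillation_def set_lebesgue_integral_def ind
      by (intro borel_measurable_times borel_measurable_const lborel.borel_measurable_lebesgue_integral) measurable
  qed
  \<comment> \<open>Convergence is spelled out with countable quantifiers to make \<open>P\<close>
    jointly measurable.\<close>
  define P where "P x s \<longleftrightarrow> (x \<in> expanding T Zt n \<longrightarrow> s \<in> {\<tau>..T} \<longrightarrow> (\<forall>j::nat. \<exists>m. \<forall>k\<ge>m. \<bar>osc k (x, s)\<bar> < 1 / real (Suc j)))" for x s
  have P_iff: "P x s \<longleftrightarrow> (x \<in> expanding T Zt n \<longrightarrow> s \<in> {\<tau>..T} \<longrightarrow> oscillation (ux s) (Zt x s) \<longlonglongrightarrow> 0)" for x s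
  proof -
    have "s \<in> {\<tau>..T} \<Longrightarrow> c s = s" by (auto simp: c_def)
    then show ?thesis unfolding P_def tendsto_0_iff_countable by (auto simp: osc_def)
  qed
  have Pm: "{p \<in> space (lborel \<Otimes>\<^sub>M lborel). P (fst p) (snd p)} \<in> sets (lborel \<Otimes>\<^sub>M lborel)"
  proof -
    have "{p \<in> space (borel \<Otimes>\<^sub>M borel). P (fst p) (snd p)} \<in> sets (borel \<Otimes>\<^sub>M borel)"
      unfolding P_def by measurable
    then show ?thesis by (simp add: space_pair_measure cong: sets_pair_measure_cong)
  qed
  have "AE x in lborel. P x s" for s
  proof (cases "s \<in> {\<tau>..T}")
    case True
    then have s: "\<tau> \<le> s" "s \<le> T" "0 \<le> s" using \<tau> by auto
    define M where "M = {x. x \<in> expanding T Zt n \<and> \<not> oscillation (ux s) (Zt x s) \<longlonglongrightarrow> 0}"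
    have "negligible M"
    proof (rule negligible_if_locally_expanding_image[where f="\<lambda>x. Zt x s"])
      have "(\<lambda>x. Zt x s) ` M \<subseteq> {y. \<not> oscillation (ux s) y \<longlonglongrightarrow> 0}" by (auto simp: M_def)
      then show "negligible ((\<lambda>x. Zt x s) ` M)"
        using negligible_oscillation_not_tendsto_0[OF meas_ux_t[OF s(3)] int_ux2[OF s(3)]] negligible_subset by blast
      fix x assume x: "x \<in> M"
      define k where "k = exp (- K \<tau> * (T - \<tau>)) * (1 / real (Suc n))"
      have "k * \<bar>y - x\<bar> \<le> \<bar>Zt y s - Zt x s\<bar>" if y: "\<bar>y - x\<bar> < 1 / real (Suc n)" for y
      proof -
        have "1 / real (Suc n) * \<bar>y - x\<bar> \<le> \<bar>Zt y T - Zt x T\<bar>" using x y by (simp add: M_def expanding_def)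
        then have "exp (- K \<tau> * (T - \<tau>)) * (1 / real (Suc n) * \<bar>y - x\<bar>) \<le> exp (- K \<tau> * (T - \<tau>)) * \<bar>Zt y T - Zt x T\<bar>"
          by (intro mult_left_mono) auto
        also have "\<dots> \<le> \<bar>Zt y s - Zt x s\<bar>" by (rule Zt_final_le[OF s(1,2)])
        finally show ?thesis by (simp only: k_def mult.assoc)
      qed
      moreover have "0 < k" by (simp add: k_def)
      ultimately show "\<exists>d>0. \<exists>c>0. \<forall>y\<in>M. \<bar>y - x\<bar> < d \<longrightarrow> c * \<bar>y - x\<bar> \<le> \<bar>Zt y s - Zt x s\<bar>"
        by (intro exI[of _ "1 / real (Suc n)"]) auto
    qed
    moreover have "{x. \<not> P x s} \<subseteq> M" by (auto simp: P_iff M_def)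
    ultimately have "negligible {x. \<not> P x s}" by (rule negligible_subset)
    then show ?thesis by (rule AE_lborel_if_negligible)
  next
    case False
    then have "P x s" for x unfolding P_def by blast
    then show ?thesis by simp
  qed
  then have "AE s in lborel. AE x in lborel. P x s" by simp
  then have "AE x in lborel. AE s in lborel. P x s" using lborel_pair.AE_commute[OF Pm] by simp
  then have "negligible {x. \<not> (AE s in lborel. P x s)}" by (rule negligible_if_AE_lborel)
  moreover have "{x. \<not> (AE s in lborel. x \<in> expanding T Zt n \<longrightarrow> s \<in> {\<tau>..T} \<longrightarrow> lebesgue_point (ux s) (Zt x s))} \<subseteq> {x. \<not> (AE s in lborel. P x s)}"
  proof (intro subsetI CollectI)
    fix x assume "x \<in> {x. \<not> (AE s in lborel. x \<in> expanding T Zt n \<longrightarrow> s \<in> {\<tau>..T} \<longrightarrow> lebesgue_point (ux s) (Zt x s))}"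
    moreover have "AE s in lborel. x \<in> expanding T Zt n \<longrightarrow> s \<in> {\<tau>..T} \<longrightarrow> lebesgue_point (ux s) (Zt x s)" if "AE s in lborel. P x s"
      using that
    proof eventually_elim
      case (elim s)
      then show ?case
        using lebesgue_point_if_oscillation_tendsto_0[OF meas_ux_t int_ux2, of s] \<tau> by (auto simp: P_iff)
    qed
    ultimately show "\<not> (AE s in lborel. P x s)" by blast
  qed
  ultimately show ?thesis by (rule negligible_subset)
qed

text \<open>On {0..2 * \<tau>} everything is inherited from the hypothesis. Later, uniqueness comes
  from \<open>char_curve_unique\<close>, and slopes are bounded above by Oleinik and below by
  \<open>slope_lower_bound\<close>, whose reference distance at \<tau> is exchanged for the one at
  \<open>s\<close> by expansion.\<close>

lemma L_unique_extends:
  assumes \<zeta>: "\<zeta> \<in> L_unique_N u ux (2 * \<tau>) N" and N: "1 \<le> N" and T: "2 * \<tau> < T"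
    and z: "char_curve z" "z 0 = \<zeta>" and x: "z \<tau> \<in> expanding T Zt n"
    and leb: "AE s in lborel. z \<tau> \<in> expanding T Zt n \<longrightarrow> s \<in> {\<tau>..T} \<longrightarrow> lebesgue_point (ux s) (Zt (z \<tau>) s)"
  shows "\<zeta> \<in> L_unique u ux T"
proof -
  have uf: "w1 s = w2 s" if "char_curve w1" "char_curve w2" "w1 0 = \<zeta>" "w2 0 = \<zeta>" "s \<in> {0..2 * \<tau>}" for w1 w2 s
    using \<zeta> that unfolding L_unique_N_def unique_fwd_def characteristic_iff by blast
  have leb0: "AE s in lborel. s \<in> {0..2 * \<tau>} \<longrightarrow> lebesgue_point (ux s) (w s)" if "char_curve w" "w 0 = \<zeta>" for w
    using \<zeta> that unfolding L_unique_N_def characteristic_iff by blast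
  have om: "- real N \<le> (u s (v s) - u s (w s)) / (v s - w s) \<and> (u s (v s) - u s (w s)) / (v s - w s) \<le> real N"
    if "char_curve w" "w 0 = \<zeta>" "char_curve v" "v 0 \<in> {\<zeta> - 1 / real N<..<\<zeta>} \<union> {\<zeta><..<\<zeta> + 1 / real N}" "s \<in> {0..2 * \<tau>}" for w v s
    using \<zeta> that unfolding L_unique_N_def characteristic_iff by blast
  have weq: "w s = z s" if w: "char_curve w" "w 0 = \<zeta>" and s: "s \<in> {0..T}" for w s
  proof (cases "s \<le> 2 * \<tau>")
    case True
    then show ?thesis using uf[OF w(1) z(1) w(2) z(2)] s by simp
  next
    case False
    have "w (2 * \<tau>) = z (2 * \<tau>)" using uf[OF w(1) z(1) w(2) z(2)] \<tau> by simp
    then show ?thesis by (rule char_curve_unique[OF w(1) z(1), rotated 2]) (use False \<tau> in auto)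
  qed
  define \<kappa> where "\<kappa> = exp (- K \<tau> * (T - \<tau>)) * (1 / real (Suc n))"
  have \<kappa>: "0 < \<kappa>" by (simp add: \<kappa>_def)
  \<comment> \<open>For s > 2 * \<tau> the term 1 / (s - \<tau>) of \<open>slope_lower_bound\<close>
    is at most 1 / \<tau>. This is why the hypothesis reaches up to 2 * \<tau> while the flow starts
    at \<tau>.\<close>
  define M0 where "M0 = 1 / \<tau> + C0 * exp (K \<tau> * (T - \<tau>)) * (T - \<tau>)"
  have M0: "0 \<le> M0" using \<tau> C0_bounds(1) by (simp add: M0_def)
  \<comment> \<open>In this order: the old bound, Oleinik's upper bound, the lower bound for slopes,
    and a neighbourhood of \<zeta> so small that at time \<tau> it lies within 1 / (n + 1) of
    \<open>z \<tau>\<close>.\<close>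
  obtain N' :: nat where N': "max (max (real N) (K \<tau>)) (max (M0 / \<kappa>) (exp (real N * \<tau>) * real (Suc n))) < real N'"
    using reals_Archimedean2 by blast
  then have N'1: "real N < real N'" "K \<tau> < real N'" "M0 / \<kappa> < real N'" "exp (real N * \<tau>) * real (Suc n) < real N'"
    by auto
  have N'0: "0 < real N'" using N'1(1) by linarith
  have slope: "- real N' \<le> (u s (q s) - u s (p s)) / (q s - p s) \<and> (u s (q s) - u s (p s)) / (q s - p s) \<le> real N'"
    if pq: "char_curve p" "char_curve q" and lt: "p s < q s" and s: "2 * \<tau> < s" "s \<le> T"
      and exp: "\<kappa> * \<bar>q \<tau> - p \<tau>\<bar> \<le> \<bar>q s - p s\<bar>" for p q s
  proof -
    have ord: "p \<tau> \<le> q \<tau>"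
      using char_curve_order[OF pq(2,1), of \<tau> s] lt s \<tau> by fastforce
    have "u s (q s) - u s (p s) \<le> K \<tau> * (q s - p s)" by (rule oleinik[OF \<tau>(1)]) (use s \<tau> lt in auto)
    also have "\<dots> \<le> real N' * (q s - p s)" using N'1(2) lt by (intro mult_right_mono) auto
    finally have up: "(u s (q s) - u s (p s)) / (q s - p s) \<le> real N'" using lt by (simp add: divide_le_eq)
    have "q \<tau> - p \<tau> \<le> (q s - p s) / \<kappa>" using exp ord lt \<kappa> by (simp add: pos_le_divide_eq mult.commute)
    then have "M0 * (q \<tau> - p \<tau>) \<le> M0 * ((q s - p s) / \<kappa>)" using M0 by (rule mult_left_mono)
    also have "\<dots> = M0 / \<kappa> * (q s - p s)" by simp
    also have "\<dots> \<le> real N' * (q s - p s)" using N'1(3) lt by (intro mult_right_mono) auto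
    finally have 1: "M0 * (q \<tau> - p \<tau>) \<le> real N' * (q s - p s)" .
    have "(1 / (s - \<tau>) + C0 * exp (K \<tau> * (s - \<tau>)) * (s - \<tau>)) * (q \<tau> - p \<tau>) \<le> M0 * (q \<tau> - p \<tau>)"
    proof (rule mult_right_mono)
      have "1 / (s - \<tau>) \<le> 1 / \<tau>" using s \<tau> by (simp add: frac_le)
      moreover have "C0 * exp (K \<tau> * (s - \<tau>)) * (s - \<tau>) \<le> C0 * exp (K \<tau> * (T - \<tau>)) * (T - \<tau>)"
        using s \<tau> C0_bounds(1) K_nonneg[OF \<tau>(1)] by (intro mult_mono mult_nonneg_nonneg) (auto intro!: mult_left_mono)
      ultimately show "1 / (s - \<tau>) + C0 * exp (K \<tau> * (s - \<tau>)) * (s - \<tau>) \<le> M0" by (simp add: M0_def)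
    qed (use ord in simp)
    moreover have "- (1 / (s - \<tau>) + C0 * exp (K \<tau> * (s - \<tau>)) * (s - \<tau>)) * (q \<tau> - p \<tau>) \<le> u s (q s) - u s (p s)"
      by (rule slope_lower_bound[OF pq \<tau>(1) _ ord]) (use s \<tau> in simp)
    ultimately have "- (real N' * (q s - p s)) \<le> u s (q s) - u s (p s)"
      using 1 by (simp only: mult_minus_left)
    then have "- real N' \<le> (u s (q s) - u s (p s)) / (q s - p s)" using lt by (simp add: pos_le_divide_eq)
    with up show ?thesis by blast
  qed
  have "\<zeta> \<in> L_unique_N u ux T N'"
    unfolding L_unique_N_def
  proof (intro CollectI conjI allI impI)
    show "unique_fwd u ux \<zeta> T" unfolding unique_fwd_def characteristic_iff using weq by metis
    fix w assume "characteristic u ux \<zeta> w"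
    then have w: "char_curve w" "w 0 = \<zeta>" by (auto simp: characteristic_iff)
    have w\<tau>: "w \<tau> = z \<tau>" using weq[OF w] \<tau> by simp
    show "AE s in lborel. s \<in> {0..T} \<longrightarrow> lebesgue_point (ux s) (w s)"
      using leb leb0[OF w]
    proof eventually_elim
      case (elim s)
      show ?case
      proof
        assume s: "s \<in> {0..T}"
        show "lebesgue_point (ux s) (w s)"
        proof (cases "s \<le> 2 * \<tau>")
          case True
          then show ?thesis using elim(2) s by simp
        next
          case False
          then have "w s = Zt (z \<tau>) s" using Zt_eq[OF w(1), of s] w\<tau> \<tau> by simp
          then show ?thesis using elim(1) x False s \<tau> by simp
        qed
      qed
    qed
    show "\<forall>\<eta>\<in>{\<zeta> - 1 / real N'<..<\<zeta>} \<union> {\<zeta><..<\<zeta> + 1 / real N'}. \<forall>\<eta>c. characteristic u ux \<eta> \<eta>c \<longrightarrow>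
        (\<forall>s\<in>{0..T}. - real N' \<le> (u s (\<eta>c s) - u s (w s)) / (\<eta>c s - w s) \<and> (u s (\<eta>c s) - u s (w s)) / (\<eta>c s - w s) \<le> real N')"
    proof (intro ballI allI impI)
      fix \<eta> v s
      assume \<eta>: "\<eta> \<in> {\<zeta> - 1 / real N'<..<\<zeta>} \<union> {\<zeta><..<\<zeta> + 1 / real N'}" and "characteristic u ux \<eta> v" and s: "s \<in> {0..T}"
      then have v: "char_curve v" "v 0 = \<eta>" by (auto simp: characteristic_iff)
      have "1 / real N' \<le> 1 / real N" using N'1(1) N by (simp add: frac_le)
      then have v0: "v 0 \<in> {\<zeta> - 1 / real N<..<\<zeta>} \<union> {\<zeta><..<\<zeta> + 1 / real N}" using \<eta> v by auto
      note om' = om[OF w v(1) v0]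
      show "- real N' \<le> (u s (v s) - u s (w s)) / (v s - w s) \<and> (u s (v s) - u s (w s)) / (v s - w s) \<le> real N'"
      proof (cases "s \<le> 2 * \<tau>")
        case True
        then show ?thesis using om'[of s] s N'1(1) by auto
      next
        case False
        \<comment> \<open>From time 0 to \<tau> the assumed slope bound \<open>N\<close> replaces
          Oleinik's bound, which degenerates at time 0.\<close>
        have "\<bar>v \<tau> - w \<tau>\<bar> \<le> exp (real N * \<tau> - real N * 0) * \<bar>v 0 - w 0\<bar>"
        proof (rule one_sided_Lipschitz_upper[where d="\<lambda>r. v r - w r" and d'="\<lambda>r. u r (v r) - u r (w r)"
              and k="\<lambda>r. real N" and Kp="\<lambda>r. real N * r"])
          show "continuous_on {0..\<tau>} (\<lambda>r. v r - w r)" using v w by (intro continuous_on_diff char_curve_cont) auto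
          fix r assume r: "0 < r" "r < \<tau>"
          show "((\<lambda>r. v r - w r) has_real_derivative u r (v r) - u r (w r)) (at r)"
            by (rule char_curve_diff_deriv[OF w(1) v(1) r(1)])
          show "((*) (real N) has_real_derivative real N) (at r)" by (auto intro!: derivative_eq_intros)
          show "(v r - w r) * (u r (v r) - u r (w r)) \<le> real N * (v r - w r)\<^sup>2"
          proof (cases "v r = w r")
            case False
            have "(u r (v r) - u r (w r)) / (v r - w r) * (v r - w r)\<^sup>2 \<le> real N * (v r - w r)\<^sup>2"
              using om'[of r] r \<tau> by (intro mult_right_mono) auto
            then show ?thesis using False by (simp add: power2_eq_square mult.commute)
          qed simp
        qed (use \<tau> in \<open>auto intro!: continuous_intros\<close>)
        also have "\<dots> = exp (real N * \<tau>) * \<bar>v 0 - w 0\<bar>" by simp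
        also have "\<dots> \<le> exp (real N * \<tau>) * (1 / real N')"
        proof (rule mult_left_mono)
          show "\<bar>v 0 - w 0\<bar> \<le> 1 / real N'" using \<eta> v(2) w(2) by auto
        qed simp
        also have "\<dots> < 1 / real (Suc n)"
          using N'1(4) N'0 by (simp add: field_simps)
        finally have near: "\<bar>v \<tau> - z \<tau>\<bar> < 1 / real (Suc n)" by (simp add: w\<tau>)
        have "\<kappa> * \<bar>v \<tau> - w \<tau>\<bar> \<le> exp (- K \<tau> * (T - \<tau>)) * \<bar>Zt (v \<tau>) T - Zt (z \<tau>) T\<bar>"
          using x near unfolding \<kappa>_def mult.assoc by (intro mult_left_mono) (auto simp: expanding_def w\<tau>)
        also have "\<dots> \<le> \<bar>Zt (v \<tau>) s - Zt (z \<tau>) s\<bar>" by (rule Zt_final_le) (use s False \<tau> in auto)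
        also have "\<dots> = \<bar>v s - w s\<bar>" using Zt_eq[OF v(1), of s] Zt_eq[OF w(1), of s] w\<tau> False \<tau> by simp
        finally have ex: "\<kappa> * \<bar>v \<tau> - w \<tau>\<bar> \<le> \<bar>v s - w s\<bar>" .
        consider "v s = w s" | "w s < v s" | "v s < w s" by linarith
        then show ?thesis
        proof cases
          case 1
          \<comment> \<open>Curves that have met give the quotient 0 / 0 = 0.\<close>
          then show ?thesis by simp
        next
          case 2
          then show ?thesis using slope[OF w(1) v(1) 2] False s ex by simp
        next
          case 3
          have "(u s (v s) - u s (w s)) / (v s - w s) = (u s (w s) - u s (v s)) / (w s - v s)"
            using 3 by (simp add: divide_simps) (simp add: algebra_simps)
          then show ?thesis using slope[OF v(1) w(1) 3] False s ex by (simp add: abs_minus_commute)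
        qed
      qed
    qed
  qed
  moreover have "N' \<in> {1..}" using N'0 by simp
  ultimately show ?thesis unfolding L_unique_def by blast
qed

end

end

section \<open>Assembling the exceptional sets at time \<open>T\<close>\<close>

theorem theorem5p1:
  fixes u ux :: "real \<Rightarrow> real \<Rightarrow> real" and u0 :: "real \<Rightarrow> real"
    and S Z :: "real \<Rightarrow> real set"
  assumes "dissipative u ux u0"
    and "admissible_family u ux S"
    and "\<forall>T>0. Z T \<in> null_sets lebesgue \<and> S T = L_unique u ux T - Z T"
  shows "\<exists>T0>0. \<forall>T. 0 < T \<and> T \<le> T0 \<longrightarrow>
           UNIV - image_at u ux (S T) T \<in> null_sets lebesgue"
proof (intro exI[of _ 1] conjI allI impI)
  interpret camassa_holm u ux u0 by unfold_locales (rule assms(1))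
  fix T :: real assume "0 < T \<and> T \<le> 1"
  then have T: "0 < T" by simp
  \<comment> \<open>The initial points that lie in no \<open>S t\<close> or lie in
    \<open>Z T\<close>. Their images at time \<open>T\<close> are null by
    \<open>negligible_image_of_negligible\<close>.\<close>
  define N0 where "N0 = (UNIV - (\<Union>T\<in>{0<..}. S T)) \<union> Z T"
  have N0: "negligible N0"
    using assms(2,3) T by (auto simp: N0_def admissible_family_def negligible_iff_null_sets)
  \<comment> \<open>Countably many starting times suffice. Since 2 * \<tau> k = 1 / (k + 1), the
    hypothesis of \<open>L_unique_extends\<close> is supplied by
    \<open>S (1 / (k + 1))\<close>.\<close>
  define \<tau> where "\<tau> k = 1 / (2 * real (Suc k))" for k
  define I where "I = {k. 2 * \<tau> k < T}"
  have \<tau>: "0 < \<tau> k" "k \<in> I \<Longrightarrow> \<tau> k < T" for k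
  proof -
    show "0 < \<tau> k" by (simp add: \<tau>_def)
    then show "k \<in> I \<Longrightarrow> \<tau> k < T" by (simp add: I_def)
  qed
  have "\<exists>z. char_curve z \<and> z (\<tau> k) = x" for k x by (rule char_curve_through) blast
  then obtain Zt where Zt: "\<And>k x. char_curve (Zt k x)" "\<And>k x. Zt k x (\<tau> k) = x" by metis
  define E where "E k = expanding T (Zt k)" for k
  define A where "A k = - (\<Union>n. E k n)" for k
  define B where "B k n = {x. \<not> (AE s in lborel. x \<in> E k n \<longrightarrow> s \<in> {\<tau> k..T} \<longrightarrow> lebesgue_point (ux s) (Zt k x s))}" for k n
  \<comment> \<open>\<open>A k\<close> may have positive measure and only its image is null, whereas
    the sets \<open>B k n\<close> are null themselves and keep null images by the Lipschitz
    property.\<close>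
  define Bad where "Bad k = (\<lambda>x. Zt k x T) ` (A k) \<union> (\<lambda>x. Zt k x T) ` (\<Union>n. B k n)" for k
  have negA: "negligible ((\<lambda>x. Zt k x T) ` (A k))" if "k \<in> I" for k
    unfolding A_def E_def by (rule negligible_image_nonexpanding[OF \<tau>(1) \<tau>(2)[OF that] Zt])
  have negB: "negligible ((\<lambda>x. Zt k x T) ` (\<Union>n. B k n))" if k: "k \<in> I" for k
  proof (rule negligible_locally_Lipschitz_image[OF order_refl])
    show "negligible (\<Union>n. B k n)"
      by (rule negligible_Union_nat) (unfold B_def E_def, rule negligible_non_lebesgue[OF \<tau>(1) \<tau>(2)[OF k] Zt])
    fix x
    show "\<exists>W C. open W \<and> x \<in> W \<and> (\<forall>y\<in>(\<Union>n. B k n) \<inter> W. norm (Zt k y T - Zt k x T) \<le> C * norm (y - x))"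
      using Zt_lipschitz[OF \<tau>(1) \<tau>(2)[OF k] Zt less_imp_le[OF \<tau>(2)[OF k]] order_refl]
      by (intro exI[of _ UNIV] exI[of _ "exp (K (\<tau> k) * (T - \<tau> k))"]) simp
  qed
  have "negligible (Bad k)" if "k \<in> I" for k
    unfolding Bad_def using negA[OF that] negB[OF that] by (rule negligible_Un)
  then have "negligible (\<Union>(Bad ` I))" by (intro negligible_countable_Union) auto
  with negligible_image_of_negligible[OF N0 T]
  have neg: "negligible ({z T | z. char_curve z \<and> z 0 \<in> N0} \<union> \<Union>(Bad ` I))" by (rule negligible_Un)
  have "UNIV - image_at u ux (S T) T \<subseteq> {z T | z. char_curve z \<and> z 0 \<in> N0} \<union> \<Union>(Bad ` I)"
  proof
    fix y assume y: "y \<in> UNIV - image_at u ux (S T) T"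
    \<comment> \<open>Any characteristic through \<open>y\<close> at time \<open>T\<close> will do
      for tracing \<open>y\<close> back to an initial point.\<close>
    obtain z where z: "char_curve z" "z T = y" by (rule char_curve_through)
    show "y \<in> {z T | z. char_curve z \<and> z 0 \<in> N0} \<union> \<Union>(Bad ` I)"
    proof (cases "z 0 \<in> N0")
      case True
      then show ?thesis using z by blast
    next
      case False
      then obtain t where t: "0 < t" "z 0 \<in> S t" and nZ: "z 0 \<notin> Z T" by (auto simp: N0_def)
      obtain k where k: "1 / real (Suc k) < min t T" using nat_approx_posE[of "min t T"] t(1) T by auto
      have 2: "2 * \<tau> k = 1 / real (Suc k)" by (simp add: \<tau>_def divide_simps)
      have kI: "k \<in> I" using k by (simp add: I_def 2)
      \<comment> \<open>The sets grow as time decreases, so \<open>t\<close> may be replaced by the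
        smaller 1 / (k + 1).\<close>
      have "S t \<subseteq> S (2 * \<tau> k)" using assms(2) k \<tau>(1)[of k] unfolding admissible_family_def 2 by auto
      then have "z 0 \<in> L_unique u ux (2 * \<tau> k)" using t(2) assms(3) \<tau>(1)[of k] by auto
      then obtain N where N: "1 \<le> N" "z 0 \<in> L_unique_N u ux (2 * \<tau> k) N" by (auto simp: L_unique_def)
      define x where "x = z (\<tau> k)"
      have yx: "y = Zt k x T"
        using Zt_eq[OF \<tau>(1) \<tau>(2)[OF kI] Zt z(1) less_imp_le[OF \<tau>(2)[OF kI]]] z(2) by (simp add: x_def)
      have "x \<in> A k \<union> (\<Union>n. B k n)"
      proof (rule ccontr)
        assume nb: "x \<notin> A k \<union> (\<Union>n. B k n)"
        then obtain n where n: "x \<in> E k n" "x \<notin> B k n" by (auto simp: A_def)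
        have "z 0 \<in> L_unique u ux T"
        proof (rule L_unique_extends[OF \<tau>(1) \<tau>(2)[OF kI] Zt N(2,1) _ z(1) refl])
          show "2 * \<tau> k < T" using kI by (simp add: I_def)
          show "z (\<tau> k) \<in> expanding T (Zt k) n" using n(1) by (simp add: x_def E_def)
          show "AE s in lborel. z (\<tau> k) \<in> expanding T (Zt k) n \<longrightarrow> s \<in> {\<tau> k..T} \<longrightarrow> lebesgue_point (ux s) (Zt k (z (\<tau> k)) s)"
            using n(2) unfolding B_def x_def E_def by blast
        qed
        \<comment> \<open>Here the form of \<open>S T\<close> enters: outside \<open>Z T\<close>,
          membership in \<open>L_unique\<close> is enough.\<close>
        then have "z 0 \<in> S T" using assms(3) T nZ by auto
        moreover have "characteristic u ux (z 0) z" using z(1) by (simp add: char_curve_def)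
        ultimately have "y \<in> image_at u ux (S T) T" using z(2) unfolding image_at_def by blast
        then show False using y by blast
      qed
      then have "y \<in> Bad k" unfolding Bad_def yx by blast
      then show ?thesis using kI by blast
    qed
  qed
  then have "negligible (UNIV - image_at u ux (S T) T)" using neg negligible_subset by blast
  then show "UNIV - image_at u ux (S T) T \<in> null_sets lebesgue" by (simp add: negligible_iff_null_sets)
qed simp

end
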